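(* (i) Every non-medial hamiltonian distributive quasigroup has at least $729$ elements. (ii) Let $\mathcal C=\mathbb Z_{27}\times\mathbb Z_9\times\mathbb Z_3$, and for $a=(a(0),a(1),a(2))$, $b=(b(0),b(1),b(2))$ in $\mathcal C$ put $$a\bigtriangledown_1 b=\bigl(26a(0)+3a(1)+2b(0)+24b(1)+18a(0)a(2)b(1)+9a(0)b(1)b(2)+9a(1)a(2)b(0)+18a(1)b(0)b(2),\ 8a(1)+3a(2)+2b(1)+6b(2),\ 2a(2)+2b(2)\bigr),$$ $$a\bigtriangledown_2 b=\bigl(26a(0)+3a(1)+2b(0)+24b(1)+9a(0)a(2)b(1)+18a(0)b(1)b(2)+18a(1)a(2)b(0)+9a(1)b(0)b(2),\ 8a(1)+3a(2)+2b(1)+6b(2),\ 2a(2)+2b(2)\bigr).$$ Then $\mathcal C(\bigtriangledown_1)$ and $\mathcal C(\bigtriangledown_2)$ are (up to isomorphism) the only non-medial hamiltonian distributive quasigroups of order $729$; that is, both are non-medial hamiltonian distributive quasigroups of order $729$, and every such quasigroup is isomorphic to one of them. These two quasigroups are not isomorphic, but they are anti-isomorphic.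
   Context: A quasigroup is a non-empty set $Q$ with a binary operation such that for all $a,b\in Q$ there are unique $x,y\in Q$ with $ax=b=ya$. It is medial if $(ax)(yb)=(ay)(xb)$ for all $a,b,x,y$; it is distributive if $x(ab)=(xa)(xb)$ and $(ab)x=(ax)(bx)$ for all $a,b,x$. A normal congruence of $Q$ is an equivalence $r$ on $Q$ such that for all $a,b,c,d\in Q$: if two of the three relations $(a,b)\in r$, $(c,d)\in r$, $(ac,bd)\in r$ hold, then so does the third. A subquasigroup (a subset which is a quasigroup under the induced operation) is normal in $Q$ if it is a block of some normal congruence of $Q$. A quasigroup is hamiltonian if every subquasigroup of it is normal. Two quasigroups $Q(\cdot)$ and $P( * )$ are anti-isomorphic if there is a bijection $\xi:Q\to P$ with $\xi(a\cdot b)=\xi(b)*\xi(a)$ for all $a,b\in Q$. In the formulas, the first, second and third coordinates are computed in $\mathbb Z_{27}$, $\mathbb Z_9$ and $\mathbb Z_3$ respectively; products such as $3a(1)$ in the first coordinate are computed with arbitrary integer representatives (the result is well defined because of the coefficients). *)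

theory Defs
  imports "HOL-Number_Theory.Number_Theory"
begin

definition quasigroup :: "'a set \<Rightarrow> ('a \<Rightarrow> 'a \<Rightarrow> 'a) \<Rightarrow> bool" where
  "quasigroup Q f \<longleftrightarrow>
     Q \<noteq> {} \<and>
     (\<forall>a\<in>Q. \<forall>b\<in>Q. f a b \<in> Q) \<and>
     (\<forall>a\<in>Q. \<forall>b\<in>Q. (\<exists>!x. x \<in> Q \<and> f a x = b) \<and> (\<exists>!y. y \<in> Q \<and> f y a = b))"

definition medial :: "'a set \<Rightarrow> ('a \<Rightarrow> 'a \<Rightarrow> 'a) \<Rightarrow> bool" where
  "medial Q f \<longleftrightarrow>
     (\<forall>a\<in>Q. \<forall>b\<in>Q. \<forall>x\<in>Q. \<forall>y\<in>Q. f (f a x) (f y b) = f (f a y) (f x b))"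

definition distributive :: "'a set \<Rightarrow> ('a \<Rightarrow> 'a \<Rightarrow> 'a) \<Rightarrow> bool" where
  "distributive Q f \<longleftrightarrow>
     (\<forall>a\<in>Q. \<forall>b\<in>Q. \<forall>x\<in>Q.
        f x (f a b) = f (f x a) (f x b) \<and> f (f a b) x = f (f a x) (f b x))"

definition normal_congruence :: "'a set \<Rightarrow> ('a \<Rightarrow> 'a \<Rightarrow> 'a) \<Rightarrow> ('a \<times> 'a) set \<Rightarrow> bool" where
  "normal_congruence Q f r \<longleftrightarrow>
     equiv Q r \<and>
     (\<forall>a\<in>Q. \<forall>b\<in>Q. \<forall>c\<in>Q. \<forall>d\<in>Q.
        ((a, b) \<in> r \<and> (c, d) \<in> r \<longrightarrow> (f a c, f b d) \<in> r) \<and>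
        ((a, b) \<in> r \<and> (f a c, f b d) \<in> r \<longrightarrow> (c, d) \<in> r) \<and>
        ((c, d) \<in> r \<and> (f a c, f b d) \<in> r \<longrightarrow> (a, b) \<in> r))"

definition subquasigroup :: "'a set \<Rightarrow> 'a set \<Rightarrow> ('a \<Rightarrow> 'a \<Rightarrow> 'a) \<Rightarrow> bool" where
  "subquasigroup H Q f \<longleftrightarrow> H \<subseteq> Q \<and> quasigroup H f"

definition normal_subquasigroup :: "'a set \<Rightarrow> 'a set \<Rightarrow> ('a \<Rightarrow> 'a \<Rightarrow> 'a) \<Rightarrow> bool" where
  "normal_subquasigroup H Q f \<longleftrightarrow>
     subquasigroup H Q f \<and> (\<exists>r. normal_congruence Q f r \<and> H \<in> Q // r)"

definition hamiltonian :: "'a set \<Rightarrow> ('a \<Rightarrow> 'a \<Rightarrow> 'a) \<Rightarrow> bool" where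
  "hamiltonian Q f \<longleftrightarrow> (\<forall>H. subquasigroup H Q f \<longrightarrow> normal_subquasigroup H Q f)"

definition nonmedial_hamiltonian_distributive_quasigroup ::
    "'a set \<Rightarrow> ('a \<Rightarrow> 'a \<Rightarrow> 'a) \<Rightarrow> bool" where
  "nonmedial_hamiltonian_distributive_quasigroup Q f \<longleftrightarrow>
     quasigroup Q f \<and> distributive Q f \<and> hamiltonian Q f \<and> \<not> medial Q f"

definition isomorphic ::
    "'a set \<Rightarrow> ('a \<Rightarrow> 'a \<Rightarrow> 'a) \<Rightarrow> 'b set \<Rightarrow> ('b \<Rightarrow> 'b \<Rightarrow> 'b) \<Rightarrow> bool" where
  "isomorphic Q f P g \<longleftrightarrow>
     (\<exists>h. bij_betw h Q P \<and> (\<forall>a\<in>Q. \<forall>b\<in>Q. h (f a b) = g (h a) (h b)))"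

definition anti_isomorphic ::
    "'a set \<Rightarrow> ('a \<Rightarrow> 'a \<Rightarrow> 'a) \<Rightarrow> 'b set \<Rightarrow> ('b \<Rightarrow> 'b \<Rightarrow> 'b) \<Rightarrow> bool" where
  "anti_isomorphic Q f P g \<longleftrightarrow>
     (\<exists>h. bij_betw h Q P \<and> (\<forall>a\<in>Q. \<forall>b\<in>Q. h (f a b) = g (h b) (h a)))"

text \<open>Residue classes modulo 27, 9 and 3 are represented by their least non-negative integer
  representatives. The lemma \<open>nabla_cong\<close> below shows that the operations do not depend on
  this choice of representatives.\<close>

definition carrier_C :: "(int \<times> int \<times> int) set" where
  "carrier_C = {0..<27} \<times> {0..<9} \<times> {0..<3}"

fun nabla1 :: "int \<times> int \<times> int \<Rightarrow> int \<times> int \<times> int \<Rightarrow> int \<times> int \<times> int" where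
  "nabla1 (a0, a1, a2) (b0, b1, b2) =
     ((26 * a0 + 3 * a1 + 2 * b0 + 24 * b1
         + 18 * a0 * a2 * b1 + 9 * a0 * b1 * b2 + 9 * a1 * a2 * b0 + 18 * a1 * b0 * b2) mod 27,
      (8 * a1 + 3 * a2 + 2 * b1 + 6 * b2) mod 9,
      (2 * a2 + 2 * b2) mod 3)"

fun nabla2 :: "int \<times> int \<times> int \<Rightarrow> int \<times> int \<times> int \<Rightarrow> int \<times> int \<times> int" where
  "nabla2 (a0, a1, a2) (b0, b1, b2) =
     ((26 * a0 + 3 * a1 + 2 * b0 + 24 * b1
         + 9 * a0 * a2 * b1 + 18 * a0 * b1 * b2 + 18 * a1 * a2 * b0 + 9 * a1 * b0 * b2) mod 27,
      (8 * a1 + 3 * a2 + 2 * b1 + 6 * b2) mod 9,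
      (2 * a2 + 2 * b2) mod 3)"

lemma cong_scale:
  fixes x y :: int
  assumes "[x = y] (mod m)" and "n dvd k * m"
  shows "[k * x = k * y] (mod n)"
proof -
  have "m dvd x - y"
    using assms(1) by (simp only: cong_iff_dvd_diff)
  then have "k * m dvd k * (x - y)"
    by (rule mult_dvd_mono[OF dvd_refl])
  then have "n dvd k * (x - y)"
    by (rule dvd_trans[OF assms(2)])
  then show ?thesis
    by (simp only: cong_iff_dvd_diff right_diff_distrib)
qed

lemma nabla_cong:
  fixes a0 a1 a2 b0 b1 b2 a0' a1' a2' b0' b1' b2' :: int
  assumes a0: "[a0 = a0'] (mod 27)" and a1: "[a1 = a1'] (mod 9)" and a2: "[a2 = a2'] (mod 3)"
    and b0: "[b0 = b0'] (mod 27)" and b1: "[b1 = b1'] (mod 9)" and b2: "[b2 = b2'] (mod 3)"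
  shows "nabla1 (a0, a1, a2) (b0, b1, b2) = nabla1 (a0', a1', a2') (b0', b1', b2')"
    and "nabla2 (a0, a1, a2) (b0, b1, b2) = nabla2 (a0', a1', a2') (b0', b1', b2')"
proof -
  note sc = cong_scale[OF a0] cong_scale[OF a1] cong_scale[OF a2]
    cong_scale[OF b0] cong_scale[OF b1] cong_scale[OF b2]
  have lin2: "[8 * a1 + 3 * a2 + 2 * b1 + 6 * b2 = 8 * a1' + 3 * a2' + 2 * b1' + 6 * b2'] (mod 9)"
    by (intro cong_add sc) simp_all
  have lin3: "[2 * a2 + 2 * b2 = 2 * a2' + 2 * b2'] (mod 3)"
    by (intro cong_add sc) simp_all
  have L: "[26 * a0 + 3 * a1 + 2 * b0 + 24 * b1 = 26 * a0' + 3 * a1' + 2 * b0' + 24 * b1'] (mod 27)"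
    by (intro cong_add sc) simp_all
  have c: "[a0 = a0'] (mod 3)" "[a1 = a1'] (mod 3)" "[b0 = b0'] (mod 3)" "[b1 = b1'] (mod 3)"
    by (rule cong_dvd_modulus[OF a0], simp, rule cong_dvd_modulus[OF a1], simp,
        rule cong_dvd_modulus[OF b0], simp, rule cong_dvd_modulus[OF b1], simp)
  have m: "[k * x * y * z = k * x' * y' * z'] (mod 27)"
    if "[x = x'] (mod 3)" "[y = y'] (mod 3)" "[z = z'] (mod 3)" "9 dvd k"
    for k x y z x' y' z' :: int
    using cong_scale[OF cong_mult[OF cong_mult[OF that(1,2)] that(3)], of 27 k]
      mult_dvd_mono[OF that(4), of 3 3]
    by (simp add: mult.assoc)
  have T: "[26 * a0 + 3 * a1 + 2 * b0 + 24 * b1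
         + p * a0 * a2 * b1 + q * a0 * b1 * b2 + q * a1 * a2 * b0 + p * a1 * b0 * b2
       = 26 * a0' + 3 * a1' + 2 * b0' + 24 * b1'
         + p * a0' * a2' * b1' + q * a0' * b1' * b2' + q * a1' * a2' * b0' + p * a1' * b0' * b2'] (mod 27)"
    if p: "9 dvd p" and q: "9 dvd q" for p q
    by (rule cong_add[OF cong_add[OF cong_add[OF cong_add[OF L
          m[OF c(1) a2 c(4) p]] m[OF c(1) c(4) b2 q]] m[OF c(2) a2 c(3) q]] m[OF c(2) c(3) b2 p]])
  show "nabla1 (a0, a1, a2) (b0, b1, b2) = nabla1 (a0', a1', a2') (b0', b1', b2')"
    unfolding nabla1.simps prod.inject
    by (intro conjI T[of 18 9, unfolded cong_def] lin2[unfolded cong_def] lin3[unfolded cong_def])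
      simp_all
  show "nabla2 (a0, a1, a2) (b0, b1, b2) = nabla2 (a0', a1', a2') (b0', b1', b2')"
    unfolding nabla2.simps prod.inject
    by (intro conjI T[of 9 18, unfolded cong_def] lin2[unfolded cong_def] lin3[unfolded cong_def])
      simp_all
qed

end

theory Submission
  imports Defs
begin

text \<open>Fix \<open>e\<close> in a distributive quasigroup \<open>Q\<close>. Belousov's loop \<open>x + y = (x / e)(e \ y)\<close> is a commutative
  Moufang loop, and the product is \<open>F x + G y\<close> with \<open>F x = x e = \<zeta> x - x\<close>, \<open>G x = e x = 2 x - \<zeta> x\<close> for an
  endomorphism \<open>\<zeta>\<close> into the centre \<open>Z\<close>, which also contains all \<open>3 x\<close>. If \<open>Q\<close> is hamiltonian, every
  associator of \<open>x\<close> lies in each subquasigroup containing \<open>e\<close> and \<open>x\<close>. This makes the associators central,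
  trilinear and alternating.

  Let \<open>t = [a, b, c] \<noteq> 0\<close> and let \<open>N\<close> be maximal among the subgroups of \<open>Z\<close> that are closed under \<open>\<zeta>\<close> and
  avoid \<open>t\<close>. The elements \<open>i a + j b + k c + z\<close> form \<open>27 |Z|\<close> elements; by the hamiltonian property the
  fibres modulo \<open>N\<close> of \<open>x \<mapsto> (3 x, \<zeta> x)\<close> on them lie in cosets of \<open>N + {0, t, -t}\<close>, and the image lies in
  \<open>{(u, v). \<zeta> u = 3 v}\<close>. Comparing cardinalities gives \<open>|Z| \<ge> 27 |N|\<close>, so \<open>|Q| \<ge> 729\<close>. In the case of
  equality the map onto these pairs is surjective, which yields a basis with \<open>\<zeta> a = 0\<close>, \<open>\<zeta> b = 3 a\<close>,
  \<open>\<zeta> c = 3 b\<close>, \<open>3 c = 0\<close> and \<open>[a, b, c] = \<plusminus>9 a\<close>; the sign is the only remaining invariant.\<close>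

section \<open>The commutative Moufang loop of a distributive quasigroup\<close>

text \<open>The comparison of cardinalities uses the map \<open>\<beta>\<close> sending (u, v) to
  \<zeta> u - 3 v, which vanishes on all pairs (3 x, \<zeta> x). Let S be the set of pairs of
  central elements sent into N, and R = N + 3 Z + \<zeta> Z, so that |R| |S| <= |Z|^2 |N|. The
  fibres are so small that at least 9 |Z| |N| members of S are congruent modulo N to a pair (3 x,
  \<zeta> x); hence |Z| >= 9 |R|. Moreover t lies in R: otherwise R = N by maximality, 3 and \<zeta>
  annihilate Z modulo N, and then Z is contained in N + {0, t, -t}, against |Z| >= 9 |R|. So |R| >=
  3 |N|, and 729 arises as 27 * 9 * 3. The maximality of N replaces the passage to a quotient with a
  smallest nonzero submodule. Since neither this quotient nor a quotient loop is formed, every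
  cardinality is estimated by an explicit injection between subsets of Q, Z and N. Finiteness of Q
  may be assumed, as the bound on the order leaves infinite quasigroups aside.\<close>

locale belousov_loop =
  fixes Q :: "'a set" and add :: "'a \<Rightarrow> 'a \<Rightarrow> 'a" (infixl "\<boxplus>" 65) and e :: 'a
    and F G :: "'a \<Rightarrow> 'a"
  assumes add_closed [simp, intro]: "x \<in> Q \<Longrightarrow> y \<in> Q \<Longrightarrow> x \<boxplus> y \<in> Q"
    and e_closed [simp, intro]: "e \<in> Q"
    and F_closed [simp, intro]: "x \<in> Q \<Longrightarrow> F x \<in> Q"
    and G_closed [simp, intro]: "x \<in> Q \<Longrightarrow> G x \<in> Q"
    and e_add [simp]: "x \<in> Q \<Longrightarrow> e \<boxplus> x = x"
    and add_e [simp]: "x \<in> Q \<Longrightarrow> x \<boxplus> e = x"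
    and left_cancel: "x \<boxplus> y = x \<boxplus> w \<Longrightarrow> x \<in> Q \<Longrightarrow> y \<in> Q \<Longrightarrow> w \<in> Q \<Longrightarrow> y = w"
    and left_solve: "x \<in> Q \<Longrightarrow> y \<in> Q \<Longrightarrow> \<exists>w\<in>Q. x \<boxplus> w = y"
    and F_add: "x \<in> Q \<Longrightarrow> y \<in> Q \<Longrightarrow> F (x \<boxplus> y) = F x \<boxplus> F y"
    and G_add: "x \<in> Q \<Longrightarrow> y \<in> Q \<Longrightarrow> G (x \<boxplus> y) = G x \<boxplus> G y"
    and bij_F: "bij_betw F Q Q"
    and bij_G: "bij_betw G Q Q"
    and F_G_commute: "x \<in> Q \<Longrightarrow> F (G x) = G (F x)"
    and left_distrib: "x \<in> Q \<Longrightarrow> y \<in> Q \<Longrightarrow> w \<in> Q \<Longrightarrow>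
      x \<boxplus> (y \<boxplus> w) = (F x \<boxplus> y) \<boxplus> (G x \<boxplus> w)"
    and right_distrib: "x \<in> Q \<Longrightarrow> y \<in> Q \<Longrightarrow> w \<in> Q \<Longrightarrow>
      (y \<boxplus> w) \<boxplus> x = (y \<boxplus> F x) \<boxplus> (w \<boxplus> G x)"
begin

lemma left_cancel_iff [simp]:
  "x \<in> Q \<Longrightarrow> y \<in> Q \<Longrightarrow> w \<in> Q \<Longrightarrow> x \<boxplus> y = x \<boxplus> w \<longleftrightarrow> y = w"
  using left_cancel by blast

lemma F_e [simp]: "F e = e"
  using F_add[of e e] left_cancel[of "F e" "F e" e] by simp

lemma G_e [simp]: "G e = e"
  using G_add[of e e] left_cancel[of "G e" "G e" e] by simp

lemma F_add_G: "x \<in> Q \<Longrightarrow> F x \<boxplus> G x = x"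
  using left_distrib[of x e e] by simp

text \<open>The middle inner mapping \<open>T\<^sub>x : y \<mapsto> x \ (y \<boxplus> x)\<close> is an endomorphism with
  \<open>T\<^sub>x = T\<^bsub>F x\<^esub> = T\<^bsub>G x\<^esub>\<close>, so \<open>T\<^sub>y \<circ> T\<^sub>x\<close> fixes \<open>x \<boxplus> y = (F x \<boxplus> y) \<boxplus> G x\<close> and \<open>F x \<boxplus> y\<close>,
  hence also \<open>G x\<close>.\<close>

lemma add_commute:
  assumes "x \<in> Q" "y \<in> Q"
  shows "x \<boxplus> y = y \<boxplus> x"
proof -
  define T where "T x y = (SOME w. w \<in> Q \<and> x \<boxplus> w = y \<boxplus> x)" for x y
  have T: "T x y \<in> Q \<and> x \<boxplus> T x y = y \<boxplus> x" if "x \<in> Q" "y \<in> Q" for x y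
    unfolding T_def by (rule someI_ex) (use left_solve[of x "y \<boxplus> x"] that in auto)
  note T1 [simp] = T[THEN conjunct1] and T2 = T[THEN conjunct2]
  have T_eq: "T x y = w" if "x \<boxplus> w = y \<boxplus> x" "x \<in> Q" "y \<in> Q" "w \<in> Q" for x y w
    using T2[of x y] that by (metis T1 left_cancel)
  have Te: "T x e = e" if "x \<in> Q" for x
    by (rule T_eq) (use that in auto)
  have Ts: "T x x = x" if "x \<in> Q" for x
    by (rule T_eq) (use that in auto)
  have FG: "T x (y \<boxplus> w) = T (F x) y \<boxplus> T (G x) w" if "x \<in> Q" "y \<in> Q" "w \<in> Q" for x y w
  proof (rule T_eq)
    have "x \<boxplus> (T (F x) y \<boxplus> T (G x) w) = (F x \<boxplus> T (F x) y) \<boxplus> (G x \<boxplus> T (G x) w)"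
      by (rule left_distrib) (use that in auto)
    also have "\<dots> = (y \<boxplus> F x) \<boxplus> (w \<boxplus> G x)"
      using that by (simp add: T2)
    also have "\<dots> = (y \<boxplus> w) \<boxplus> x"
      by (rule right_distrib[symmetric]) (use that in auto)
    finally show "x \<boxplus> (T (F x) y \<boxplus> T (G x) w) = (y \<boxplus> w) \<boxplus> x" .
  qed (use that in auto)
  have TF: "T (F x) y = T x y" if "x \<in> Q" "y \<in> Q" for x y
    using FG[of x y e] that by (simp add: Te)
  have TG: "T (G x) y = T x y" if "x \<in> Q" "y \<in> Q" for x y
    using FG[of x e y] that by (simp add: Te)
  have Tadd: "T x (y \<boxplus> w) = T x y \<boxplus> T x w" if "x \<in> Q" "y \<in> Q" "w \<in> Q" for x y w
    using FG that by (simp add: TF TG)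
  have swap: "T x (x \<boxplus> y) = y \<boxplus> x" if "x \<in> Q" "y \<in> Q" for x y
    using that by (simp add: Tadd Ts T2)
  have *: "G x \<boxplus> y = y \<boxplus> G x" if "x \<in> Q" "y \<in> Q" for x y
  proof -
    define U where "U w = T y (T x w)" for w
    have U1: "U (x \<boxplus> y) = x \<boxplus> y"
      using that by (simp add: U_def swap)
    have "T x (F x \<boxplus> y) = y \<boxplus> F x"
      using swap[of "F x" y] that by (simp add: TF)
    then have U2: "U (F x \<boxplus> y) = F x \<boxplus> y"
      using that by (simp add: U_def swap)
    have s: "x \<boxplus> y = (F x \<boxplus> y) \<boxplus> G x"
      using left_distrib[of x y e] that by simp
    have "U (x \<boxplus> y) = U (F x \<boxplus> y) \<boxplus> U (G x)"
      unfolding s U_def using that by (simp add: Tadd)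
    then have "(F x \<boxplus> y) \<boxplus> U (G x) = (F x \<boxplus> y) \<boxplus> G x"
      using U1 U2 s by simp
    then have "U (G x) = G x"
      using that by (simp add: U_def)
    moreover have "T x (G x) = G x"
      using Ts[of "G x"] that by (simp add: TG)
    ultimately have "T y (G x) = G x"
      by (simp add: U_def)
    then show ?thesis
      using T2[of y "G x"] that by simp
  qed
  obtain u where "u \<in> Q" "G u = x"
    using bij_G assms(1) by (metis bij_betw_imp_surj_on imageE)
  then show ?thesis
    using * assms(2) by blast
qed

section \<open>The Moufang identity and the inverse property\<close>

lemma right_cancel_iff [simp]:
  "x \<in> Q \<Longrightarrow> y \<in> Q \<Longrightarrow> w \<in> Q \<Longrightarrow> y \<boxplus> x = w \<boxplus> x \<longleftrightarrow> y = w"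
  by (simp add: add_commute[of _ x])

text \<open>Two applications of \<open>left_distrib\<close>. The first splits x into F x and G x.
  Exchanging the summands before the second pairs F x with G x + w and G x with F x + y, and the
  parts recombine because F x + (G x + u) = x + u = G x + (F x + u).\<close>

lemma moufang:
  assumes [simp]: "x \<in> Q" "y \<in> Q" "w \<in> Q"
  shows "x \<boxplus> (x \<boxplus> (y \<boxplus> w)) = (x \<boxplus> y) \<boxplus> (x \<boxplus> w)"
proof -
  have GF: "G x \<boxplus> (F x \<boxplus> u) = x \<boxplus> u" and FG: "F x \<boxplus> (G x \<boxplus> u) = x \<boxplus> u"
    if [simp]: "u \<in> Q" for u
    using left_distrib[of x u e] left_distrib[of x e u]
    by (simp_all add: add_commute[of "G x"])
  have "x \<boxplus> (x \<boxplus> (y \<boxplus> w)) = x \<boxplus> ((G x \<boxplus> w) \<boxplus> (F x \<boxplus> y))"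
    by (simp add: left_distrib[of x y w] add_commute[of "G x \<boxplus> w"])
  also have "\<dots> = (F x \<boxplus> (G x \<boxplus> w)) \<boxplus> (G x \<boxplus> (F x \<boxplus> y))"
    by (rule left_distrib) auto
  also have "\<dots> = (x \<boxplus> y) \<boxplus> (x \<boxplus> w)"
    by (simp add: GF FG add_commute[of "x \<boxplus> w"])
  finally show ?thesis .
qed

definition neg :: "'a \<Rightarrow> 'a" where
  "neg x = (SOME w. w \<in> Q \<and> x \<boxplus> w = e)"

lemma neg_closed [simp, intro]: "x \<in> Q \<Longrightarrow> neg x \<in> Q"
  and add_neg [simp]: "x \<in> Q \<Longrightarrow> x \<boxplus> neg x = e"
proof -
  assume "x \<in> Q"
  then have "\<exists>w. w \<in> Q \<and> x \<boxplus> w = e"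
    using left_solve[of x e] by auto
  then have "neg x \<in> Q \<and> x \<boxplus> neg x = e"
    unfolding neg_def by (rule someI_ex)
  then show "neg x \<in> Q" "x \<boxplus> neg x = e"
    by auto
qed

lemma neg_add [simp]: "x \<in> Q \<Longrightarrow> neg x \<boxplus> x = e"
  by (simp add: add_commute[of "neg x"])

lemma neg_unique: "x \<boxplus> y = e \<Longrightarrow> x \<in> Q \<Longrightarrow> y \<in> Q \<Longrightarrow> neg x = y"
  using left_cancel[of x "neg x" y] by simp

lemma neg_neg [simp]: "x \<in> Q \<Longrightarrow> neg (neg x) = x"
  by (rule neg_unique) auto

lemma neg_e [simp]: "neg e = e"
  by (rule neg_unique) auto

text \<open>The Moufang identity for -x and y reads x + (x + (-x + y)) = x + y, and one x
  cancels.\<close>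

lemma add_neg_cancel [simp]:
  assumes [simp]: "x \<in> Q" "y \<in> Q"
  shows "x \<boxplus> (neg x \<boxplus> y) = y"
proof -
  have "x \<boxplus> (x \<boxplus> (neg x \<boxplus> y)) = x \<boxplus> y"
    using moufang[of x "neg x" y] by simp
  then show ?thesis
    by simp
qed

lemma neg_add_cancel [simp]: "x \<in> Q \<Longrightarrow> y \<in> Q \<Longrightarrow> neg x \<boxplus> (x \<boxplus> y) = y"
  using add_neg_cancel[of "neg x" y] by simp

lemma add_neg_cancel_right [simp]: "x \<in> Q \<Longrightarrow> y \<in> Q \<Longrightarrow> (y \<boxplus> x) \<boxplus> neg x = y"
  by (simp add: add_commute[of _ "neg x"] add_commute[of y x])

lemma neg_add_cancel_right [simp]: "x \<in> Q \<Longrightarrow> y \<in> Q \<Longrightarrow> (y \<boxplus> neg x) \<boxplus> x = y"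
  using add_neg_cancel_right[of "neg x" y] by simp

lemma neg_distrib:
  assumes [simp]: "x \<in> Q" "y \<in> Q"
  shows "neg (x \<boxplus> y) = neg x \<boxplus> neg y"
proof -
  have "(x \<boxplus> y) \<boxplus> neg x = y"
    by (simp add: add_commute[of x y])
  then have "neg (x \<boxplus> y) \<boxplus> y = neg x"
    using neg_add_cancel[of "x \<boxplus> y" "neg x"] by simp
  then show ?thesis
    using add_neg_cancel_right[of y "neg (x \<boxplus> y)"] by simp
qed

lemma F_neg: "x \<in> Q \<Longrightarrow> F (neg x) = neg (F x)"
  using F_add[of x "neg x"] by (metis F_closed F_e add_neg neg_closed neg_unique)

text \<open>The Moufang identity as an autotopism: adding x twice to one summand and -x to the other
  amounts to adding x to the sum. It comes from the Moufang identity for u + v and -v.\<close>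

lemma moufang_shifted:
  assumes [simp]: "x \<in> Q" "u \<in> Q" "v \<in> Q"
  shows "(x \<boxplus> (x \<boxplus> u)) \<boxplus> (neg x \<boxplus> v) = x \<boxplus> (u \<boxplus> v)"
proof -
  have "x \<boxplus> (x \<boxplus> u) = (x \<boxplus> (u \<boxplus> v)) \<boxplus> (x \<boxplus> neg v)"
    using moufang[of x "u \<boxplus> v" "neg v"] by simp
  moreover have "neg x \<boxplus> v = neg (x \<boxplus> neg v)"
    by (simp add: neg_distrib)
  ultimately show ?thesis
    by simp
qed

lemma left_alternative:
  assumes [simp]: "x \<in> Q" "y \<in> Q"
  shows "(x \<boxplus> x) \<boxplus> y = x \<boxplus> (x \<boxplus> y)"
  using moufang_shifted[of x e "x \<boxplus> y"] by simp

section \<open>The centre and the endomorphism \<zeta>\<close>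

definition Z :: "'a set" where
  "Z = {c \<in> Q. \<forall>x\<in>Q. \<forall>y\<in>Q. c \<boxplus> (x \<boxplus> y) = (c \<boxplus> x) \<boxplus> y}"

lemma ZI:
  "c \<in> Q \<Longrightarrow> (\<And>x y. x \<in> Q \<Longrightarrow> y \<in> Q \<Longrightarrow> c \<boxplus> (x \<boxplus> y) = (c \<boxplus> x) \<boxplus> y) \<Longrightarrow> c \<in> Z"
  unfolding Z_def by blast

lemma Z_sub [simp]: "c \<in> Z \<Longrightarrow> c \<in> Q"
  unfolding Z_def by blast

lemma Z_assoc: "c \<in> Z \<Longrightarrow> x \<in> Q \<Longrightarrow> y \<in> Q \<Longrightarrow> (c \<boxplus> x) \<boxplus> y = c \<boxplus> (x \<boxplus> y)"
  unfolding Z_def mem_Collect_eq by metis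

lemma Z_left_commute: "c \<in> Z \<Longrightarrow> x \<in> Q \<Longrightarrow> y \<in> Q \<Longrightarrow> x \<boxplus> (c \<boxplus> y) = c \<boxplus> (x \<boxplus> y)"
  by (metis Z_assoc Z_sub add_closed add_commute)

lemma e_in_Z [simp]: "e \<in> Z"
  by (rule ZI) auto

lemma Z_add [simp, intro]: "c \<in> Z \<Longrightarrow> d \<in> Z \<Longrightarrow> c \<boxplus> d \<in> Z"
  by (rule ZI) (auto simp: Z_assoc Z_sub)

lemma Z_neg [simp, intro]:
  assumes "c \<in> Z"
  shows "neg c \<in> Z"
proof -
  have "neg c \<boxplus> (x \<boxplus> y) = (neg c \<boxplus> x) \<boxplus> y" if [simp]: "x \<in> Q" "y \<in> Q" for x y
  proof -
    have "c \<boxplus> ((neg c \<boxplus> x) \<boxplus> y) = x \<boxplus> y"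
      using Z_assoc[OF assms, of "neg c \<boxplus> x" y] assms by simp
    then show ?thesis
      using neg_add_cancel[of c "(neg c \<boxplus> x) \<boxplus> y"] assms by simp
  qed
  then show ?thesis
    using ZI[of "neg c"] Z_sub[OF assms] neg_closed by blast
qed

definition triple :: "'a \<Rightarrow> 'a" where
  "triple x = x \<boxplus> (x \<boxplus> x)"

lemma triple_closed [simp, intro]: "x \<in> Q \<Longrightarrow> triple x \<in> Q"
  by (simp add: triple_def)

lemma triple_neg: "x \<in> Q \<Longrightarrow> triple (neg x) = neg (triple x)"
  by (simp add: triple_def neg_distrib)

text \<open>In \<open>moufang_shifted\<close> with a + x and a + y for u and v the right-hand side
  is symmetric in x and y, so 3 a may be moved from one summand to the other (\<open>mid\<close>).
  Applied to -a in place of a, this exchange law turns into centrality of 3 a.\<close>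

lemma triple_in_Z [simp, intro]:
  assumes [simp]: "a \<in> Q"
  shows "triple a \<in> Z"
proof -
  have mid: "(triple a \<boxplus> x) \<boxplus> y = x \<boxplus> (triple a \<boxplus> y)"
    if a [simp]: "a \<in> Q" and [simp]: "x \<in> Q" "y \<in> Q" for a x y
  proof -
    have *: "((a \<boxplus> a) \<boxplus> (a \<boxplus> x)) \<boxplus> y = x \<boxplus> ((a \<boxplus> a) \<boxplus> (a \<boxplus> y))" if [simp]: "x \<in> Q" "y \<in> Q" for x y
    proof -
      have "((a \<boxplus> a) \<boxplus> (a \<boxplus> x)) \<boxplus> (neg a \<boxplus> (a \<boxplus> y)) = a \<boxplus> ((a \<boxplus> x) \<boxplus> (a \<boxplus> y))"
        using moufang_shifted[of a "a \<boxplus> x" "a \<boxplus> y"] by (simp add: left_alternative)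
      moreover have "((a \<boxplus> a) \<boxplus> (a \<boxplus> y)) \<boxplus> (neg a \<boxplus> (a \<boxplus> x)) = a \<boxplus> ((a \<boxplus> y) \<boxplus> (a \<boxplus> x))"
        using moufang_shifted[of a "a \<boxplus> y" "a \<boxplus> x"] by (simp add: left_alternative)
      ultimately show ?thesis
        using add_commute[of "a \<boxplus> x" "a \<boxplus> y"] add_commute[of "(a \<boxplus> a) \<boxplus> (a \<boxplus> y)" x]
        by simp
    qed
    have "(a \<boxplus> a) \<boxplus> (a \<boxplus> x) = triple a \<boxplus> x" if [simp]: "x \<in> Q" for x
      using *[of x e] by (simp add: add_commute[of x] triple_def left_alternative)
    then show ?thesis
      using *[of x y] by simp
  qed
  have "triple a \<boxplus> (x \<boxplus> y) = (triple a \<boxplus> x) \<boxplus> y" if [simp]: "x \<in> Q" "y \<in> Q" for x y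
  proof -
    define n where "n = triple (neg a)"
    have [simp]: "n \<in> Q" and n: "neg n = triple a"
      by (simp_all add: n_def triple_neg)
    have "y = neg x \<boxplus> (n \<boxplus> (neg (n \<boxplus> neg x) \<boxplus> y))"
      using mid[of "neg a" "neg x" "neg (n \<boxplus> neg x) \<boxplus> y"] by (simp add: n_def)
    then have "x \<boxplus> y = n \<boxplus> (neg (n \<boxplus> neg x) \<boxplus> y)"
      using add_neg_cancel[of x "n \<boxplus> (neg (n \<boxplus> neg x) \<boxplus> y)"] by simp
    then have "neg n \<boxplus> (x \<boxplus> y) = neg (n \<boxplus> neg x) \<boxplus> y"
      by simp
    then show ?thesis
      by (simp add: neg_distrib n)
  qed
  then show ?thesis
    using ZI triple_closed[OF assms] by blast
qed

text \<open>By the Moufang identity and \<open>left_distrib\<close>, \<theta> (y + v) = y + (G x +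
  (-F x + v)). Putting v = e shows that \<theta> adds c, putting y = e that G x + (-F x + v) = v +
  c; together (y + v) + c = y + (v + c).\<close>

lemma G_minus_F_in_Z:
  assumes [simp]: "x \<in> Q"
  shows "G x \<boxplus> neg (F x) \<in> Z"
proof -
  define c where "c = G x \<boxplus> neg (F x)"
  define \<theta> where "\<theta> u = x \<boxplus> (neg (F x) \<boxplus> (neg (F x) \<boxplus> u))" for u
  have [simp]: "c \<in> Q"
    by (simp add: c_def)
  have \<theta>: "\<theta> (y \<boxplus> v) = y \<boxplus> (G x \<boxplus> (neg (F x) \<boxplus> v))" if [simp]: "y \<in> Q" "v \<in> Q" for y v
    unfolding \<theta>_def by (simp add: moufang left_distrib[of x "neg (F x) \<boxplus> y"])
  have \<theta>1: "\<theta> y = y \<boxplus> c" if [simp]: "y \<in> Q" for y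
    using \<theta>[of y e] by (simp add: c_def)
  have "G x \<boxplus> (neg (F x) \<boxplus> v) = v \<boxplus> c" if [simp]: "v \<in> Q" for v
    using \<theta>[of e v] by (simp add: \<theta>1)
  then have "(y \<boxplus> v) \<boxplus> c = y \<boxplus> (v \<boxplus> c)" if [simp]: "y \<in> Q" "v \<in> Q" for y v
    using \<theta>[of y v] by (simp add: \<theta>1)
  then have "c \<boxplus> (y \<boxplus> v) = (c \<boxplus> y) \<boxplus> v" if [simp]: "y \<in> Q" "v \<in> Q" for y v
    by (metis \<open>c \<in> Q\<close> add_closed add_commute that)
  then show ?thesis
    unfolding c_def[symmetric] using ZI \<open>c \<in> Q\<close> by blast
qed

definition \<zeta> :: "'a \<Rightarrow> 'a" where
  "\<zeta> x = x \<boxplus> F x"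

text \<open>With c = G x - F x central, x = F x + G x = c + 2 F x, so x + F x = c + 3 F x is a sum
  of two central elements.\<close>

lemma zeta_in_Z [simp, intro]:
  assumes [simp]: "x \<in> Q"
  shows "\<zeta> x \<in> Z"
proof -
  define c where "c = G x \<boxplus> neg (F x)"
  have c [simp]: "c \<in> Z"
    by (simp add: c_def G_minus_F_in_Z)
  have "G x = c \<boxplus> F x"
    by (simp add: c_def)
  then have x: "x = c \<boxplus> (F x \<boxplus> F x)"
    using F_add_G[of x] by (simp add: Z_left_commute)
  have "\<zeta> x = (c \<boxplus> (F x \<boxplus> F x)) \<boxplus> F x"
    unfolding \<zeta>_def using x by simp
  also have "\<dots> = c \<boxplus> triple (F x)"
    by (simp add: triple_def Z_assoc left_alternative)
  finally show ?thesis
    by simp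
qed

lemma F_eq: "x \<in> Q \<Longrightarrow> F x = neg x \<boxplus> \<zeta> x"
  by (simp add: \<zeta>_def)

lemma G_eq:
  assumes [simp]: "x \<in> Q"
  shows "G x = (x \<boxplus> x) \<boxplus> neg (\<zeta> x)"
proof -
  have "G x = neg (F x) \<boxplus> x"
    using neg_add_cancel[of "F x" "G x"] by (simp add: F_add_G)
  also have "\<dots> = (x \<boxplus> neg (\<zeta> x)) \<boxplus> x"
    by (simp add: F_eq neg_distrib)
  also have "\<dots> = (x \<boxplus> x) \<boxplus> neg (\<zeta> x)"
    by (simp add: add_commute[of _ "neg (\<zeta> x)"] Z_assoc)
  finally show ?thesis .
qed

lemma zeta_add:
  assumes [simp]: "x \<in> Q" "y \<in> Q"
  shows "\<zeta> (x \<boxplus> y) = \<zeta> x \<boxplus> \<zeta> y"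
proof -
  have "F (x \<boxplus> y) = (neg x \<boxplus> \<zeta> x) \<boxplus> (neg y \<boxplus> \<zeta> y)"
    by (simp add: F_add F_eq[of x] F_eq[of y])
  also have "\<dots> = (\<zeta> x \<boxplus> \<zeta> y) \<boxplus> (neg x \<boxplus> neg y)"
    by (simp add: add_commute[of "neg x" "\<zeta> x"] add_commute[of "neg y" "\<zeta> y"] Z_assoc Z_left_commute)
  also have "\<dots> = (\<zeta> x \<boxplus> \<zeta> y) \<boxplus> neg (x \<boxplus> y)"
    by (simp add: neg_distrib)
  finally have *: "F (x \<boxplus> y) = (\<zeta> x \<boxplus> \<zeta> y) \<boxplus> neg (x \<boxplus> y)" .
  show ?thesis
    unfolding \<zeta>_def[of "x \<boxplus> y"] * by (subst Z_left_commute) auto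
qed

lemma zeta_neg: "x \<in> Q \<Longrightarrow> \<zeta> (neg x) = neg (\<zeta> x)"
  by (simp add: \<zeta>_def F_neg neg_distrib)

lemma zeta_e [simp]: "\<zeta> e = e"
  by (simp add: \<zeta>_def)

lemma triple_e [simp]: "triple e = e"
  by (simp add: triple_def)

lemma double_add:
  assumes [simp]: "x \<in> Q" "y \<in> Q"
  shows "(x \<boxplus> y) \<boxplus> (x \<boxplus> y) = (x \<boxplus> x) \<boxplus> (y \<boxplus> y)"
  using moufang[of x y y] by (simp add: left_alternative)

text \<open>Doubling twice gives \<open>4 (x + y) = 4 x + 4 y\<close>, and \<open>4 u = 3 u + u\<close> with \<open>3 u\<close> central.\<close>

lemma triple_add:
  assumes [simp]: "x \<in> Q" "y \<in> Q"
  shows "triple (x \<boxplus> y) = triple x \<boxplus> triple y"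
proof -
  have quad: "(u \<boxplus> u) \<boxplus> (u \<boxplus> u) = triple u \<boxplus> u" if [simp]: "u \<in> Q" for u
    using left_alternative[of u "u \<boxplus> u"] add_commute[of u "triple u"] by (simp add: triple_def)
  have "triple (x \<boxplus> y) \<boxplus> (x \<boxplus> y) = (triple x \<boxplus> x) \<boxplus> (triple y \<boxplus> y)"
    using quad[of "x \<boxplus> y"] quad[of x] quad[of y] double_add[of x y]
      double_add[of "x \<boxplus> x" "y \<boxplus> y"] by simp
  also have "\<dots> = (triple x \<boxplus> triple y) \<boxplus> (x \<boxplus> y)"
    by (simp add: Z_assoc Z_left_commute)
  finally show ?thesis
    by simp
qed

lemma zeta_triple: "x \<in> Q \<Longrightarrow> \<zeta> (triple x) = triple (\<zeta> x)"
  by (simp add: triple_def zeta_add)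

section \<open>Associators and mediality\<close>

definition asc :: "'a \<Rightarrow> 'a \<Rightarrow> 'a \<Rightarrow> 'a" where
  "asc x y w = ((x \<boxplus> y) \<boxplus> w) \<boxplus> neg (x \<boxplus> (y \<boxplus> w))"

lemma asc_closed [simp, intro]: "x \<in> Q \<Longrightarrow> y \<in> Q \<Longrightarrow> w \<in> Q \<Longrightarrow> asc x y w \<in> Q"
  by (simp add: asc_def)

lemma asc_eq: "x \<in> Q \<Longrightarrow> y \<in> Q \<Longrightarrow> w \<in> Q \<Longrightarrow> (x \<boxplus> y) \<boxplus> w = asc x y w \<boxplus> (x \<boxplus> (y \<boxplus> w))"
  by (simp add: asc_def)

lemma asc_unique:
  "(x \<boxplus> y) \<boxplus> w = d \<boxplus> (x \<boxplus> (y \<boxplus> w)) \<Longrightarrow> x \<in> Q \<Longrightarrow> y \<in> Q \<Longrightarrow> w \<in> Q \<Longrightarrow> d \<in> Q \<Longrightarrow> asc x y w = d"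
  by (simp add: asc_def)

text \<open>Without associators the loop is an abelian group with commuting endomorphisms F and G,
  and both sides of the medial law are the same sum of four terms. So a non-medial product has a
  nonzero associator.\<close>

lemma medialI:
  assumes "\<And>x y w. x \<in> Q \<Longrightarrow> y \<in> Q \<Longrightarrow> w \<in> Q \<Longrightarrow> asc x y w = e"
  shows "medial Q (\<lambda>x y. F x \<boxplus> G y)"
proof -
  have assoc: "(x \<boxplus> y) \<boxplus> w = x \<boxplus> (y \<boxplus> w)" if "x \<in> Q" "y \<in> Q" "w \<in> Q" for x y w
    using asc_eq[OF that] assms[OF that] that by simp
  have "(x \<boxplus> y) \<boxplus> (u \<boxplus> v) = (x \<boxplus> u) \<boxplus> (y \<boxplus> v)" if [simp]: "x \<in> Q" "y \<in> Q" "u \<in> Q" "v \<in> Q" for x y u v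
    by (metis add_closed add_commute assoc that)
  then show ?thesis
    unfolding medial_def by (simp add: F_add G_add F_G_commute)
qed

end

section \<open>Hamiltonian distributive quasigroups\<close>

lemma finite_quasigroupI:
  assumes fin: "finite H" and ne: "H \<noteq> {}"
    and closed: "\<And>a b. a \<in> H \<Longrightarrow> b \<in> H \<Longrightarrow> f a b \<in> H"
    and left: "\<And>a x y. a \<in> H \<Longrightarrow> x \<in> H \<Longrightarrow> y \<in> H \<Longrightarrow> f a x = f a y \<Longrightarrow> x = y"
    and right: "\<And>a x y. a \<in> H \<Longrightarrow> x \<in> H \<Longrightarrow> y \<in> H \<Longrightarrow> f x a = f y a \<Longrightarrow> x = y"
  shows "quasigroup H f"
proof -
  have "\<exists>!x. x \<in> H \<and> f a x = b" "\<exists>!x. x \<in> H \<and> f x a = b" if ab: "a \<in> H" "b \<in> H" for a b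
  proof -
    have "inj_on (f a) H" "inj_on (\<lambda>x. f x a) H"
      using left right that by (blast intro: inj_onI)+
    moreover have "f a ` H \<subseteq> H" "(\<lambda>x. f x a) ` H \<subseteq> H"
      using closed that by blast+
    ultimately have "f a ` H = H" "(\<lambda>x. f x a) ` H = H"
      using fin by (simp_all add: endo_inj_surj)
    then obtain x y where x: "x \<in> H" "f a x = b" and y: "y \<in> H" "f y a = b"
      using ab(2) by (metis (no_types, lifting) imageE)
    show "\<exists>!x. x \<in> H \<and> f a x = b"
      by (rule ex1I[of _ x]) (use x left ab(1) in auto)
    show "\<exists>!x. x \<in> H \<and> f x a = b"
      by (rule ex1I[of _ y]) (use y right ab(1) in auto)
  qed
  then show ?thesis
    unfolding quasigroup_def using ne closed by simp
qed

lemma quasigroup_left_cancel: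
  "quasigroup Q f \<Longrightarrow> a \<in> Q \<Longrightarrow> x \<in> Q \<Longrightarrow> y \<in> Q \<Longrightarrow> f a x = f a y \<Longrightarrow> x = y"
  unfolding quasigroup_def by metis

lemma quasigroup_right_cancel:
  "quasigroup Q f \<Longrightarrow> a \<in> Q \<Longrightarrow> x \<in> Q \<Longrightarrow> y \<in> Q \<Longrightarrow> f x a = f y a \<Longrightarrow> x = y"
  unfolding quasigroup_def by metis

lemma quasigroup_closed: "quasigroup Q f \<Longrightarrow> a \<in> Q \<Longrightarrow> b \<in> Q \<Longrightarrow> f a b \<in> Q"
  by (simp add: quasigroup_def)

lemma quasigroup_bij_left: "quasigroup Q f \<Longrightarrow> a \<in> Q \<Longrightarrow> bij_betw (f a) Q Q"
  unfolding quasigroup_def bij_betw_def inj_on_def image_def by (auto; metis)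

lemma quasigroup_bij_right: "quasigroup Q f \<Longrightarrow> a \<in> Q \<Longrightarrow> bij_betw (\<lambda>x. f x a) Q Q"
  unfolding quasigroup_def bij_betw_def inj_on_def image_def by (auto; metis)

lemma distributive_idem:
  assumes "quasigroup Q f" "distributive Q f" "x \<in> Q"
  shows "f x x = x"
proof -
  have c: "f x x \<in> Q"
    using assms by (simp add: quasigroup_closed)
  have "f x (f x x) = f (f x x) (f x x)"
    using assms by (simp add: distributive_def)
  then show ?thesis
    using quasigroup_right_cancel[OF assms(1) c, of x "f x x"] c assms(3) by simp
qed

text \<open>F and G are the right and left translation by e. They are automorphisms by
  distributivity and commute because e is idempotent; \<open>F'\<close> and \<open>G'\<close> are
  the two divisions by e.\<close>

lemma distributive_quasigroup_belousov:
  assumes qg: "quasigroup Q f" and distr: "distributive Q f" and e: "e \<in> Q"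
  obtains add F G where "belousov_loop Q add e F G"
    and "\<And>x y. x \<in> Q \<Longrightarrow> y \<in> Q \<Longrightarrow> f x y = add (F x) (G y)"
proof -
  define F where "F x = f x e" for x
  define G where "G x = f e x" for x
  have bF: "bij_betw F Q Q" and bG: "bij_betw G Q Q"
    unfolding F_def[abs_def] G_def[abs_def]
    using quasigroup_bij_left[OF qg e] quasigroup_bij_right[OF qg e] by simp_all
  define F' where "F' = inv_into Q F"
  define G' where "G' = inv_into Q G"
  define add where "add x y = f (F' x) (G' y)" for x y
  have cl: "f x y \<in> Q" if "x \<in> Q" "y \<in> Q" for x y
    using qg that by (rule quasigroup_closed)
  have [simp]: "F x \<in> Q" "G x \<in> Q" "F' x \<in> Q" "G' x \<in> Q" if "x \<in> Q" for x
    using that bF bG bij_betw_inv_into[OF bF] bij_betw_inv_into[OF bG]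
    by (auto simp: F'_def G'_def bij_betw_apply)
  have [simp]: "F' (F x) = x" "G' (G x) = x" "F (F' x) = x" "G (G' x) = x" if "x \<in> Q" for x
    using that bF bG by (simp_all add: F'_def G'_def bij_betw_inv_into_left bij_betw_inv_into_right)
  have dl: "f x (f a b) = f (f x a) (f x b)" and dr: "f (f a b) x = f (f a x) (f b x)"
    if "x \<in> Q" "a \<in> Q" "b \<in> Q" for x a b
    using distr that by (simp_all add: distributive_def)
  have idem: "f x x = x" if "x \<in> Q" for x
    using distributive_idem[OF qg distr that] .
  have [simp]: "F e = e" "G e = e"
    using e by (simp_all add: F_def G_def idem)
  have [simp]: "F' e = e" "G' e = e"
    using \<open>F e = e\<close> \<open>G e = e\<close> \<open>e \<in> Q \<Longrightarrow> F' (F e) = e\<close> \<open>e \<in> Q \<Longrightarrow> G' (G e) = e\<close> e by simp_all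
  have f_eq: "f x y = add (F x) (G y)" if "x \<in> Q" "y \<in> Q" for x y
    using that by (simp add: add_def)
  have Ff: "F (f x y) = f (F x) (F y)" and Gf: "G (f x y) = f (G x) (G y)" if "x \<in> Q" "y \<in> Q" for x y
    using that e by (simp_all add: F_def G_def dl dr)
  have FG: "F (G x) = G (F x)" if "x \<in> Q" for x
    using that e by (simp add: F_def G_def dl[of e x e] idem)
  have FG': "F (G' x) = G' (F x)" "G (F' x) = F' (G x)" if "x \<in> Q" for x
  proof -
    have "G (F (G' x)) = F x" "F (G (F' x)) = G x"
      using that FG[of "G' x"] FG[of "F' x"] by simp_all
    then show "F (G' x) = G' (F x)" "G (F' x) = F' (G x)"
      using that by (metis \<open>\<And>x. x \<in> Q \<Longrightarrow> F x \<in> Q\<close> \<open>\<And>x. x \<in> Q \<Longrightarrow> G x \<in> Q\<close>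
          \<open>\<And>x. x \<in> Q \<Longrightarrow> F' x \<in> Q\<close> \<open>\<And>x. x \<in> Q \<Longrightarrow> G' x \<in> Q\<close>
          \<open>\<And>x. x \<in> Q \<Longrightarrow> F' (F x) = x\<close> \<open>\<And>x. x \<in> Q \<Longrightarrow> G' (G x) = x\<close>)+
  qed
  have Fadd: "F (add x y) = add (F x) (F y)" and Gadd: "G (add x y) = add (G x) (G y)"
    if "x \<in> Q" "y \<in> Q" for x y
    using that by (simp_all add: add_def Ff Gf FG')
  have addc: "add x y \<in> Q" if "x \<in> Q" "y \<in> Q" for x y
    using that by (simp add: add_def cl)
  have surjs: "\<exists>u\<in>Q. x = F u" "\<exists>u\<in>Q. x = G u" if "x \<in> Q" for x
    using that by (metis \<open>\<And>x. x \<in> Q \<Longrightarrow> F' x \<in> Q\<close> \<open>\<And>x. x \<in> Q \<Longrightarrow> F (F' x) = x\<close>,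
        metis \<open>\<And>x. x \<in> Q \<Longrightarrow> G' x \<in> Q\<close> \<open>\<And>x. x \<in> Q \<Longrightarrow> G (G' x) = x\<close>)
  have "belousov_loop Q add e F G"
  proof
    fix x y w
    assume [simp]: "x \<in> Q" "y \<in> Q"
    show "add x y \<in> Q"
      by (simp add: addc)
    show "F (add x y) = add (F x) (F y)" "G (add x y) = add (G x) (G y)"
      by (simp_all add: Fadd Gadd)
    show "\<exists>w\<in>Q. add x w = y"
    proof -
      obtain v where "v \<in> Q" "f (F' x) v = y"
        using qg by (metis \<open>x \<in> Q\<close> \<open>y \<in> Q\<close> \<open>\<And>x. x \<in> Q \<Longrightarrow> F' x \<in> Q\<close> quasigroup_def)
      then show ?thesis
        by (intro bexI[of _ "G v"]) (simp_all add: add_def)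
    qed
    assume [simp]: "w \<in> Q"
    obtain x1 where x1 [simp]: "x1 \<in> Q" "x = F x1"
      using surjs(1) \<open>x \<in> Q\<close> by blast
    obtain x2 where x2 [simp]: "x2 \<in> Q" "x = G x2"
      using surjs(2) \<open>x \<in> Q\<close> by blast
    \<comment> \<open>Distributivity for x1, y1, w1 reads F x1 + (F G y1 + G G w1) = (F F x1 + F G
      y1) + (G F x1 + G G w1), which explains the form in which the arguments are written. The right
      law needs G x2, F F y2 and F G w2 instead.\<close>
    obtain y1 where y1: "y1 \<in> Q" "y = F (G y1)"
      using surjs \<open>y \<in> Q\<close> by metis
    obtain y2 where y2: "y2 \<in> Q" "y = F (F y2)"
      using surjs \<open>y \<in> Q\<close> by metis
    obtain w1 where w1: "w1 \<in> Q" "w = G (G w1)"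
      using surjs \<open>w \<in> Q\<close> by metis
    obtain w2 where w2: "w2 \<in> Q" "w = F (G w2)"
      using surjs \<open>w \<in> Q\<close> by metis
    show "add x (add y w) = add (add (F x) y) (add (G x) w)"
      using dl[of x1 y1 w1] y1 w1 unfolding x1(2)
      by (simp add: f_eq cl addc Fadd Gadd FG)
    show "add (add y w) x = add (add y (F x)) (add w (G x))"
      using dr[of x2 y2 w2] y2 w2 unfolding x2(2)
      by (simp add: f_eq cl addc Fadd Gadd FG)
  next
    fix x y w
    assume "add x y = add x w" and [simp]: "x \<in> Q" "y \<in> Q" "w \<in> Q"
    then have "G' y = G' w"
      using quasigroup_left_cancel[OF qg, of "F' x" "G' y" "G' w"] by (simp add: add_def)
    then show "y = w"
      by (metis \<open>\<And>x. x \<in> Q \<Longrightarrow> G (G' x) = x\<close> \<open>y \<in> Q\<close> \<open>w \<in> Q\<close>)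
  next
    fix x
    assume [simp]: "x \<in> Q"
    show "add e x = x"
      using \<open>x \<in> Q \<Longrightarrow> G (G' x) = x\<close> by (simp add: add_def flip: G_def)
    show "add x e = x"
      using \<open>x \<in> Q \<Longrightarrow> F (F' x) = x\<close> by (simp add: add_def flip: F_def)
  qed (use e bF bG FG in simp_all)
  then show ?thesis
    using that f_eq by blast
qed

text \<open>Here \<open>m\<close> is the given product. Finiteness makes a nonempty subset closed
  under \<open>m\<close> a subquasigroup and provides maximal submodules.\<close>

locale hamiltonian_loop = belousov_loop Q add e F G
  for Q :: "'a set" and add (infixl "\<boxplus>" 65) and e :: 'a and F G :: "'a \<Rightarrow> 'a" +
  fixes m :: "'a \<Rightarrow> 'a \<Rightarrow> 'a"
  assumes finite_Q: "finite Q"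
    and m_eq: "x \<in> Q \<Longrightarrow> y \<in> Q \<Longrightarrow> m x y = F x \<boxplus> G y"
    and hamiltonian: "hamiltonian Q m"
begin

text \<open>As e is congruent to itself, the two-out-of-three rule makes F and G preserve and
  reflect the congruence; the rule for the product then carries over to the loop addition.\<close>

lemma normal_congruence_add:
  assumes r: "normal_congruence Q m r"
    and [simp]: "a \<in> Q" "b \<in> Q" "c \<in> Q" "d \<in> Q" and cd: "(c, d) \<in> r"
  shows "(a, b) \<in> r \<longleftrightarrow> (a \<boxplus> c, b \<boxplus> d) \<in> r"
proof -
  have cong: "((a, b) \<in> r \<and> (c, d) \<in> r \<longrightarrow> (m a c, m b d) \<in> r) \<and>
      ((a, b) \<in> r \<and> (m a c, m b d) \<in> r \<longrightarrow> (c, d) \<in> r) \<and>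
      ((c, d) \<in> r \<and> (m a c, m b d) \<in> r \<longrightarrow> (a, b) \<in> r)"
    if "a \<in> Q" "b \<in> Q" "c \<in> Q" "d \<in> Q" for a b c d
    using r that unfolding normal_congruence_def by blast
  have ee: "(e, e) \<in> r"
    using r by (simp add: normal_congruence_def equiv_def refl_on_def)
  have surj: "\<exists>v\<in>Q. u = F v" "\<exists>v\<in>Q. u = G v" if "u \<in> Q" for u
    using that bij_F bij_G unfolding bij_betw_def by blast+
  obtain a' b' c' d' where [simp]: "a' \<in> Q" "b' \<in> Q" "c' \<in> Q" "d' \<in> Q"
    and [simp]: "a = F a'" "b = F b'" "c = G c'" "d = G d'"
    using surj(1)[OF \<open>a \<in> Q\<close>] surj(1)[OF \<open>b \<in> Q\<close>] surj(2)[OF \<open>c \<in> Q\<close>] surj(2)[OF \<open>d \<in> Q\<close>]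
    by blast
  have "(F a', F b') \<in> r \<longleftrightarrow> (a', b') \<in> r"
    using cong[of a' b' e e] ee by (auto simp: m_eq)
  moreover have "(c', d') \<in> r"
    using cong[of e e c' d'] ee cd by (auto simp: m_eq)
  ultimately show ?thesis
    using cong[of a' b' c' d'] by (auto simp: m_eq)
qed

text \<open>H is the block of e for a normal congruence, which identifies x with e. Both bracketings
  therefore reduce to the sum q of the other two arguments, and their difference falls into the
  block of e.\<close>

lemma asc_mem_subquasigroup:
  assumes H: "subquasigroup H Q m" and eH: "e \<in> H" and xH: "x \<in> H"
    and y [simp]: "y \<in> Q" and w [simp]: "w \<in> Q"
  shows "asc x y w \<in> H" "asc y x w \<in> H" "asc y w x \<in> H"
proof -
  have x [simp]: "x \<in> Q"
    using H xH by (auto simp: subquasigroup_def)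
  obtain r where r: "normal_congruence Q m r" and Hr: "H \<in> Q // r"
    using hamiltonian H unfolding hamiltonian_def normal_subquasigroup_def by blast
  have eqv: "equiv Q r"
    using r by (simp add: normal_congruence_def)
  have refl: "(u, u) \<in> r" if "u \<in> Q" for u
    using eqv that by (simp add: equiv_def refl_on_def)
  have H_eq: "u \<in> H \<longleftrightarrow> (u, e) \<in> r" for u
    using eqv Hr eH by (metis equiv_def quotient_eq_iff quotient_eqI equivE in_quotient_imp_closed symD)
  note cong = normal_congruence_add[OF r]
  have xe: "(x, e) \<in> r"
    using xH H_eq by simp
  have *: "asc u v z \<in> H" if [simp]: "u \<in> Q" "v \<in> Q" "z \<in> Q" and
      l: "((u \<boxplus> v) \<boxplus> z, q) \<in> r" and rr: "(u \<boxplus> (v \<boxplus> z), q) \<in> r" for u v z q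
  proof -
    have "((u \<boxplus> v) \<boxplus> z, u \<boxplus> (v \<boxplus> z)) \<in> r"
      using l rr eqv by (meson equivE symD transD)
    then have "(asc u v z \<boxplus> (u \<boxplus> (v \<boxplus> z)), e \<boxplus> (u \<boxplus> (v \<boxplus> z))) \<in> r"
      using asc_eq[of u v z] by simp
    then show ?thesis
      unfolding H_eq using cong[of "asc u v z" e "u \<boxplus> (v \<boxplus> z)" "u \<boxplus> (v \<boxplus> z)"] refl by simp
  qed
  have add: "(u \<boxplus> z, v \<boxplus> z) \<in> r" "(z \<boxplus> u, z \<boxplus> v) \<in> r" if "(u, v) \<in> r" "u \<in> Q" "v \<in> Q" "z \<in> Q" for u v z
    using cong[of u v z z] that refl[of z] by (auto simp: add_commute[of z])
  have xu: "(x \<boxplus> u, u) \<in> r" "(u \<boxplus> x, u) \<in> r" if "u \<in> Q" for u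
    using add[of x e u] xe that by auto
  show "asc x y w \<in> H"
    by (rule *[OF _ _ _ add(1)[OF xu(1)] xu(1)]) auto
  show "asc y x w \<in> H"
    by (rule *[OF _ _ _ add(1)[OF xu(2)] add(2)[OF xu(1)]]) auto
  show "asc y w x \<in> H"
    by (rule *[OF _ _ _ xu(2) add(2)[OF xu(2)]]) auto
qed

section \<open>Submodules of the centre and the subquasigroups N + {0, x, -x}\<close>

definition submodule :: "'a set \<Rightarrow> bool" where
  "submodule N \<longleftrightarrow> N \<subseteq> Z \<and> e \<in> N \<and> (\<forall>x\<in>N. \<forall>y\<in>N. x \<boxplus> y \<in> N) \<and> (\<forall>x\<in>N. neg x \<in> N)
     \<and> (\<forall>x\<in>N. \<zeta> x \<in> N)"

lemma submodule_Z: "submodule Z"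
  by (auto simp: submodule_def)

lemma m_cancel:
  assumes "a \<in> Q" "x \<in> Q" "y \<in> Q"
  shows "m a x = m a y \<Longrightarrow> x = y" "m x a = m y a \<Longrightarrow> x = y"
  using assms bij_F bij_G by (auto simp: m_eq bij_betw_def inj_on_eq_iff)

text \<open>Three cosets suffice because x is used only when 3 x and \<zeta> x lie in N. The element
  x need not be central; then the result is a subquasigroup but not a submodule.\<close>

definition adjoin :: "'a set \<Rightarrow> 'a \<Rightarrow> 'a set" where
  "adjoin N x = {y. \<exists>n\<in>N. y = n \<or> y = n \<boxplus> x \<or> y = n \<boxplus> neg x}"

lemma submodule_sub [simp]: "submodule N \<Longrightarrow> n \<in> N \<Longrightarrow> n \<in> Z"
  by (auto simp: submodule_def)

lemma submodule_closed:
  assumes "submodule N"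
  shows "e \<in> N" "n \<in> N \<Longrightarrow> k \<in> N \<Longrightarrow> n \<boxplus> k \<in> N" "n \<in> N \<Longrightarrow> neg n \<in> N"
    "n \<in> N \<Longrightarrow> \<zeta> n \<in> N" "n \<in> N \<Longrightarrow> triple n \<in> N"
  using assms by (auto simp: submodule_def triple_def)

lemma adjoin_I:
  "n \<in> N \<Longrightarrow> n \<in> adjoin N x" "n \<in> N \<Longrightarrow> n \<boxplus> x \<in> adjoin N x"
  "n \<in> N \<Longrightarrow> n \<boxplus> neg x \<in> adjoin N x"
  by (auto simp: adjoin_def)

lemma adjoin_subset:
  assumes "submodule N" "x \<in> Q"
  shows "adjoin N x \<subseteq> Q"
  using assms by (auto simp: adjoin_def)

lemma adjoin_self:
  assumes "submodule N" "x \<in> Q"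
  shows "x \<in> adjoin N x"
  using adjoin_I(2)[of e N x] submodule_closed(1)[OF assms(1)] assms by simp

context
  fixes N x
  assumes N [simp]: "submodule N" and x [simp]: "x \<in> Q" and x3: "triple x \<in> N" and zx: "\<zeta> x \<in> N"
begin

lemma adjoin_add:
  assumes "u \<in> adjoin N x" "v \<in> adjoin N x"
  shows "u \<boxplus> v \<in> adjoin N x"
proof -
  let ?H = "adjoin N x"
  have NZ [simp]: "n \<in> Z" if "n \<in> N" for n
    using N that by (rule submodule_sub)
  note HI = adjoin_I[of _ N x]
  have N_add: "n \<boxplus> u \<in> ?H" if "n \<in> N" "u \<in> ?H" for n u
    using that unfolding adjoin_def
    by (auto simp: submodule_closed simp flip: Z_assoc)
  \<comment> \<open>2 x = 3 x - x with 3 x in N, so doubling stays inside the three cosets; likewise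
    for -x.\<close>
  have xx: "x \<boxplus> x \<in> ?H"
  proof -
    have "x \<boxplus> x = triple x \<boxplus> neg x"
      by (simp add: triple_def add_commute[of x "x \<boxplus> x"])
    then show ?thesis
      using HI(3)[OF x3] by simp
  qed
  have nn: "neg x \<boxplus> neg x \<in> ?H"
  proof -
    have "neg x \<boxplus> neg x = neg (triple x) \<boxplus> x"
      by (simp add: triple_def neg_distrib add_commute[of "neg x" "neg x \<boxplus> neg x"])
    then show ?thesis
      using HI(2)[OF submodule_closed(3)[OF N x3]] by simp
  qed
  have basic: "u \<boxplus> v \<in> ?H" if "u \<in> {e, x, neg x}" "v \<in> {e, x, neg x}" for u v
    using that xx nn HI(1)[of e] HI(2)[of e] HI(3)[of e] submodule_closed(1)[OF N] by auto
  obtain n u' where u: "n \<in> N" "u' \<in> {e, x, neg x}" "u = n \<boxplus> u'"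
    using \<open>u \<in> ?H\<close> unfolding adjoin_def by fastforce
  obtain k v' where v: "k \<in> N" "v' \<in> {e, x, neg x}" "v = k \<boxplus> v'"
    using \<open>v \<in> ?H\<close> unfolding adjoin_def by fastforce
  have Q: "u' \<in> Q" "v' \<in> Q"
    using u v by auto
  have "u \<boxplus> v = n \<boxplus> (k \<boxplus> (u' \<boxplus> v'))"
    using u v Q by (simp add: Z_assoc Z_left_commute)
  then show ?thesis
    using u v by (simp add: N_add basic)
qed

lemma adjoin_neg: "u \<in> adjoin N x \<Longrightarrow> neg u \<in> adjoin N x"
  using adjoin_I[of _ N x] submodule_closed(3)[OF N] submodule_sub[OF N]
  by (auto simp: adjoin_def neg_distrib)

lemma adjoin_zeta: "u \<in> adjoin N x \<Longrightarrow> \<zeta> u \<in> N"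
  using zx submodule_closed[OF N] submodule_sub[OF N]
  by (auto simp: adjoin_def zeta_add zeta_neg)

lemma adjoin_subquasigroup: "subquasigroup (adjoin N x) Q m"
proof -
  let ?H = "adjoin N x"
  have HQ: "?H \<subseteq> Q"
    by (intro adjoin_subset) auto
  have "m u v \<in> ?H" if "u \<in> ?H" "v \<in> ?H" for u v
  proof -
    have "\<zeta> u \<in> ?H" "\<zeta> v \<in> ?H" and [simp]: "u \<in> Q" "v \<in> Q"
      using that adjoin_I(1)[of _ N x] adjoin_zeta HQ by auto
    then have "(neg u \<boxplus> \<zeta> u) \<boxplus> ((v \<boxplus> v) \<boxplus> neg (\<zeta> v)) \<in> ?H"
      using that by (intro adjoin_add adjoin_neg)
    then show ?thesis
      by (simp add: m_eq F_eq G_eq)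
  qed
  then have "quasigroup ?H m"
    using HQ finite_Q adjoin_self[OF N x]
    by (intro finite_quasigroupI) (auto intro: finite_subset m_cancel)
  then show ?thesis
    using HQ by (simp add: subquasigroup_def)
qed

end

text \<open>The form in which the hamiltonian property is used from here on: the associators of x
  are confined to three cosets of N.\<close>

lemma asc_in_adjoin:
  assumes N: "submodule N" and x: "x \<in> Q" and x3: "triple x \<in> N" and zx: "\<zeta> x \<in> N"
    and yw: "y \<in> Q" "w \<in> Q"
  shows "asc x y w \<in> adjoin N x" "asc y x w \<in> adjoin N x" "asc y w x \<in> adjoin N x"
proof -
  have eN: "e \<in> N"
    using N by (simp add: submodule_def)
  have "e \<in> adjoin N x" "x \<in> adjoin N x"
    using x by (auto simp: adjoin_def intro!: bexI[OF _ eN])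
  from asc_mem_subquasigroup[OF adjoin_subquasigroup[OF N x x3 zx] this yw]
  show "asc x y w \<in> adjoin N x" "asc y x w \<in> adjoin N x" "asc y w x \<in> adjoin N x" .
qed

text \<open>A non-central associator of \<open>x\<close>, \<open>y\<close>, \<open>w\<close> would be congruent modulo the centre to both \<open>\<plusminus>x\<close>
  and \<open>\<plusminus>y\<close>; but then \<open>y\<close> is congruent to \<open>\<plusminus>x\<close> and the associator vanishes.\<close>

lemma asc_in_Z:
  assumes x [simp]: "x \<in> Q" and y [simp]: "y \<in> Q" and w [simp]: "w \<in> Q"
  shows "asc x y w \<in> Z"
proof (rule ccontr)
  assume nZ: "asc x y w \<notin> Z"
  define a where "a = asc x y w"
  have aQ [simp]: "a \<in> Q"
    by (simp add: a_def)
  have "a \<in> adjoin Z x" "a \<in> adjoin Z y"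
    unfolding a_def by (auto intro!: asc_in_adjoin submodule_Z)
  then obtain c d x' y' where [simp]: "c \<in> Z" "d \<in> Z" and x': "x' = x \<or> x' = neg x"
    and y': "y' = y \<or> y' = neg y" and ac: "a = c \<boxplus> x'" and ad: "a = d \<boxplus> y'"
    using nZ unfolding a_def[symmetric] adjoin_def by blast
  have [simp]: "x' \<in> Q" "y' \<in> Q"
    using x' y' by auto
  have yx': "y' = (neg d \<boxplus> c) \<boxplus> x'"
    using ac ad neg_add_cancel[of d y'] by (simp add: Z_assoc)
  obtain k where kZ [simp]: "k \<in> Z" and y_k: "y = k \<boxplus> x \<or> y = k \<boxplus> neg x"
  proof (cases "y' = y")
    case True
    then show ?thesis
      using that[of "neg d \<boxplus> c"] yx' x' by auto
  next
    case False
    then have "y = neg (neg d \<boxplus> c) \<boxplus> neg x'"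
      using y' yx' by (metis Z_add Z_neg Z_sub \<open>c \<in> Z\<close> \<open>d \<in> Z\<close> \<open>x' \<in> Q\<close> neg_distrib neg_neg y)
    then show ?thesis
      using that[of "neg (neg d \<boxplus> c)"] x' by auto
  qed
  have "(x \<boxplus> y) \<boxplus> w = x \<boxplus> (y \<boxplus> w)"
    using y_k
  proof
    assume y: "y = k \<boxplus> x"
    show ?thesis
      unfolding y by (simp add: Z_assoc Z_left_commute left_alternative)
  next
    assume y: "y = k \<boxplus> neg x"
    show ?thesis
      unfolding y by (simp add: Z_assoc Z_left_commute)
  qed
  then have "asc x y w = e"
    by (intro asc_unique) auto
  then show False
    using nZ by simp
qed

text \<open>With p = x + y, the Moufang identity applied twice turns x + (x + (y + (y + (u + v))))
  into (x + (y + u)) + (x + (y + v)), which is p + (p + (u + v)) minus the two central associators.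
  The first expression and p + (p + (u + v)) depend only on u + v, so the pair u, v may be compared
  with the pair u + v, e.\<close>

lemma asc_add_right:
  assumes [simp]: "x \<in> Q" "y \<in> Q" "u \<in> Q" "v \<in> Q"
  shows "asc x y (u \<boxplus> v) = asc x y u \<boxplus> asc x y v"
proof -
  note asc_in_Z [simp]
  define p where "p = x \<boxplus> y"
  have [simp]: "p \<in> Q"
    by (simp add: p_def)
  have shift: "x \<boxplus> (y \<boxplus> z) = neg (asc x y z) \<boxplus> (p \<boxplus> z)" if [simp]: "z \<in> Q" for z
    using asc_eq[of x y z] by (simp add: p_def)
  have D: "x \<boxplus> (x \<boxplus> (y \<boxplus> (y \<boxplus> (u \<boxplus> v))))
      = neg (asc x y u \<boxplus> asc x y v) \<boxplus> (p \<boxplus> (p \<boxplus> (u \<boxplus> v)))"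
    if [simp]: "u \<in> Q" "v \<in> Q" for u v
  proof -
    have "x \<boxplus> (x \<boxplus> (y \<boxplus> (y \<boxplus> (u \<boxplus> v)))) = (x \<boxplus> (y \<boxplus> u)) \<boxplus> (x \<boxplus> (y \<boxplus> v))"
      by (simp add: moufang)
    also have "\<dots> = neg (asc x y u \<boxplus> asc x y v) \<boxplus> ((p \<boxplus> u) \<boxplus> (p \<boxplus> v))"
      by (simp add: shift Z_assoc Z_left_commute neg_distrib)
    finally show ?thesis
      by (simp add: moufang)
  qed
  have "asc x y e = e"
    by (rule asc_unique) auto
  then have "neg (asc x y u \<boxplus> asc x y v) \<boxplus> (p \<boxplus> (p \<boxplus> (u \<boxplus> v)))
      = neg (asc x y (u \<boxplus> v)) \<boxplus> (p \<boxplus> (p \<boxplus> (u \<boxplus> v)))"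
    using D[of u v] D[of "u \<boxplus> v" e] by simp
  then have "neg (asc x y u \<boxplus> asc x y v) = neg (asc x y (u \<boxplus> v))"
    by simp
  then show ?thesis
    by (metis Z_add Z_sub add_closed asc_closed assms neg_neg)
qed

lemma asc_flip:
  assumes [simp]: "x \<in> Q" "y \<in> Q" "w \<in> Q"
  shows "asc w y x = neg (asc x y w)"
  using add_commute[of w y] add_commute[of y x] add_commute[of "y \<boxplus> w" x] add_commute[of w "x \<boxplus> y"]
    add_commute[of "x \<boxplus> (y \<boxplus> w)" "neg ((x \<boxplus> y) \<boxplus> w)"]
  by (simp add: asc_def neg_distrib)

end

text \<open>A one-sided substitute for |A| = |image| |kernel| that asks neither for a subgroup A nor
  for a homomorphism: \<delta> acts as difference, and fixing one point of a fibre embeds the fibre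
  into D.\<close>

lemma card_le_card_image_times:
  assumes fA: "finite A" and fD: "finite D"
    and mem: "\<And>x y. x \<in> A \<Longrightarrow> y \<in> A \<Longrightarrow> f x = f y \<Longrightarrow> \<delta> x y \<in> D"
    and inj: "\<And>x y w. x \<in> A \<Longrightarrow> y \<in> A \<Longrightarrow> w \<in> A \<Longrightarrow> f x = f y \<Longrightarrow> f x = f w \<Longrightarrow> \<delta> x y = \<delta> x w \<Longrightarrow> y = w"
  shows "card A \<le> card (f ` A) * card D"
proof -
  have fib: "card {y \<in> A. f y = k} \<le> card D" if k: "k \<in> f ` A" for k
  proof -
    obtain x where x: "x \<in> A" "k = f x"
      using k by blast
    show ?thesis
    proof (rule card_inj_on_le[OF _ _ fD])
      show "inj_on (\<delta> x) {y \<in> A. f y = k}"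
        by (rule inj_onI) (use inj x in auto)
      show "\<delta> x ` {y \<in> A. f y = k} \<subseteq> D"
        using mem x by auto
    qed
  qed
  have "A = (\<Union>k\<in>f ` A. {y \<in> A. f y = k})"
    by blast
  then have "card A \<le> (\<Sum>k\<in>f ` A. card {y \<in> A. f y = k})"
    using card_UN_le[of "f ` A" "\<lambda>k. {y \<in> A. f y = k}"] fA by simp
  also have "\<dots> \<le> (\<Sum>k\<in>f ` A. card D)"
    by (rule sum_mono) (rule fib)
  finally show ?thesis
    by simp
qed

section \<open>The associator as an alternating trilinear map\<close>

context hamiltonian_loop
begin

lemma asc_add_left:
  assumes [simp]: "u \<in> Q" "v \<in> Q" "y \<in> Q" "w \<in> Q"
  shows "asc (u \<boxplus> v) y w = asc u y w \<boxplus> asc v y w"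
  using asc_add_right[of w y u v] asc_flip[of w y "u \<boxplus> v"] asc_flip[of w y u] asc_flip[of w y v]
  by (simp add: neg_distrib)

text \<open>By commutativity, rebracketing (x + y) + w gives (y + w) + x up to an associator; after
  three such rotations the sum has returned to itself.\<close>

lemma asc_cyclic:
  assumes [simp]: "x \<in> Q" "y \<in> Q" "w \<in> Q"
  shows "asc x y w \<boxplus> (asc y w x \<boxplus> asc w x y) = e"
proof -
  note asc_in_Z [simp]
  have "(x \<boxplus> y) \<boxplus> w = asc x y w \<boxplus> ((y \<boxplus> w) \<boxplus> x)"
    using asc_eq[of x y w] add_commute[of x "y \<boxplus> w"] by simp
  also have "(y \<boxplus> w) \<boxplus> x = asc y w x \<boxplus> ((w \<boxplus> x) \<boxplus> y)"
    using asc_eq[of y w x] add_commute[of y "w \<boxplus> x"] by simp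
  also have "(w \<boxplus> x) \<boxplus> y = asc w x y \<boxplus> ((x \<boxplus> y) \<boxplus> w)"
    using asc_eq[of w x y] add_commute[of w "x \<boxplus> y"] by simp
  finally have "e \<boxplus> ((x \<boxplus> y) \<boxplus> w) = (asc x y w \<boxplus> (asc y w x \<boxplus> asc w x y)) \<boxplus> ((x \<boxplus> y) \<boxplus> w)"
    by (simp add: Z_assoc)
  then show ?thesis
    by (subst (asm) right_cancel_iff) auto
qed

text \<open>The cyclic identity expresses an associator through two others in which the middle
  argument has moved to an outer place.\<close>

lemma asc_add_mid:
  assumes [simp]: "u \<in> Q" "v \<in> Q" "y \<in> Q" "w \<in> Q"
  shows "asc y (u \<boxplus> v) w = asc y u w \<boxplus> asc y v w"
proof -
  note asc_in_Z [simp]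
  have mid: "asc y x w = neg (asc x w y) \<boxplus> neg (asc w y x)" if [simp]: "x \<in> Q" for x
  proof -
    have "neg (asc x w y \<boxplus> asc w y x) = asc y x w"
      by (rule neg_unique) (use asc_cyclic[of y x w] in \<open>simp_all add: add_commute[of _ "asc y x w"]\<close>)
    then show ?thesis
      by (simp add: neg_distrib)
  qed
  show ?thesis
    by (simp add: mid asc_add_left asc_add_right neg_distrib Z_assoc Z_left_commute)
qed

lemma asc_repeat [simp]:
  assumes [simp]: "x \<in> Q" "y \<in> Q"
  shows "asc x x y = e" "asc x y x = e" "asc y x x = e"
proof -
  show *: "asc x x y = e"
    by (rule asc_unique) (auto simp: left_alternative)
  show "asc x y x = e"
    by (rule asc_unique) (auto simp: add_commute[of x "y \<boxplus> x"] add_commute[of x y])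
  show "asc y x x = e"
    using asc_flip[of x x y] * by simp
qed

lemma asc_swap:
  assumes [simp]: "x \<in> Q" "y \<in> Q" "w \<in> Q"
  shows "asc y x w = neg (asc x y w)" "asc x w y = neg (asc x y w)"
proof -
  note asc_in_Z [simp]
  have "asc (x \<boxplus> y) (x \<boxplus> y) w = (asc x x w \<boxplus> asc x y w) \<boxplus> (asc y x w \<boxplus> asc y y w)"
    by (subst asc_add_left) (simp_all only: asc_add_mid add_closed assms)
  moreover have "asc x (y \<boxplus> w) (y \<boxplus> w) = (asc x y y \<boxplus> asc x y w) \<boxplus> (asc x w y \<boxplus> asc x w w)"
    by (subst asc_add_mid) (simp_all only: asc_add_right add_closed assms)
  ultimately have "asc x y w \<boxplus> asc y x w = e" "asc x y w \<boxplus> asc x w y = e"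
    by simp_all
  then show "asc y x w = neg (asc x y w)" "asc x w y = neg (asc x y w)"
    using neg_unique[of "asc x y w" "asc y x w"] neg_unique[of "asc x y w" "asc x w y"]
    by simp_all
qed

lemma asc_central [simp]:
  assumes [simp]: "c \<in> Z" "x \<in> Q" "y \<in> Q"
  shows "asc c x y = e" "asc x c y = e" "asc x y c = e"
proof -
  have *: "asc c x y = e" if "x \<in> Q" "y \<in> Q" for x y
    by (rule asc_unique) (use that in \<open>auto simp: Z_assoc\<close>)
  show "asc c x y = e"
    by (rule *) auto
  show "asc x c y = e"
    using asc_swap(1)[of c x y] * by simp
  show "asc x y c = e"
    using asc_flip[of c y x] * by simp
qed

text \<open>3 [x, y, w] = [3 x, y, w], and 3 x is central.\<close>

lemma triple_asc:
  assumes [simp]: "x \<in> Q" "y \<in> Q" "w \<in> Q"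
  shows "triple (asc x y w) = e"
proof -
  have "asc (triple x) y w = triple (asc x y w)"
    unfolding triple_def by (simp add: asc_add_left)
  then show ?thesis
    by simp
qed

text \<open>\<zeta> is additive with central values, so it sends both bracketings to the same
  element.\<close>

lemma zeta_asc:
  assumes [simp]: "x \<in> Q" "y \<in> Q" "w \<in> Q"
  shows "\<zeta> (asc x y w) = e"
proof -
  have "\<zeta> ((x \<boxplus> y) \<boxplus> w) = \<zeta> (asc x y w) \<boxplus> \<zeta> (x \<boxplus> (y \<boxplus> w))"
    by (subst asc_eq) (auto simp: zeta_add)
  then have "e \<boxplus> ((\<zeta> x \<boxplus> \<zeta> y) \<boxplus> \<zeta> w) = \<zeta> (asc x y w) \<boxplus> ((\<zeta> x \<boxplus> \<zeta> y) \<boxplus> \<zeta> w)"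
    by (simp add: zeta_add Z_assoc)
  then show ?thesis
    by (subst (asm) right_cancel_iff) auto
qed

section \<open>Multiples, additive maps and coordinates modulo the centre\<close>

definition nm :: "nat \<Rightarrow> 'a \<Rightarrow> 'a" where
  "nm n x = ((\<boxplus>) x ^^ n) e"

lemma nm_0 [simp]: "nm 0 x = e"
  and nm_Suc: "nm (Suc n) x = x \<boxplus> nm n x"
  by (simp_all add: nm_def)

lemma nm_closed [simp, intro]: "x \<in> Q \<Longrightarrow> nm n x \<in> Q"
  by (induction n) (simp_all add: nm_Suc)

lemma nm_Z [simp, intro]: "x \<in> Z \<Longrightarrow> nm n x \<in> Z"
  by (induction n) (simp_all add: nm_Suc)

lemma nm_1 [simp]: "x \<in> Q \<Longrightarrow> nm (Suc 0) x = x"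
  by (simp add: nm_Suc)

lemma nm_3: "x \<in> Q \<Longrightarrow> nm 3 x = triple x"
  by (simp add: eval_nat_numeral nm_Suc triple_def)

text \<open>Translation by a multiple of x is a power of the translation by x.
  \<open>moufang_shifted\<close> moves one x to the left and one to the right of the remaining
  multiple, so the induction descends by two.\<close>

lemma nm_translation:
  assumes [simp]: "x \<in> Q"
  shows "v \<in> Q \<Longrightarrow> nm n x \<boxplus> v = ((\<boxplus>) x ^^ n) v"
proof (induction n arbitrary: v rule: less_induct)
  case (less n)
  note [simp] = less.prems
  consider "n = 0" | "n = 1" | k where "n = Suc (Suc k)"
    by (metis One_nat_def not0_implies_Suc)
  then show ?case
  proof cases
    case 3
    have "nm n x \<boxplus> v = x \<boxplus> (nm k x \<boxplus> (x \<boxplus> v))"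
      using moufang_shifted[of x "nm k x" "x \<boxplus> v"] by (simp add: 3 nm_Suc)
    also have "nm k x \<boxplus> (x \<boxplus> v) = ((\<boxplus>) x ^^ k) (x \<boxplus> v)"
      by (rule less.IH) (simp_all add: 3)
    finally show ?thesis
      by (simp add: 3 funpow_swap1)
  qed simp_all
qed

lemma nm_add: "x \<in> Q \<Longrightarrow> nm (n + k) x = nm n x \<boxplus> nm k x"
  by (simp add: nm_translation) (simp add: nm_def funpow_add)

lemma nm_mult: "x \<in> Q \<Longrightarrow> nm (n * k) x = nm n (nm k x)"
  by (induction n) (simp_all add: nm_Suc nm_add)

lemma nm_e [simp]: "nm n e = e"
  by (induction n) (simp_all add: nm_Suc)

text \<open>A common frame for \<zeta>, tripling and the associator in each of its arguments, all of
  which serve as coordinate functions.\<close>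

definition additive :: "('a \<Rightarrow> 'a) \<Rightarrow> bool" where
  "additive \<phi> \<longleftrightarrow> (\<forall>x\<in>Q. \<phi> x \<in> Q \<and> (\<forall>y\<in>Q. \<phi> (x \<boxplus> y) = \<phi> x \<boxplus> \<phi> y))"

lemma additive_closed [simp]: "additive \<phi> \<Longrightarrow> x \<in> Q \<Longrightarrow> \<phi> x \<in> Q"
  and additive_add: "additive \<phi> \<Longrightarrow> x \<in> Q \<Longrightarrow> y \<in> Q \<Longrightarrow> \<phi> (x \<boxplus> y) = \<phi> x \<boxplus> \<phi> y"
  by (simp_all add: additive_def)

lemma additive_e [simp]: "additive \<phi> \<Longrightarrow> \<phi> e = e"
  using additive_add[of \<phi> e e] left_cancel[of "\<phi> e" "\<phi> e" e] by simp

lemma additive_neg: "additive \<phi> \<Longrightarrow> x \<in> Q \<Longrightarrow> \<phi> (neg x) = neg (\<phi> x)"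
  using additive_add[of \<phi> x "neg x"] neg_unique[of "\<phi> x" "\<phi> (neg x)"] by simp

lemma additive_nm: "additive \<phi> \<Longrightarrow> x \<in> Q \<Longrightarrow> \<phi> (nm n x) = nm n (\<phi> x)"
  by (induction n) (simp_all add: nm_Suc additive_add)

lemma additive_comp: "additive \<phi> \<Longrightarrow> additive \<psi> \<Longrightarrow> additive (\<lambda>x. \<phi> (\<psi> x))"
  by (simp add: additive_def)

lemma additive_zeta: "additive \<zeta>"
  and additive_triple: "additive triple"
  by (simp_all add: additive_def zeta_add triple_add)

lemma additive_asc:
  assumes "y \<in> Q" "w \<in> Q"
  shows "additive (\<lambda>x. asc x y w)" "additive (\<lambda>x. asc y x w)" "additive (\<lambda>x. asc y w x)"
  using assms by (simp_all add: additive_def asc_add_left asc_add_mid asc_add_right)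

fun comb :: "'a \<Rightarrow> 'a \<Rightarrow> 'a \<Rightarrow> nat \<times> nat \<times> nat \<times> 'a \<Rightarrow> 'a" where
  "comb a b c (i, j, k, z) = z \<boxplus> ((nm i a \<boxplus> nm j b) \<boxplus> nm k c)"

definition comb_index :: "(nat \<times> nat \<times> nat \<times> 'a) set" where
  "comb_index = {..<3} \<times> {..<3} \<times> {..<3} \<times> Z"

definition comb_set :: "'a \<Rightarrow> 'a \<Rightarrow> 'a \<Rightarrow> 'a set" where
  "comb_set a b c = comb a b c ` comb_index"

lemma additive_comb:
  assumes "additive \<phi>" "\<And>z. z \<in> Z \<Longrightarrow> \<phi> z = e" "a \<in> Q" "b \<in> Q" "c \<in> Q" "z \<in> Z"
  shows "\<phi> (comb a b c (i, j, k, z)) = (nm i (\<phi> a) \<boxplus> nm j (\<phi> b)) \<boxplus> nm k (\<phi> c)"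
  using assms by (simp add: additive_add additive_nm)

lemma nm_order3:
  assumes [simp]: "t \<in> Q" and t: "t \<noteq> e" "triple t = e" and ij: "nm i t = nm j t" "i < 3" "j < 3"
  shows "i = j"
proof -
  have "t \<boxplus> t \<noteq> e"
    using t by (metis add_e assms(1) triple_def)
  moreover have "t \<boxplus> t \<noteq> t"
    using t(1) left_cancel[of t t e] by auto
  moreover have "nm 0 t = e" "nm 1 t = t" "nm 2 t = t \<boxplus> t"
    by (simp_all add: eval_nat_numeral nm_Suc)
  moreover have "i = 0 \<or> i = 1 \<or> i = 2" "j = 0 \<or> j = 1 \<or> j = 2"
    using ij by auto
  ultimately show ?thesis
    using ij(1) t(1) by metis
qed

text \<open>The three maps vanish on the centre and are dual to a, b, c with value t of order 3, so
  they read off i, j and k; then z cancels. They will be associators in one case, and 9, 3 \<zeta>,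
  \<zeta>^2 in the other.\<close>

lemma inj_on_comb:
  assumes [simp]: "a \<in> Q" "b \<in> Q" "c \<in> Q" and [simp]: "t \<in> Q" and t: "t \<noteq> e" "triple t = e"
    and \<phi>: "additive \<phi>1" "additive \<phi>2" "additive \<phi>3"
    and \<phi>Z: "\<And>z. z \<in> Z \<Longrightarrow> \<phi>1 z = e" "\<And>z. z \<in> Z \<Longrightarrow> \<phi>2 z = e" "\<And>z. z \<in> Z \<Longrightarrow> \<phi>3 z = e"
    and \<phi>a: "\<phi>1 a = t" "\<phi>1 b = e" "\<phi>1 c = e"
    and \<phi>b: "\<phi>2 a = e" "\<phi>2 b = t" "\<phi>2 c = e"
    and \<phi>c: "\<phi>3 a = e" "\<phi>3 b = e" "\<phi>3 c = t"
  shows "inj_on (comb a b c) comb_index"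
proof (rule inj_onI)
  fix p q
  assume p: "p \<in> comb_index" and q: "q \<in> comb_index" and eq: "comb a b c p = comb a b c q"
  obtain i j k z where p_eq: "p = (i, j, k, z)"
    by (cases p)
  obtain i' j' k' z' where q_eq: "q = (i', j', k', z')"
    by (cases q)
  have bd: "i < 3" "j < 3" "k < 3" "i' < 3" "j' < 3" "k' < 3" and [simp]: "z \<in> Z" "z' \<in> Z"
    using p q by (auto simp: comb_index_def p_eq q_eq)
  note eq = eq[unfolded p_eq q_eq]
  have "i = i'"
    using arg_cong[OF eq, of \<phi>1] bd
      additive_comb[OF \<phi>(1) \<phi>Z(1) _ _ _ \<open>z \<in> Z\<close>, of a b c i j k]
      additive_comb[OF \<phi>(1) \<phi>Z(1) _ _ _ \<open>z' \<in> Z\<close>, of a b c i' j' k']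
    by (intro nm_order3[OF _ t]) (simp_all add: \<phi>a del: comb.simps)
  moreover have "j = j'"
    using arg_cong[OF eq, of \<phi>2] bd
      additive_comb[OF \<phi>(2) \<phi>Z(2) _ _ _ \<open>z \<in> Z\<close>, of a b c i j k]
      additive_comb[OF \<phi>(2) \<phi>Z(2) _ _ _ \<open>z' \<in> Z\<close>, of a b c i' j' k']
    by (intro nm_order3[OF _ t]) (simp_all add: \<phi>b del: comb.simps)
  moreover have "k = k'"
    using arg_cong[OF eq, of \<phi>3] bd
      additive_comb[OF \<phi>(3) \<phi>Z(3) _ _ _ \<open>z \<in> Z\<close>, of a b c i j k]
      additive_comb[OF \<phi>(3) \<phi>Z(3) _ _ _ \<open>z' \<in> Z\<close>, of a b c i' j' k']
    by (intro nm_order3[OF _ t]) (simp_all add: \<phi>c del: comb.simps)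
  ultimately show "p = q"
    using eq by (simp add: p_eq q_eq)
qed

lemma finite_Z: "finite Z"
  using finite_Q by (rule finite_subset[rotated]) auto

lemma card_comb_set:
  assumes "inj_on (comb a b c) comb_index"
  shows "card (comb_set a b c) = 27 * card Z"
  unfolding comb_set_def using card_image[OF assms] by (simp add: comb_index_def card_cartesian_product)

lemma comb_set_subset:
  assumes "a \<in> Q" "b \<in> Q" "c \<in> Q"
  shows "comb_set a b c \<subseteq> Q"
  using assms by (auto simp: comb_set_def comb_index_def)

lemma adjoin_submodule:
  assumes N: "submodule N" and [simp]: "s \<in> Z" and s: "triple s \<in> N" "\<zeta> s \<in> N"
  shows "submodule (adjoin N s)"
proof -
  have "adjoin N s \<subseteq> Z"
    using submodule_sub[OF N] by (auto simp: adjoin_def)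
  then show ?thesis
    unfolding submodule_def
    using adjoin_add[OF N _ s] adjoin_neg[OF N _ s] adjoin_zeta[OF N _ s]
      adjoin_I(1)[of _ N s] submodule_closed(1)[OF N] by auto
qed

end

text \<open>Every submodule properly above N contains t, so modulo N the multiples of t form the
  smallest nonzero submodule of Z.\<close>

locale hamiltonian_loop_max = hamiltonian_loop +
  fixes a b c :: 'a and N
  assumes a [simp]: "a \<in> Q" and b [simp]: "b \<in> Q" and c [simp]: "c \<in> Q"
    and N: "submodule N" and asc_notin_N: "asc a b c \<notin> N"
    and N_max: "\<And>M. submodule M \<Longrightarrow> N \<subseteq> M \<Longrightarrow> asc a b c \<notin> M \<Longrightarrow> M = N"
begin

abbreviation t where "t \<equiv> asc a b c"

lemma t_Z [simp]: "t \<in> Z"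
  by (rule asc_in_Z) auto

lemma N_Z [simp]: "n \<in> N \<Longrightarrow> n \<in> Z"
  using submodule_sub[OF N] .

lemmas N_closed [simp] = submodule_closed[OF N]

lemma t_notin [simp]: "t \<notin> N" and t_ne_e [simp]: "t \<noteq> e"
  using asc_notin_N N_closed(1) by metis+

lemma triple_t: "triple t = e" and zeta_t: "\<zeta> t = e"
  by (simp_all add: triple_asc zeta_asc)

lemma neg_t: "neg t = t \<boxplus> t"
  by (rule neg_unique) (use triple_t in \<open>simp_all add: triple_def\<close>)

lemma neg_t_notin [simp]: "neg t \<notin> N"
  using N_closed(3)[of "neg t"] by auto

lemma card_adjoin_t: "card (adjoin N t) = 3 * card N"
proof -
  have fN: "finite N"
    using finite_Z by (rule finite_subset[rotated]) auto
  let ?f = "\<lambda>s n. n \<boxplus> s"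
  have inj: "inj_on (?f s) N" if "s \<in> Q" for s
    by (rule inj_onI) (use that in auto)
  have eq: "adjoin N t = N \<union> (?f t ` N \<union> ?f (neg t) ` N)"
    by (auto simp: adjoin_def)
  have diff: "s \<in> N" if "n \<in> N" "k \<in> N" "n = k \<boxplus> s" "s \<in> Q" for n k s
    using that neg_add_cancel[of k s] N_closed(2)[of "neg k" n] by simp
  have d1: "N \<inter> (?f t ` N \<union> ?f (neg t) ` N) = {}"
    using diff[of _ _ t] diff[of _ _ "neg t"] by auto
  have "n \<boxplus> t \<noteq> k \<boxplus> neg t" if "n \<in> N" "k \<in> N" for n k
  proof
    assume "n \<boxplus> t = k \<boxplus> neg t"
    then have "(n \<boxplus> t) \<boxplus> t = k"
      using that by simp
    then have "k = n \<boxplus> neg t"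
      using that by (simp add: Z_assoc neg_t)
    then show False
      using diff[of k n "neg t"] that by simp
  qed
  then have d2: "?f t ` N \<inter> ?f (neg t) ` N = {}"
    by auto
  show ?thesis
    unfolding eq using fN d1 d2 by (simp add: card_Un_disjoint card_image inj)
qed

lemma in_adjoin_t:
  assumes [simp]: "s \<in> Q" and t: "t \<in> adjoin N s"
  shows "s \<in> adjoin N t"
proof -
  obtain n where n [simp]: "n \<in> N" and "t = n \<or> t = n \<boxplus> s \<or> t = n \<boxplus> neg s"
    using t by (auto simp: adjoin_def)
  then consider "t = n \<boxplus> s" | "t = n \<boxplus> neg s"
    using n t_notin by metis
  then show ?thesis
  proof cases
    case 1
    then have "s = neg n \<boxplus> t"
      by simp
    then show ?thesis
      using adjoin_I(2)[of "neg n" N t] by simp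
  next
    case 2
    then have "neg s = neg n \<boxplus> t"
      by simp
    then have "s = n \<boxplus> neg t"
      using neg_neg[of s] by (simp add: neg_distrib)
    then show ?thesis
      using adjoin_I(3)[of n N t] by simp
  qed
qed

text \<open>If s is not in N, then N + {0, s, -s} is a submodule properly above N, hence contains t;
  solving for s puts s into a coset of t or -t.\<close>

lemma socle_Z:
  assumes "s \<in> Z" "triple s \<in> N" "\<zeta> s \<in> N"
  shows "s \<in> adjoin N t"
proof (cases "s \<in> N")
  case True
  then show ?thesis
    by (rule adjoin_I)
next
  case False
  have "adjoin N s \<noteq> N"
    using False adjoin_self[OF N, of s] assms(1) by auto
  then have "t \<in> adjoin N s"
    using N_max[OF adjoin_submodule[OF N assms]] adjoin_I(1)[of _ N s] by blast
  then show ?thesis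
    using assms(1) by (intro in_adjoin_t) auto
qed

text \<open>For s outside the centre, N + {0, s, -s} is no submodule and the maximality of N says
  nothing about it. Here t is found in it because t or -t is an associator of s.\<close>

lemma socle:
  assumes [simp]: "s \<in> Q" and s: "triple s \<in> N" "\<zeta> s \<in> N"
    and t: "t \<in> {asc s b c, asc a s c, asc a b s} \<or> neg t \<in> {asc s b c, asc a s c, asc a b s}"
  shows "s \<in> adjoin N t"
proof -
  have "{asc s b c, asc a s c, asc a b s} \<subseteq> adjoin N s"
    using asc_in_adjoin[OF N \<open>s \<in> Q\<close> s] by simp
  then have "t \<in> adjoin N s \<or> neg t \<in> adjoin N s"
    using t by blast
  then have "t \<in> adjoin N s"
    using adjoin_neg[OF N \<open>s \<in> Q\<close> s, of "neg t"] by auto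
  then show ?thesis
    by (intro in_adjoin_t) auto
qed

lemma inj_comb: "inj_on (comb a b c) comb_index"
  by (rule inj_on_comb[where t = t, OF _ _ _ _ _ _ additive_asc(1)[of b c] additive_asc(2)[of a c] additive_asc(3)[of a b]])
    (auto simp: triple_t)

text \<open>If x and y differ in a coordinate i, j or k, the associator of y - x with two of a, b, c
  is t or -t, and \<open>socle\<close> applies. If all coordinates agree, y - x is central and
  \<open>socle_Z\<close> applies.\<close>

lemma socle_diff:
  assumes x: "x \<in> comb_set a b c" and y: "y \<in> comb_set a b c"
    and s: "triple (y \<boxplus> neg x) \<in> N" "\<zeta> (y \<boxplus> neg x) \<in> N"
  shows "y \<boxplus> neg x \<in> adjoin N t"
proof -
  have [simp]: "x \<in> Q" "y \<in> Q"
    using x y subsetD[OF comb_set_subset[OF a b c]] by auto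
  obtain i j k z where p: "(i, j, k, z) \<in> comb_index" and x_eq: "x = comb a b c (i, j, k, z)"
    using x by (auto simp: comb_set_def)
  obtain i' j' k' z' where q: "(i', j', k', z') \<in> comb_index" and y_eq: "y = comb a b c (i', j', k', z')"
    using y by (auto simp: comb_set_def)
  have bd: "i < 3" "j < 3" "k < 3" "i' < 3" "j' < 3" "k' < 3" and zz [simp]: "z \<in> Z" "z' \<in> Z"
    using p q by (auto simp: comb_index_def)
  have val: "\<phi> (y \<boxplus> neg x) = nm n' t \<boxplus> neg (nm n t)"
    if "additive \<phi>" "\<phi> x = nm n t" "\<phi> y = nm n' t" for \<phi> n n'
    using that by (simp add: additive_add additive_neg)
  have vx: "asc x b c = nm i t" "asc a x c = nm j t" "asc a b x = nm k t"
    unfolding x_eq using zz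
    by (simp_all only: additive_comb[OF additive_asc(1)] additive_comb[OF additive_asc(2)]
      additive_comb[OF additive_asc(3)] asc_central a b c) simp_all
  have vy: "asc y b c = nm i' t" "asc a y c = nm j' t" "asc a b y = nm k' t"
    unfolding y_eq using zz
    by (simp_all only: additive_comb[OF additive_asc(1)] additive_comb[OF additive_asc(2)]
      additive_comb[OF additive_asc(3)] asc_central a b c) simp_all
  have v: "asc (y \<boxplus> neg x) b c = nm i' t \<boxplus> neg (nm i t)"
    "asc a (y \<boxplus> neg x) c = nm j' t \<boxplus> neg (nm j t)"
    "asc a b (y \<boxplus> neg x) = nm k' t \<boxplus> neg (nm k t)"
    using val[OF additive_asc(1) vx(1) vy(1)] val[OF additive_asc(2) vx(2) vy(2)]
      val[OF additive_asc(3) vx(3) vy(3)] by simp_all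
  have nn: "neg t \<boxplus> neg t = t"
    by (metis neg_distrib neg_neg neg_t t_Z Z_sub)
  have vals: "nm 0 t = e" "nm 1 t = t" "nm 2 t = neg t"
    by (simp_all add: eval_nat_numeral nm_Suc neg_t)
  have pm: "nm n' t \<boxplus> neg (nm n t) \<in> {t, neg t}" if "n < 3" "n' < 3" "n \<noteq> n'" for n n'
  proof -
    have "n = 0 \<or> n = 1 \<or> n = 2" "n' = 0 \<or> n' = 1 \<or> n' = 2"
      using that by auto
    then show ?thesis
      using \<open>n \<noteq> n'\<close> vals nn neg_t[symmetric] by (elim disjE) simp_all
  qed
  consider "i \<noteq> i'" | "j \<noteq> j'" | "k \<noteq> k'" | "i = i'" "j = j'" "k = k'"
    by blast
  then show ?thesis
  proof cases
    case 4
    have "y \<boxplus> neg x = z' \<boxplus> neg z"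
      using 4 add_commute[of "neg z" z'] by (simp add: x_eq y_eq neg_distrib[of z] Z_assoc Z_left_commute)
    then show ?thesis
      using s by (intro socle_Z) auto
  qed (rule socle; use s v pm bd in \<open>simp; metis\<close>)+
qed

end

section \<open>Counting\<close>

context hamiltonian_loop_max
begin

definition \<beta> :: "'a \<times> 'a \<Rightarrow> 'a" where
  "\<beta> p = \<zeta> (fst p) \<boxplus> neg (triple (snd p))"

definition syzygies :: "('a \<times> 'a) set" where
  "syzygies = {p \<in> Z \<times> Z. \<beta> p \<in> N}"

text \<open>This is N + \<zeta> Z + 3 Z: modulo N, the product of the module Z with the ideal
  generated by 3 and \<zeta>.\<close>

definition radical :: "'a set" where
  "radical = (\<lambda>(p, n). \<beta> p \<boxplus> n) ` ((Z \<times> Z) \<times> N)"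

text \<open>The two components from N fill up whole cosets of N x N, so the pairs are counted modulo
  N without forming a quotient.\<close>

definition \<Phi> :: "'a \<times> 'a \<times> 'a \<Rightarrow> 'a \<times> 'a" where
  "\<Phi> = (\<lambda>(x, n, n'). (triple x \<boxplus> n, \<zeta> x \<boxplus> n'))"

abbreviation P where "P \<equiv> comb_set a b c"

lemma P_Q [simp]: "x \<in> P \<Longrightarrow> x \<in> Q"
  using comb_set_subset[OF a b c] by blast

lemma finite_N: "finite N"
  using finite_Z by (rule finite_subset[rotated]) auto

lemma finite_P: "finite P"
  using finite_Q by (rule finite_subset[rotated]) auto

lemma beta_Z [simp, intro]: "p \<in> Z \<times> Z \<Longrightarrow> \<beta> p \<in> Z"
  by (auto simp: \<beta>_def)

lemma beta_add:
  assumes "u \<in> Z" "v \<in> Z" "u' \<in> Z" "v' \<in> Z"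
  shows "\<beta> (u \<boxplus> u', v \<boxplus> v') = \<beta> (u, v) \<boxplus> \<beta> (u', v')"
  using assms
  by (simp add: \<beta>_def zeta_add triple_add neg_distrib Z_assoc Z_left_commute)

lemma Phi_in_syzygies: "\<Phi> ` (P \<times> N \<times> N) \<subseteq> syzygies"
proof
  fix p
  assume "p \<in> \<Phi> ` (P \<times> N \<times> N)"
  then obtain x n n' where x [simp]: "x \<in> P" and [simp]: "n \<in> N" "n' \<in> N"
    and p: "p = (triple x \<boxplus> n, \<zeta> x \<boxplus> n')"
    by (auto simp: \<Phi>_def)
  have "\<beta> p = \<beta> (triple x, \<zeta> x) \<boxplus> \<beta> (n, n')"
    unfolding p by (rule beta_add) auto
  also have "\<beta> (triple x, \<zeta> x) = e"
    by (simp add: \<beta>_def zeta_triple)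
  finally have "\<beta> p = \<beta> (n, n')"
    by (simp add: \<beta>_def)
  also have "\<dots> \<in> N"
    by (simp add: \<beta>_def)
  finally show "p \<in> syzygies"
    by (auto simp: syzygies_def p)
qed

lemma card_N_pos: "card N > 0"
  using finite_N N_closed(1) card_gt_0_iff by blast

lemma card_P: "card P = 27 * card Z"
  using inj_comb by (rule card_comb_set)

text \<open>The domain has 27 |Z| |N|^2 elements. Within a fibre the first component determines the
  other two, and its differences lie in the 3 |N| elements of \<open>adjoin N t\<close>.\<close>

lemma card_Phi_bound: "9 * card Z * card N \<le> card (\<Phi> ` (P \<times> N \<times> N))"
proof -
  have "card (P \<times> N \<times> N) \<le> card (\<Phi> ` (P \<times> N \<times> N)) * card (adjoin N t)"
  proof (rule card_le_card_image_times[where \<delta> = "\<lambda>p q. fst q \<boxplus> neg (fst p)"])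
    show "finite (P \<times> N \<times> N)"
      by (simp add: finite_P finite_N)
    show "finite (adjoin N t)"
      using finite_Q by (rule finite_subset[rotated]) (use adjoin_subset[OF N] in auto)
  next
    fix p q
    assume p: "p \<in> P \<times> N \<times> N" and q: "q \<in> P \<times> N \<times> N" and eq: "\<Phi> p = \<Phi> q"
    obtain x n n' where p_eq: "p = (x, n, n')" and [simp]: "x \<in> P" "n \<in> N" "n' \<in> N"
      using p by auto
    obtain y k k' where q_eq: "q = (y, k, k')" and [simp]: "y \<in> P" "k \<in> N" "k' \<in> N"
      using q by auto
    have diff: "v \<boxplus> neg u = n \<boxplus> neg k" if "u \<boxplus> n = v \<boxplus> k" "n \<in> N" "k \<in> N" "u \<in> Z" "v \<in> Z" for u v n k
    proof -
      have "v = u \<boxplus> (n \<boxplus> neg k)"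
        using that Z_assoc[of u n "neg k"] by simp
      then show ?thesis
        using that by (simp add: add_commute[of u])
    qed
    have "triple y \<boxplus> neg (triple x) = n \<boxplus> neg k" "\<zeta> y \<boxplus> neg (\<zeta> x) = n' \<boxplus> neg k'"
      using eq by (auto simp: \<Phi>_def p_eq q_eq intro!: diff)
    then have "triple (y \<boxplus> neg x) \<in> N" "\<zeta> (y \<boxplus> neg x) \<in> N"
      by (simp_all add: triple_add zeta_add triple_neg zeta_neg)
    then show "fst q \<boxplus> neg (fst p) \<in> adjoin N t"
      using socle_diff[of x y] by (simp add: p_eq q_eq)
  next
    fix p q r
    assume "p \<in> P \<times> N \<times> N" "q \<in> P \<times> N \<times> N" "r \<in> P \<times> N \<times> N" "\<Phi> p = \<Phi> q" "\<Phi> p = \<Phi> r"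
      "fst q \<boxplus> neg (fst p) = fst r \<boxplus> neg (fst p)"
    then show "q = r"
      by (auto simp: \<Phi>_def)
  qed
  moreover note card_N_pos
  ultimately show ?thesis
    by (simp add: card_cartesian_product card_P card_adjoin_t mult.commute)
qed

lemma radical_memI: "p \<in> Z \<times> Z \<Longrightarrow> n \<in> N \<Longrightarrow> \<beta> p \<boxplus> n \<in> radical"
  unfolding radical_def by force

lemma radicalE:
  assumes "y \<in> radical"
  obtains p n where "p \<in> Z \<times> Z" "n \<in> N" "y = \<beta> p \<boxplus> n"
  using assms unfolding radical_def by force

lemma submodule_radical: "submodule radical"
proof -
  have 1: "radical \<subseteq> Z"
    by (auto elim!: radicalE)
  have 2: "e \<in> radical"
    using radical_memI[of "(e, e)" e] by (simp add: \<beta>_def)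
  have 3: "x \<boxplus> y \<in> radical" if "x \<in> radical" "y \<in> radical" for x y
  proof -
    obtain u v n where x: "u \<in> Z" "v \<in> Z" "n \<in> N" "x = \<beta> (u, v) \<boxplus> n"
      using \<open>x \<in> radical\<close> by (auto elim!: radicalE)
    obtain u' v' n' where y: "u' \<in> Z" "v' \<in> Z" "n' \<in> N" "y = \<beta> (u', v') \<boxplus> n'"
      using \<open>y \<in> radical\<close> by (auto elim!: radicalE)
    have [simp]: "\<beta> (u, v) \<in> Z" "\<beta> (u', v') \<in> Z"
      using x y by auto
    have "x \<boxplus> y = \<beta> (u \<boxplus> u', v \<boxplus> v') \<boxplus> (n \<boxplus> n')"
      using x y by (simp add: beta_add Z_assoc Z_left_commute)
    then show ?thesis
      using radical_memI[of "(u \<boxplus> u', v \<boxplus> v')" "n \<boxplus> n'"] x y by simp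
  qed
  have 4: "neg x \<in> radical" "\<zeta> x \<in> radical" if xr: "x \<in> radical" for x
  proof -
    obtain u v n where x: "u \<in> Z" "v \<in> Z" "n \<in> N" "x = \<beta> (u, v) \<boxplus> n"
      using xr by (auto elim!: radicalE)
    have "neg x = \<beta> (neg u, neg v) \<boxplus> neg n" "\<zeta> x = \<beta> (\<zeta> u, \<zeta> v) \<boxplus> \<zeta> n"
      using x by (simp_all add: \<beta>_def neg_distrib zeta_neg triple_neg zeta_add zeta_triple)
    then show "neg x \<in> radical" "\<zeta> x \<in> radical"
      using radical_memI[of "(neg u, neg v)" "neg n"] radical_memI[of "(\<zeta> u, \<zeta> v)" "\<zeta> n"] x
      by simp_all
  qed
  show ?thesis
    unfolding submodule_def using 1 2 3 4 by blast
qed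

lemma N_subset_radical: "N \<subseteq> radical"
  using radical_memI[of "(e, e)"] by (auto simp: \<beta>_def)

lemma zeta_in_radical: "u \<in> Z \<Longrightarrow> \<zeta> u \<in> radical"
  and triple_in_radical: "u \<in> Z \<Longrightarrow> triple u \<in> radical"
  using radical_memI[of "(u, e)" e] radical_memI[of "(e, neg u)" e]
  by (simp_all add: \<beta>_def triple_neg)

text \<open>S is the kernel of the map from Z x Z onto R / N. Each y in R gets a chosen
  representation \<open>\<rho> y\<close>; a pair from S is added to it and the N-component is
  corrected so that the represented value stays y. Thus y, and then the pair, can be
  recovered.\<close>

lemma card_radical_bound: "card radical * card syzygies \<le> card Z * card Z * card N"
proof -
  have "\<exists>q. q \<in> (Z \<times> Z) \<times> N \<and> y = \<beta> (fst q) \<boxplus> snd q" if "y \<in> radical" for y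
    using that unfolding radical_def image_iff case_prod_beta by blast
  then obtain \<rho> where \<rho>: "\<And>y. y \<in> radical \<Longrightarrow> \<rho> y \<in> (Z \<times> Z) \<times> N \<and> y = \<beta> (fst (\<rho> y)) \<boxplus> snd (\<rho> y)"
    by metis
  define g where "g = (\<lambda>(y, u, v). (fst (fst (\<rho> y)) \<boxplus> u, snd (fst (\<rho> y)) \<boxplus> v, snd (\<rho> y) \<boxplus> neg (\<beta> (u, v))))"
  have g: "g (y, u, v) \<in> Z \<times> Z \<times> N" 
    "y = \<beta> (fst (g (y, u, v)), fst (snd (g (y, u, v)))) \<boxplus> snd (snd (g (y, u, v)))"
    if "y \<in> radical" "(u, v) \<in> syzygies" for y u v
  proof -
    obtain u' v' n where r: "\<rho> y = ((u', v'), n)"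
      by (metis surj_pair)
    have mem [simp]: "u' \<in> Z" "v' \<in> Z" "n \<in> N" and y: "y = \<beta> (u', v') \<boxplus> n"
      using \<rho>[OF that(1)] r by auto
    have [simp]: "u \<in> Z" "v \<in> Z" "\<beta> (u, v) \<in> N" "\<beta> (u', v') \<in> Z"
      using that(2) by (auto simp: syzygies_def)
    show "g (y, u, v) \<in> Z \<times> Z \<times> N"
      by (simp add: g_def r)
    have "\<beta> (u' \<boxplus> u, v' \<boxplus> v) \<boxplus> (n \<boxplus> neg (\<beta> (u, v))) = y"
      using add_commute[of n "\<beta> (u', v')"] by (simp add: beta_add Z_assoc Z_left_commute y)
    then show "y = \<beta> (fst (g (y, u, v)), fst (snd (g (y, u, v)))) \<boxplus> snd (snd (g (y, u, v)))"
      by (simp add: g_def r)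
  qed
  have "inj_on g (radical \<times> syzygies)"
  proof (rule inj_onI)
    fix p q
    assume p: "p \<in> radical \<times> syzygies" and q: "q \<in> radical \<times> syzygies" and "g p = g q"
    obtain y u v where p_eq: "p = (y, u, v)" and y: "y \<in> radical" "(u, v) \<in> syzygies"
      using p by auto
    obtain y' u' v' where q_eq: "q = (y', u', v')" and y': "y' \<in> radical" "(u', v') \<in> syzygies"
      using q by auto
    have eq: "g (y, u, v) = g (y', u', v')"
      using \<open>g p = g q\<close> by (simp add: p_eq q_eq)
    have "y = y'"
      using g(2)[OF y] g(2)[OF y'] eq by simp
    moreover have "u \<in> Q" "v \<in> Q" "u' \<in> Q" "v' \<in> Q"
      using y(2) y'(2) by (auto simp: syzygies_def)
    moreover have "fst (fst (\<rho> y)) \<in> Q" "snd (fst (\<rho> y)) \<in> Q"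
      using \<rho>[OF y(1)] by auto
    ultimately show "p = q"
      using eq by (simp add: g_def p_eq q_eq)
  qed
  moreover have "g p \<in> Z \<times> Z \<times> N" if "p \<in> radical \<times> syzygies" for p
    using that g(1)[of "fst p" "fst (snd p)" "snd (snd p)"] by (cases p) simp
  then have "g ` (radical \<times> syzygies) \<subseteq> Z \<times> Z \<times> N"
    by (rule image_subsetI)
  ultimately have "card (radical \<times> syzygies) \<le> card (Z \<times> Z \<times> N)"
    using finite_Z finite_N by (intro card_inj_on_le) auto
  then show ?thesis
    by (simp add: card_cartesian_product)
qed

lemma finite_syzygies: "finite syzygies"
  by (rule finite_subset[of _ "Z \<times> Z"]) (auto simp: syzygies_def finite_Z)

lemma card_bounds:
  shows "9 * card radical \<le> card Z" "3 * card N \<le> card radical"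
    "9 * card Z * card N \<le> card syzygies" "card N > 0"
proof -
  have pos: "card N > 0" "card Z > 0"
    using card_N_pos finite_Z e_in_Z card_gt_0_iff by blast+
  show "card N > 0"
    by fact
  show *: "9 * card Z * card N \<le> card syzygies"
    using card_Phi_bound card_mono[OF finite_syzygies Phi_in_syzygies] by linarith
  then have "card radical * (9 * card Z * card N) \<le> card Z * card Z * card N"
    using card_radical_bound by (meson le_trans mult_le_mono2)
  then have "(9 * card radical) * (card Z * card N) \<le> card Z * (card Z * card N)"
    by (simp add: algebra_simps)
  then show 9: "9 * card radical \<le> card Z"
    using pos by simp
  have "t \<in> radical"
  proof (rule ccontr)
    assume "t \<notin> radical"
    then have R: "radical = N"
      by (intro N_max submodule_radical N_subset_radical)
    have "Z \<subseteq> adjoin N t"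
      using socle_Z zeta_in_radical triple_in_radical R by auto
    moreover have "finite (adjoin N t)"
      using finite_Q by (rule finite_subset[rotated]) (use adjoin_subset[OF N] in auto)
    ultimately have "card Z \<le> 3 * card N"
      using card_mono card_adjoin_t by metis
    then show False
      using 9 R pos by simp
  qed
  then have "adjoin N t \<subseteq> radical"
    using N_subset_radical submodule_closed[OF submodule_radical] by (auto simp: adjoin_def)
  moreover have "finite radical"
    using finite_Z by (rule finite_subset[rotated]) (use submodule_sub[OF submodule_radical] in auto)
  ultimately show "3 * card N \<le> card radical"
    using card_mono card_adjoin_t by metis
qed

lemma card_Q_ge: "card Q \<ge> 729"
proof -
  have "card Q \<ge> 27 * card Z"
    using card_mono[OF finite_Q comb_set_subset[OF a b c]] card_P by simp
  then show ?thesis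
    using card_bounds by linarith
qed

lemma card_Q_eq:
  assumes "card Q = 729"
  shows "N = {e}" "card Z = 27" "radical = {e, t, neg t}"
    "\<And>u v. u \<in> Z \<Longrightarrow> v \<in> Z \<Longrightarrow> \<zeta> u = triple v \<Longrightarrow> \<exists>x\<in>Q. triple x = u \<and> \<zeta> x = v"
proof -
  have "card Q \<ge> 27 * card Z"
    using card_mono[OF finite_Q comb_set_subset[OF a b c]] card_P by simp
  then have cards: "card N = 1" "card radical = 3" "card Z = 27"
    using card_bounds assms by linarith+
  show "card Z = 27"
    by fact
  show N_eq: "N = {e}"
    using cards(1) N_closed(1) by (metis card_1_singletonE singletonD)
  have "e \<noteq> neg t" "t \<noteq> neg t"
    using neg_t_notin N_eq neg_t left_cancel[of t e t] by auto
  then have c3: "card {e, t, neg t} = 3"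
    using t_ne_e[symmetric] by auto
  have "finite radical"
    using cards(2) card.infinite by fastforce
  moreover have "t \<in> radical"
  proof (rule ccontr)
    assume "t \<notin> radical"
    then have "radical = N"
      by (intro N_max submodule_radical N_subset_radical)
    then show False
      using cards by simp
  qed
  then have "{e, t, neg t} \<subseteq> radical"
    using submodule_closed[OF submodule_radical] by auto
  ultimately show "radical = {e, t, neg t}"
    using c3 cards(2) by (metis card_subset_eq)
  fix u v
  assume uv: "u \<in> Z" "v \<in> Z" "\<zeta> u = triple v"
  \<comment> \<open>Now 3 |S| <= 27 * 27, so |S| <= 243 = 9 * 27, which is the lower bound for the
    image.\<close>
  have "card syzygies \<le> card (\<Phi> ` (P \<times> N \<times> N))"
    using card_radical_bound card_Phi_bound cards by simp
  then have "\<Phi> ` (P \<times> N \<times> N) = syzygies"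
    using Phi_in_syzygies finite_syzygies by (metis card_seteq)
  moreover have "(u, v) \<in> syzygies"
    using uv by (simp add: syzygies_def \<beta>_def)
  ultimately have "(u, v) \<in> \<Phi> ` (P \<times> N \<times> N)"
    by (rule ssubst)
  then obtain p where p: "p \<in> P \<times> N \<times> N" and "(u, v) = \<Phi> p"
    by (rule imageE)
  then obtain x where "x \<in> P" "u = triple x" "v = \<zeta> x"
    by (cases p) (auto simp: \<Phi>_def N_eq)
  then show "\<exists>x\<in>Q. triple x = u \<and> \<zeta> x = v"
    by auto
qed

end

section \<open>Quasigroups of order 729\<close>

text \<open>Since 26 = -1 and 24 = -3 modulo 27, and correspondingly modulo 9 and 3, the linear part
  is (\<zeta> a - a) + (2 b - \<zeta> b) with \<zeta> (a0, a1, a2) = (3 a1, 3 a2, 0). The four cubic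
  terms combine modulo 27 into a single product, and s is the sign by which the two operations
  differ.\<close>

fun nabla :: "int \<Rightarrow> int \<times> int \<times> int \<Rightarrow> int \<times> int \<times> int \<Rightarrow> int \<times> int \<times> int" where
  "nabla s (a0, a1, a2) (b0, b1, b2) =
     ((26 * a0 + 3 * a1 + 2 * b0 + 24 * b1 + 9 * (s * ((b2 - a2) * (a0 * b1 - a1 * b0)))) mod 27,
      (8 * a1 + 3 * a2 + 2 * b1 + 6 * b2) mod 9,
      (2 * a2 + 2 * b2) mod 3)"

lemma mod_eqI: "(x :: int) - y = n * k \<Longrightarrow> x mod n = y mod n"
  by (simp add: mod_eq_dvd_iff)

lemma residue_eqI:
  fixes x y n u :: int
  assumes "n dvd u * (x - y)" "coprime n u" "0 \<le> x" "x < n" "0 \<le> y" "y < n"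
  shows "x = y"
proof -
  have "n dvd x - y"
    using assms(1,2) by (simp add: coprime_dvd_mult_right_iff)
  then have "x mod n = y mod n"
    by (simp add: mod_eq_dvd_iff)
  then show ?thesis
    using assms by simp
qed

lemma coprime_three_power:
  assumes "\<not> 3 dvd (u :: int)"
  shows "coprime 27 u" "coprime 9 u"
proof -
  have "coprime 3 u"
    using assms by (intro prime_imp_coprime) auto
  then have "coprime (3 ^ 3) u" "coprime (3 ^ 2) u"
    by (simp_all only: coprime_power_left_iff) simp_all
  then show "coprime 27 u" "coprime 9 u"
    by simp_all
qed

lemma nabla1_eq: "nabla1 = nabla 1"
proof (intro ext)
  fix v w :: "int \<times> int \<times> int"
  obtain a0 a1 a2 where v: "v = (a0, a1, a2)"
    by (cases v)
  obtain b0 b1 b2 where w: "w = (b0, b1, b2)"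
    by (cases w)
  show "nabla1 v w = nabla 1 v w"
    unfolding v w nabla1.simps nabla.simps prod.inject
    by (intro conjI refl mod_eqI[where k = "a0 * a2 * b1 + a1 * b0 * b2"]) (simp add: algebra_simps)
qed

lemma nabla2_eq: "nabla2 = nabla (-1)"
proof (intro ext)
  fix v w :: "int \<times> int \<times> int"
  obtain a0 a1 a2 where v: "v = (a0, a1, a2)"
    by (cases v)
  obtain b0 b1 b2 where w: "w = (b0, b1, b2)"
    by (cases w)
  show "nabla2 v w = nabla (-1) v w"
    unfolding v w nabla2.simps nabla.simps prod.inject
    by (intro conjI refl mod_eqI[where k = "a0 * b1 * b2 + a1 * a2 * b0"]) (simp add: algebra_simps)
qed

lemma finite_carrier_C: "finite carrier_C"
  by (simp add: carrier_C_def)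

lemma card_carrier_C: "card carrier_C = 729"
  by (simp add: carrier_C_def card_cartesian_product)

lemma nabla_in_carrier_C: "nabla s v w \<in> carrier_C"
  by (cases v; cases w) (simp add: carrier_C_def)

section \<open>A basis in order 729\<close>

context hamiltonian_loop
begin

lemma ex_hamiltonian_loop_max:
  assumes "a \<in> Q" "b \<in> Q" "c \<in> Q" "asc a b c \<noteq> e"
  shows "\<exists>N. hamiltonian_loop_max Q (\<boxplus>) e F G m a b c N"
proof -
  let ?S = "{N. submodule N \<and> asc a b c \<notin> N}"
  have "?S \<subseteq> Pow Z"
    by (auto simp: submodule_def)
  then have "finite ?S"
    using finite_Z by (meson finite_Pow_iff finite_subset)
  moreover have "{e} \<in> ?S"
    using assms(4) by (simp add: submodule_def)
  ultimately obtain N where N: "N \<in> ?S" and max: "\<And>M. M \<in> ?S \<Longrightarrow> N \<subseteq> M \<Longrightarrow> N = M"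
    using finite_has_maximal[of ?S] by blast
  have "hamiltonian_loop_max Q (\<boxplus>) e F G m a b c N"
  proof
    fix M
    assume "submodule M" "N \<subseteq> M" "asc a b c \<notin> M"
    then show "M = N"
      using max[of M] by simp
  qed (use assms N in auto)
  then show ?thesis
    by blast
qed

lemma comb_set_vanish:
  assumes "additive \<phi>" "\<And>z. z \<in> Z \<Longrightarrow> \<phi> z = e" "a \<in> Q" "b \<in> Q" "c \<in> Q"
    and "\<phi> a = e" "\<phi> b = e" "\<phi> c = e" and "x \<in> comb_set a b c"
  shows "\<phi> x = e"
proof -
  obtain i j k z where x: "x = comb a b c (i, j, k, z)" and "z \<in> Z"
    using assms(9) by (auto simp: comb_set_def comb_index_def)
  then show ?thesis
    unfolding x using additive_comb[OF assms(1-5)] assms(6-8) by simp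
qed

text \<open>Alternation settles all associators of the generators; additivity then frees one
  argument after another, since the combinations of generators with central terms exhaust Q.\<close>

lemma asc_vanish:
  assumes abc [simp]: "a \<in> Q" "b \<in> Q" "c \<in> Q" and span: "comb_set a b c = Q" and d: "asc a b c = e"
    and [simp]: "x \<in> Q" "y \<in> Q" "w \<in> Q"
  shows "asc x y w = e"
proof -
  note vanish = comb_set_vanish[OF _ _ abc, unfolded span]
  have gens: "asc u v z = e" if "u \<in> {a, b, c}" "v \<in> {a, b, c}" "z \<in> {a, b, c}" for u v z
  proof -
    have "asc b a c = e" "asc a c b = e" "asc c b a = e" "asc b c a = e" "asc c a b = e"
      using asc_swap[of a b c] asc_swap[of b a c] asc_swap[of a c b] asc_flip[of a b c] d by simp_all
    then show ?thesis
      using that d by auto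
  qed
  have 1: "asc u v z = e" if "u \<in> Q" "v \<in> {a, b, c}" "z \<in> {a, b, c}" for u v z
  proof -
    have vz: "v \<in> Q" "z \<in> Q"
      using that by auto
    show ?thesis
      by (rule vanish[OF additive_asc(1)[OF vz]]) (use that(1) vz gens[OF _ that(2,3)] in simp_all)
  qed
  have 2: "asc u v z = e" if "u \<in> Q" "v \<in> Q" "z \<in> {a, b, c}" for u v z
  proof -
    have uz: "u \<in> Q" "z \<in> Q"
      using that by auto
    show ?thesis
      by (rule vanish[OF additive_asc(2)[OF uz]]) (use that(2) uz 1[OF that(1) _ that(3)] in simp_all)
  qed
  show ?thesis
    by (rule vanish[OF additive_asc(3)[of x y]]) (use 2[of x y] in simp_all)
qed

end

context hamiltonian_loop_max
begin

lemma ex_basis: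
  assumes card_Q: "card Q = 729"
  obtains a' b' c' where "a' \<in> Q" "b' \<in> Q" "c' \<in> Q"
    "\<zeta> a' = e" "\<zeta> b' = triple a'" "\<zeta> c' = triple b'" "triple c' = e"
    "triple (triple b') = e" "triple (triple a') \<noteq> e" "triple (triple (triple a')) = e"
    "asc a' b' c' = triple (triple a') \<or> asc a' b' c' = neg (triple (triple a'))"
proof -
  note eq = card_Q_eq[OF card_Q]
  let ?T = "{e, t, neg t}"
  have T: "adjoin N t = ?T"
    by (auto simp: adjoin_def eq(1))
  have T3: "card ?T = 3"
    using card_adjoin_t T eq(1) by simp
  have rad: "triple u \<in> ?T" "\<zeta> u \<in> ?T" if "u \<in> Z" for u
    using triple_in_radical[OF that] zeta_in_radical[OF that] by (simp_all only: eq(3))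
  have asc_T: "asc x y w \<in> ?T" if "x \<in> Q" "y \<in> Q" "w \<in> Q" for x y w
    unfolding T[symmetric] using that
    by (intro socle_Z) (simp_all add: triple_asc zeta_asc asc_in_Z)
  have T_vanish: "triple u = e" "\<zeta> u = e" if "u \<in> ?T" for u
    using that by (auto simp: triple_t zeta_t triple_neg zeta_neg)
  define f where "f u = (triple u, \<zeta> u)" for u
  \<comment> \<open>By \<open>socle_Z\<close> with N = {e}, elements of Z with equal image differ by
    an element of \<open>?T\<close>. So f takes at least 27 / 3 = 9 values, as many as
    \<open>?T \<times> ?T\<close> has elements.\<close>
  have "card Z \<le> card (f ` Z) * card ?T"
  proof (rule card_le_card_image_times[where \<delta> = "\<lambda>x y. y \<boxplus> neg x", OF finite_Z])
    fix x y
    assume xy: "x \<in> Z" "y \<in> Z" "f x = f y"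
    then show "y \<boxplus> neg x \<in> ?T"
      unfolding T[symmetric]
      by (intro socle_Z) (auto simp: f_def triple_add zeta_add triple_neg zeta_neg)
  qed auto
  then have "card (?T \<times> ?T) \<le> card (f ` Z)"
    using eq(2) T3 by (simp add: card_cartesian_product del: insert_Times_insert)
  moreover have "f ` Z \<subseteq> ?T \<times> ?T"
    unfolding f_def using rad by (intro image_subsetI SigmaI)
  ultimately have f_surj: "f ` Z = ?T \<times> ?T"
    by (intro card_seteq) auto
  have "(t, e) \<in> f ` Z" "(e, t) \<in> f ` Z"
    unfolding f_surj by auto
  then obtain p q where [simp]: "p \<in> Z" "q \<in> Z" and p: "triple p = t" "\<zeta> p = e"
    and q: "triple q = e" "\<zeta> q = t"
    by (auto simp: f_def)
  \<comment> \<open>The pairs (p, e), (q, p), (e, q) are admissible: \<zeta> p = e = 3 e, \<zeta> q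
    = t = 3 p and \<zeta> e = e = 3 q.\<close>
  obtain a' where a': "a' \<in> Q" "triple a' = p" "\<zeta> a' = e"
    using eq(4)[of p e] p by auto
  obtain b' where b': "b' \<in> Q" "triple b' = q" "\<zeta> b' = p"
    using eq(4)[of q p] p q by auto
  obtain c' where c': "c' \<in> Q" "triple c' = e" "\<zeta> c' = q"
    using eq(4)[of e q] q by auto
  \<comment> \<open>The maps 9, 3 \<zeta> and \<zeta>^2 are dual to a', b', c' with value t.\<close>
  have "inj_on (comb a' b' c') comb_index"
    by (rule inj_on_comb[where t = t, OF _ _ _ _ _ _ additive_comp[OF additive_triple additive_triple]
          additive_comp[OF additive_triple additive_zeta] additive_comp[OF additive_zeta additive_zeta]])
      (use rad in \<open>simp_all add: triple_t a' b' c' p q T_vanish\<close>)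
  then have "card (comb_set a' b' c') = card Q"
    using card_comb_set eq(2) card_Q by simp
  then have span: "comb_set a' b' c' = Q"
    using a' b' c' by (intro card_subset_eq finite_Q comb_set_subset) auto
  \<comment> \<open>Otherwise all associators would vanish, among them t.\<close>
  have "asc a' b' c' \<noteq> e"
    using asc_vanish[OF a'(1) b'(1) c'(1) span _ a b c] t_ne_e by blast
  moreover have "asc a' b' c' \<in> ?T"
    using a' b' c' by (intro asc_T)
  ultimately show ?thesis
    using that[of a' b' c'] a' b' c' p q triple_t by auto
qed

end

section \<open>Integer coordinates with respect to the basis\<close>

locale hamiltonian_basis = hamiltonian_loop +
  fixes a b c :: 'a and \<sigma> :: int
  assumes a [simp]: "a \<in> Q" and b [simp]: "b \<in> Q" and c [simp]: "c \<in> Q"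
    and zeta_a: "\<zeta> a = e" and zeta_b: "\<zeta> b = triple a" and zeta_c: "\<zeta> c = triple b"
    and triple_c: "triple c = e" and triple2_b: "triple (triple b) = e"
    and triple2_a: "triple (triple a) \<noteq> e" and triple3_a: "triple (triple (triple a)) = e"
    and card_Q: "card Q = 729"
    and sign: "asc a b c = (if \<sigma> = 1 then triple (triple a) else neg (triple (triple a)))"
    and sigma: "\<sigma> = 1 \<or> \<sigma> = -1"
begin

text \<open>Negative coefficients are taken as residues modulo 27. The rules for multiples are
  therefore stated on \<open>Q27\<close>, the elements annihilated by 27, which contains the
  basis.\<close>

definition zm :: "int \<Rightarrow> 'a \<Rightarrow> 'a" where
  "zm i x = nm (nat (i mod 27)) x"

lemma nm_27: "x \<in> Q \<Longrightarrow> nm 27 x = triple (triple (triple x))"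
  using nm_mult[of x 9 3] nm_mult[of "triple x" 3 3] by (simp add: nm_3)

definition Q27 :: "'a set" where
  "Q27 = {x \<in> Q. nm 27 x = e}"

lemma Q27I: "x \<in> Q \<Longrightarrow> nm 27 x = e \<Longrightarrow> x \<in> Q27"
  and Q27_nm: "x \<in> Q27 \<Longrightarrow> nm 27 x = e"
  and Q27_Q [simp]: "x \<in> Q27 \<Longrightarrow> x \<in> Q"
  unfolding Q27_def by blast+

lemma nm_mod:
  assumes "x \<in> Q27"
  shows "nm (n mod 27) x = nm n x"
proof -
  have "nm n x = nm (n div 27 * 27) x \<boxplus> nm (n mod 27) x"
    using nm_add[of x "n div 27 * 27" "n mod 27"] assms by simp
  also have "nm (n div 27 * 27) x = e"
    using nm_mult[of x "n div 27" 27] assms by (simp add: Q27_nm)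
  finally show ?thesis
    using assms by simp
qed

lemma zm_closed [simp, intro]: "x \<in> Q \<Longrightarrow> zm i x \<in> Q"
  by (simp add: zm_def)

lemma zm_Z [simp, intro]: "x \<in> Z \<Longrightarrow> zm i x \<in> Z"
  by (simp add: zm_def)

lemma zm_Q27 [simp, intro]: "x \<in> Q27 \<Longrightarrow> zm i x \<in> Q27"
proof (rule Q27I)
  assume x: "x \<in> Q27"
  then have "nm 27 (zm i x) = nm (nat (i mod 27)) (nm 27 x)"
    unfolding zm_def by (metis Q27_Q mult.commute nm_mult)
  then show "nm 27 (zm i x) = e"
    using x by (simp add: Q27_nm)
qed simp

lemma zm_0 [simp]: "zm 0 x = e" and zm_1: "x \<in> Q \<Longrightarrow> zm 1 x = x"
  by (simp_all add: zm_def)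

lemma zm_3: "x \<in> Q \<Longrightarrow> zm 3 x = triple x"
  by (simp add: zm_def nm_3)

lemma zm_e [simp]: "zm i e = e"
  by (simp add: zm_def)

lemma zm_add:
  assumes "x \<in> Q27"
  shows "zm (i + j) x = zm i x \<boxplus> zm j x"
proof -
  have "(i + j) mod 27 = (i mod 27 + j mod 27) mod 27"
    by (rule mod_add_eq[symmetric])
  then have "nat ((i + j) mod 27) = (nat (i mod 27) + nat (j mod 27)) mod 27"
    by (simp only: nat_mod_distrib nat_add_distrib pos_mod_sign zero_less_numeral
        add_nonneg_nonneg zero_le_numeral nat_numeral)
  then show ?thesis
    by (simp only: zm_def nm_mod[OF assms] nm_add[OF Q27_Q[OF assms]])
qed

lemma zm_mult:
  assumes "x \<in> Q27"
  shows "zm (i * j) x = zm i (zm j x)"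
proof -
  have "(i * j) mod 27 = ((i mod 27) * (j mod 27)) mod 27"
    by (rule mod_mult_eq[symmetric])
  then have "nat ((i * j) mod 27) = (nat (i mod 27) * nat (j mod 27)) mod 27"
    by (simp only: nat_mod_distrib nat_mult_distrib pos_mod_sign zero_less_numeral
        mult_nonneg_nonneg zero_le_numeral nat_numeral)
  then show ?thesis
    by (simp only: zm_def nm_mod[OF assms] nm_mult[OF Q27_Q[OF assms]])
qed

lemma zm_neg:
  assumes "x \<in> Q27"
  shows "zm (- i) x = neg (zm i x)"
proof -
  have "zm i x \<boxplus> zm (- i) x = e"
    using zm_add[OF assms, of i "- i"] by simp
  then show ?thesis
    using assms neg_unique[of "zm i x" "zm (- i) x"] by simp
qed

lemma zm_cong:
  assumes x: "x \<in> Q27" and n: "zm n x = e" and ij: "[i = j] (mod n)"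
  shows "zm i x = zm j x"
proof -
  obtain k where "i = j + k * n"
    using ij unfolding cong_iff_dvd_diff by (metis add.commute diff_add_cancel dvdE mult.commute)
  then show ?thesis
    using x n by (simp add: zm_add zm_mult)
qed

lemma additive_zm: "additive \<phi> \<Longrightarrow> x \<in> Q \<Longrightarrow> \<phi> (zm i x) = zm i (\<phi> x)"
  by (simp add: zm_def additive_nm)

lemma asc_zm:
  assumes "x \<in> Q" "y \<in> Q" "w \<in> Q"
  shows "asc (zm i x) y w = zm i (asc x y w)" "asc x (zm i y) w = zm i (asc x y w)"
    "asc x y (zm i w) = zm i (asc x y w)"
  using assms by (simp_all add: additive_zm additive_asc additive_zm[of "\<lambda>x. asc x y w"]
    additive_zm[of "\<lambda>y. asc x y w"] additive_zm[of "\<lambda>w. asc x y w"])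

abbreviation t where "t \<equiv> triple (triple a)"

lemma basis_27 [simp]: "a \<in> Q27" "b \<in> Q27" "c \<in> Q27"
  by (auto intro!: Q27I simp: nm_27 triple3_a triple2_b triple_c)

lemma zm_9: "x \<in> Q27 \<Longrightarrow> zm 9 x = triple (triple x)"
  using zm_mult[of x 3 3] by (simp add: zm_3)

lemma t_27 [simp]: "t \<in> Q27"
  using zm_Q27[of a 9] by (simp add: zm_9)

lemma zm_t_cong: "[i = j] (mod 3) \<Longrightarrow> zm i t = zm j t"
  by (rule zm_cong) (simp_all add: zm_3 triple3_a)

lemma zm_t_eq_e:
  assumes "zm i t = e"
  shows "3 dvd i"
proof -
  have 2: "t \<boxplus> t \<noteq> e"
  proof
    assume "t \<boxplus> t = e"
    then have "triple t = t"
      by (simp add: triple_def[of t])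
    then show False
      using triple3_a triple2_a by simp
  qed
  have "zm (i mod 3) t = e"
    using zm_t_cong[of "i mod 3" i] assms by (simp add: cong_def)
  moreover have "i mod 3 = 0 \<or> i mod 3 = 1 \<or> i mod 3 = 2"
    by auto
  moreover have "zm 1 t = t" "zm 2 t = t \<boxplus> t"
    using zm_add[of t 1 1] by (simp_all add: zm_1)
  ultimately have "i mod 3 = 0"
    using triple2_a 2 by auto
  then show ?thesis
    by auto
qed

text \<open>One factor 3 at a time: 9 (i a) = i t gives i = 3 j, then 3 (i a) = j t gives j = 3 k,
  and finally i a = k t.\<close>

lemma zm_a_eq_e:
  assumes "zm i a = e"
  shows "27 dvd i"
proof -
  have 9: "zm (k * 9) a = zm k t" for k
    by (simp add: zm_mult zm_9)
  have "zm i t = e"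
    using assms zm_mult[of a 9 i] zm_mult[of a i 9] by (simp add: zm_9 mult.commute)
  then obtain j where j: "i = 3 * j"
    using zm_t_eq_e by blast
  have "zm j t = zm 3 (zm i a)"
    using 9[of j] zm_mult[of a 3 i] mult.commute[of j 9] by (simp add: j)
  then obtain k where k: "j = 3 * k"
    using zm_t_eq_e[of j] assms by auto
  have "zm k t = e"
    using 9[of k] assms mult.commute[of k 9] by (simp add: j k)
  then show ?thesis
    using zm_t_eq_e[of k] by (auto simp: j k)
qed

fun h :: "int \<times> int \<times> int \<Rightarrow> 'a" where
  "h (i, j, k) = (zm i a \<boxplus> zm j b) \<boxplus> zm k c"

lemma h_closed [simp, intro]: "h v \<in> Q"
  by (cases v) simp

lemma h_cong:
  assumes "[i = i'] (mod 27)" "[j = j'] (mod 9)" "[k = k'] (mod 3)"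
  shows "h (i, j, k) = h (i', j', k')"
proof -
  have "zm 27 a = e"
    by (simp add: zm_def)
  then have "zm i a = zm i' a" "zm j b = zm j' b" "zm k c = zm k' c"
    using assms by (auto intro!: zm_cong[of a 27] zm_cong[of b 9] zm_cong[of c 3]
        simp: zm_9 zm_3 triple2_b triple_c)
  then show ?thesis
    by simp
qed

lemma assocI: "asc x y w = e \<Longrightarrow> x \<in> Q \<Longrightarrow> y \<in> Q \<Longrightarrow> w \<in> Q \<Longrightarrow> (x \<boxplus> y) \<boxplus> w = x \<boxplus> (y \<boxplus> w)"
  using asc_eq[of x y w] by simp

lemma absorb:
  "zm (3 * i') a \<boxplus> h (i, j, k) = h (i + 3 * i', j, k)"
  "zm (3 * j') b \<boxplus> h (i, j, k) = h (i, j + 3 * j', k)"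
proof -
  have [simp]: "zm (3 * i') a \<in> Z" "zm (3 * j') b \<in> Z"
    using zm_mult[of a i' 3] zm_mult[of b j' 3] by (simp_all add: zm_3 mult.commute)
  show "zm (3 * i') a \<boxplus> h (i, j, k) = h (i + 3 * i', j, k)"
    by (simp add: zm_add add_commute[of "zm i a" "zm (3 * i') a"] Z_assoc)
  show "zm (3 * j') b \<boxplus> h (i, j, k) = h (i, j + 3 * j', k)"
    by (simp add: zm_add add_commute[of "zm j b" "zm (3 * j') b"] Z_assoc
        Z_left_commute[of "zm (3 * j') b"])
qed

lemma asc_basis: "asc a b c = zm (9 * \<sigma>) a" "asc a b c \<in> Q27"
proof -
  have "zm (9 * 1) a = t" "zm (9 * (-1)) a = neg t"
    using zm_neg[of a 9] by (simp_all add: zm_9)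
  then show *: "asc a b c = zm (9 * \<sigma>) a"
    using sign sigma by auto
  show "asc a b c \<in> Q27"
    unfolding * by simp
qed

text \<open>Evaluating ((y + x) + w) + w' in two ways, with w and w' the multiples of c, shows that
  (x + w) + (y + w') exceeds (x + y) + (w + w') by [x, y, w] - [x, y, w']. By trilinearity this is
  (i j' - j i') (k - k') [a, b, c], and [a, b, c] = 9 \<sigma> a.\<close>

lemma h_add:
  "h (i, j, k) \<boxplus> h (i', j', k')
    = h (i + i' + 9 * (\<sigma> * ((i * j' - j * i') * (k - k'))), j + j', k + k')"
proof -
  note [simp] = asc_in_Z
  define u where "u = zm i a"
  define v where "v = zm j b"
  define w where "w = zm k c"
  define u' where "u' = zm i' a"
  define v' where "v' = zm j' b"
  define w' where "w' = zm k' c"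
  note defs = u_def v_def w_def u'_def v'_def w'_def
  have [simp]: "u \<in> Q" "v \<in> Q" "w \<in> Q" "u' \<in> Q" "v' \<in> Q" "w' \<in> Q"
    by (simp_all add: defs)
  have flip: "asc b a c = neg (asc a b c)"
    by (rule asc_swap) auto
  define N where "N = (i * j' - j * i') * (k - k')"
  let ?d = "asc a b c"
  have asc_val: "asc (u \<boxplus> v) (u' \<boxplus> v') (zm l c) = zm ((i * j' - j * i') * l) ?d" for l
  proof -
    let ?w = "zm l c"
    have neg_d: "neg ?d = zm (-1) ?d"
      using asc_basis(2) by (simp add: zm_neg zm_1)
    have "asc (u \<boxplus> v) (u' \<boxplus> v') ?w
        = (asc u u' ?w \<boxplus> asc u v' ?w) \<boxplus> (asc v u' ?w \<boxplus> asc v v' ?w)"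
      by (subst asc_add_left) (simp_all add: asc_add_mid)
    also have "asc u u' ?w = e"
      by (simp add: defs asc_zm)
    also have "asc v v' ?w = e"
      by (simp add: defs asc_zm)
    also have "asc u v' ?w = zm (i * j' * l) ?d"
      using asc_basis(2) by (simp add: defs asc_zm ac_simps flip: zm_mult)
    also have "asc v u' ?w = zm (- (j * i' * l)) ?d"
      using asc_basis(2) by (simp add: defs asc_zm flip neg_d ac_simps flip: zm_mult)
    finally show ?thesis
      using asc_basis(2) by (simp add: left_diff_distrib flip: zm_add)
  qed
  \<comment> \<open>Every associator occurring here has three arguments generated by a and b alone,
    so it vanishes by alternation.\<close>
  have uv: "(u \<boxplus> v) \<boxplus> (u' \<boxplus> v') = (u \<boxplus> u') \<boxplus> (v \<boxplus> v')"
  proof -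
    have "(u \<boxplus> v) \<boxplus> (u' \<boxplus> v') = ((u \<boxplus> v) \<boxplus> u') \<boxplus> v'"
      by (rule assocI[symmetric]) (simp_all add: defs asc_add_left asc_zm)
    also have "(u \<boxplus> v) \<boxplus> u' = u' \<boxplus> (u \<boxplus> v)"
      by (rule add_commute) simp_all
    also have "u' \<boxplus> (u \<boxplus> v) = (u' \<boxplus> u) \<boxplus> v"
      by (rule assocI[symmetric]) (simp_all add: defs asc_zm)
    also have "((u' \<boxplus> u) \<boxplus> v) \<boxplus> v' = (u' \<boxplus> u) \<boxplus> (v \<boxplus> v')"
      by (rule assocI) (simp_all add: defs asc_zm asc_add_left)
    finally show ?thesis
      by (simp add: add_commute[of u' u])
  qed
  define x where "x = u \<boxplus> v"
  define y where "y = u' \<boxplus> v'"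
  have [simp]: "x \<in> Q" "y \<in> Q"
    by (simp_all add: x_def y_def)
  have ww: "asc z w w' = e" "asc w z w' = e" if "z \<in> Q" for z
    using that by (simp_all add: defs asc_zm)
  have "((y \<boxplus> x) \<boxplus> w) \<boxplus> w' = (y \<boxplus> x) \<boxplus> (w \<boxplus> w')"
    by (rule assocI) (simp_all add: ww)
  moreover have "((y \<boxplus> x) \<boxplus> w) \<boxplus> w' = asc y x w \<boxplus> (((x \<boxplus> w) \<boxplus> y) \<boxplus> w')"
    by (simp add: asc_eq[of y x w] Z_assoc add_commute[of y "x \<boxplus> w"])
  moreover have "((x \<boxplus> w) \<boxplus> y) \<boxplus> w' = asc x y w' \<boxplus> ((x \<boxplus> w) \<boxplus> (y \<boxplus> w'))"
    by (simp add: asc_eq[of "x \<boxplus> w" y w'] asc_add_left ww)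
  ultimately have "(x \<boxplus> y) \<boxplus> (w \<boxplus> w') = (neg (asc x y w) \<boxplus> asc x y w') \<boxplus> ((x \<boxplus> w) \<boxplus> (y \<boxplus> w'))"
    by (simp add: asc_swap(1)[of x y w] add_commute[of y x] Z_assoc)
  also have "neg (asc x y w) \<boxplus> asc x y w' = zm (- N) ?d"
    unfolding x_def y_def w_def w'_def asc_val N_def using asc_basis(2)
    by (simp add: algebra_simps flip: zm_neg zm_add)
  finally have eq: "(x \<boxplus> y) \<boxplus> (w \<boxplus> w') = neg (zm N ?d) \<boxplus> ((x \<boxplus> w) \<boxplus> (y \<boxplus> w'))"
    by (simp add: zm_neg asc_basis(2))
  have "(x \<boxplus> w) \<boxplus> (y \<boxplus> w') = zm N ?d \<boxplus> ((x \<boxplus> y) \<boxplus> (w \<boxplus> w'))"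
    unfolding eq by simp
  also have "zm N ?d = zm (3 * (3 * (\<sigma> * N))) a"
    unfolding asc_basis(1) by (simp add: ac_simps flip: zm_mult)
  also have "(x \<boxplus> y) \<boxplus> (w \<boxplus> w') = h (i + i', j + j', k + k')"
    unfolding x_def y_def uv by (simp add: defs zm_add)
  finally show ?thesis
    unfolding absorb by (simp add: x_def y_def defs N_def)
qed

lemma zeta_h: "\<zeta> (h (i, j, k)) = zm (3 * j) a \<boxplus> zm (3 * k) b"
proof -
  have "zm (3 * j) a = zm j (triple a)" "zm (3 * k) b = zm k (triple b)"
    using zm_mult[of a j 3] zm_mult[of b k 3] by (simp_all add: zm_3 mult.commute)
  then show ?thesis
    by (simp add: zeta_add additive_zm[OF additive_zeta] zeta_a zeta_b zeta_c)
qed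

lemma F_h: "F (h (i, j, k)) = h (3 * j - i, 3 * k - j, - k)"
proof -
  have "F (h (i, j, k)) = (zm (3 * j) a \<boxplus> zm (3 * k) b) \<boxplus> neg (h (i, j, k))"
    using add_commute[of "neg (h (i, j, k))" "\<zeta> (h (i, j, k))"]
    by (simp add: F_eq zeta_h del: h.simps)
  also have "neg (h (i, j, k)) = h (- i, - j, - k)"
    by (simp add: neg_distrib zm_neg)
  also have "(zm (3 * j) a \<boxplus> zm (3 * k) b) \<boxplus> h (- i, - j, - k)
      = zm (3 * j) a \<boxplus> (zm (3 * k) b \<boxplus> h (- i, - j, - k))"
    using Z_assoc[of "zm (3 * j) a"] zm_mult[of a j 3] by (simp add: zm_3 mult.commute del: h.simps)
  finally show ?thesis
    by (simp only: absorb) simp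
qed

lemma G_h: "G (h (i, j, k)) = h (2 * i - 3 * j, 2 * j - 3 * k, 2 * k)"
proof -
  have "G (h (i, j, k)) = neg (zm (3 * j) a \<boxplus> zm (3 * k) b) \<boxplus> (h (i, j, k) \<boxplus> h (i, j, k))"
    using add_commute[of "neg (\<zeta> (h (i, j, k)))" "h (i, j, k) \<boxplus> h (i, j, k)"]
    by (simp add: G_eq zeta_h del: h.simps)
  also have "\<dots> = (zm (3 * (- j)) a \<boxplus> zm (3 * (- k)) b) \<boxplus> (h (i, j, k) \<boxplus> h (i, j, k))"
    by (simp add: neg_distrib zm_neg del: h.simps)
  also have "\<dots> = zm (3 * (- j)) a \<boxplus> (zm (3 * (- k)) b \<boxplus> (h (i, j, k) \<boxplus> h (i, j, k)))"
    using Z_assoc[of "zm (3 * (- j)) a"] zm_mult[of a "- j" 3] by (simp add: zm_3 mult.commute del: h.simps)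
  also have "h (i, j, k) \<boxplus> h (i, j, k) = h (2 * i, 2 * j, 2 * k)"
    by (simp add: h_add mult.commute del: h.simps)
  also have "zm (3 * (- j)) a \<boxplus> (zm (3 * (- k)) b \<boxplus> h (2 * i, 2 * j, 2 * k))
      = h (2 * i + 3 * (- j), 2 * j + 3 * (- k), 2 * k)"
    by (simp only: absorb)
  finally show ?thesis
    by (simp del: h.simps)
qed

text \<open>F and G are linear in coordinates and both act as -1 modulo 3. So the cubic term of F v
  + G w is that of (-v) + (-w), and its odd degree turns k - k' into k' - k.\<close>

lemma h_nabla: "h (nabla \<sigma> v w) = m (h v) (h w)"
proof -
  obtain i j k where v: "v = (i, j, k)"
    by (cases v)
  obtain i' j' k' where w: "w = (i', j', k')"
    by (cases w)
  have "m (h v) (h w) = h (3 * j - i, 3 * k - j, - k) \<boxplus> h (2 * i' - 3 * j', 2 * j' - 3 * k', 2 * k')"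
    unfolding v w by (simp only: m_eq h_closed F_h G_h)
  also have "\<dots> = h (nabla \<sigma> v w)"
    unfolding h_add v w nabla.simps
  proof (rule h_cong)
    have c3: "[((3 * j - i) * (2 * j' - 3 * k') - (3 * k - j) * (2 * i' - 3 * j')) * (- k - 2 * k')
        = (k' - k) * (i * j' - j * i')] (mod 3)"
    proof -
      have "[(3 * j - i) * (2 * j' - 3 * k') - (3 * k - j) * (2 * i' - 3 * j') = i * j' - j * i'] (mod 3)"
        unfolding cong_iff_dvd_diff
        by (rule dvdI[where k = "2 * j * j' - 3 * j * k' + i * k' - 2 * k * i' + 3 * k * j' - j * j' - i * j' + j * i'"])
          (simp add: algebra_simps)
      moreover have "[- k - 2 * k' = k' - k] (mod 3)"
        unfolding cong_iff_dvd_diff by (rule dvdI[where k = "- k'"]) simp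
      ultimately show ?thesis
        using cong_mult by (metis mult.commute)
    qed
    have c27: "[9 * (\<sigma> * X) = 9 * (\<sigma> * Y)] (mod 27)" if "[X = Y] (mod 3)" for X Y
      by (rule cong_scale[OF cong_scalar_left[OF that]]) simp
    have "[3 * j - i + (2 * i' - 3 * j') = 26 * i + 3 * j + 2 * i' + 24 * j'] (mod 27)"
      unfolding cong_iff_dvd_diff by (rule dvdI[where k = "- i - j'"]) simp
    from cong_add[OF this c27[OF c3]]
    show "[3 * j - i + (2 * i' - 3 * j') + 9 * (\<sigma> * (((3 * j - i) * (2 * j' - 3 * k') - (3 * k - j) * (2 * i' - 3 * j')) * (- k - 2 * k'))) =
      (26 * i + 3 * j + 2 * i' + 24 * j' + 9 * (\<sigma> * ((k' - k) * (i * j' - j * i')))) mod 27] (mod 27)"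
      by simp
    show "[3 * k - j + (2 * j' - 3 * k') = (8 * j + 3 * k + 2 * j' + 6 * k') mod 9] (mod 9)"
      unfolding cong_mod_right unfolding cong_iff_dvd_diff by (rule dvdI[where k = "- j - k'"]) simp
    show "[- k + 2 * k' = (2 * k + 2 * k') mod 3] (mod 3)"
      unfolding cong_mod_right unfolding cong_iff_dvd_diff by (rule dvdI[where k = "- k"]) simp
  qed
  finally show ?thesis ..
qed

text \<open>\<zeta>^2 reveals k as k t, then \<zeta> reveals j through 3 j a, and what remains is i
  a.\<close>

lemma inj_on_h: "inj_on h carrier_C"
proof (rule inj_onI)
  fix v w
  assume v: "v \<in> carrier_C" and w: "w \<in> carrier_C" and eq: "h v = h w"
  obtain i j k where v_eq: "v = (i, j, k)"
    by (cases v)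
  obtain i' j' k' where w_eq: "w = (i', j', k')"
    by (cases w)
  have bd: "0 \<le> i" "i < 27" "0 \<le> j" "j < 9" "0 \<le> k" "k < 3"
    "0 \<le> i'" "i' < 27" "0 \<le> j'" "j' < 9" "0 \<le> k'" "k' < 3"
    using v w by (auto simp: carrier_C_def v_eq w_eq)
  have "\<zeta> (\<zeta> (h (i, j, k))) = zm k t" for i j k
    by (simp add: zeta_add additive_zm[OF additive_zeta] zeta_a zeta_b zeta_c zeta_triple)
  then have "zm (k - k') t = e"
    using eq zm_add[of t "k - k'" k'] by (simp add: v_eq w_eq) (metis e_add right_cancel_iff t_27 Q27_Q zm_closed e_closed)
  then have "3 dvd k - k'"
    by (rule zm_t_eq_e)
  then have k: "k = k'"
    using bd by (intro residue_eqI[of 3 1]) simp_all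
  have "\<zeta> (h (i, j, k)) = \<zeta> (h (i', j', k))"
    using eq k by (simp add: v_eq w_eq)
  then have "zm (3 * j) a = zm (3 * j') a"
    by (simp only: zeta_h k) simp
  then have "zm (3 * j - 3 * j') a = e"
    using zm_add[of a "3 * j" "- (3 * j')"] by (simp add: zm_neg)
  then have "27 dvd 3 * j - 3 * j'"
    by (rule zm_a_eq_e)
  then have "3 * 9 dvd 3 * (j - j')"
    by (simp add: algebra_simps)
  then have "9 dvd j - j'"
    by (subst (asm) dvd_times_left_cancel_iff) simp_all
  then have j: "j = j'"
    using bd by (intro residue_eqI[of 9 1]) simp_all
  have "zm i a = zm i' a"
    using eq by (simp add: v_eq w_eq j k)
  then have "zm (i - i') a = e"
    using zm_add[of a i "- i'"] by (simp add: zm_neg)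
  then have "27 dvd i - i'"
    by (rule zm_a_eq_e)
  then have "i = i'"
    using bd by (intro residue_eqI[of 27 1]) simp_all
  then show "v = w"
    by (simp add: v_eq w_eq j k)
qed

lemma isomorphic_nabla: "isomorphic Q m carrier_C (nabla \<sigma>)"
proof -
  have "h ` carrier_C = Q"
    using inj_on_h card_Q card_carrier_C finite_Q
    by (intro card_subset_eq) (auto simp: card_image)
  then have bij: "bij_betw h carrier_C Q"
    using inj_on_h by (simp add: bij_betw_def)
  let ?g = "inv_into carrier_C h"
  have "?g (m x y) = nabla \<sigma> (?g x) (?g y)" if "x \<in> Q" "y \<in> Q" for x y
  proof -
    have "h (nabla \<sigma> (?g x) (?g y)) = m x y"
      unfolding h_nabla using that bij by (simp add: bij_betw_inv_into_right)
    then show ?thesis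
      using bij_betw_inv_into_left[OF bij nabla_in_carrier_C, of \<sigma> "?g x" "?g y"] by simp
  qed
  then show ?thesis
    unfolding isomorphic_def using bij_betw_inv_into[OF bij] by blast
qed

end

section \<open>The two quasigroups on the residue classes\<close>

text \<open>Multiplied by 9 and a sign, this is the cocycle by which the loop differs from the group
  Z_27 x Z_9 x Z_3. Up to sign, the associator it produces is the determinant of the three arguments
  modulo 3.\<close>

fun ddet :: "int \<times> int \<times> int \<Rightarrow> int \<times> int \<times> int \<Rightarrow> int" where
  "ddet (a0, a1, a2) (b0, b1, b2) = (b2 - a2) * (a0 * b1 - a1 * b0)"

lemma ddet_cong:
  assumes "[a0 = a0'] (mod 3)" "[a1 = a1'] (mod 3)" "[a2 = a2'] (mod 3)"
    and "[b0 = b0'] (mod 3)" "[b1 = b1'] (mod 3)" "[b2 = b2'] (mod 3)"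
  shows "[ddet (a0, a1, a2) (b0, b1, b2) = ddet (a0', a1', a2') (b0', b1', b2')] (mod 3)"
  unfolding ddet.simps by (intro cong_mult cong_diff assms)

definition reduce :: "int \<times> int \<times> int \<Rightarrow> int \<times> int \<times> int" where
  "reduce = (\<lambda>(i, j, k). (i mod 27, j mod 9, k mod 3))"

lemma reduce_eq_iff:
  "reduce (i, j, k) = reduce (i', j', k') \<longleftrightarrow> [i = i'] (mod 27) \<and> [j = j'] (mod 9) \<and> [k = k'] (mod 3)"
  by (simp add: reduce_def cong_def)

lemma reduce_reduce [simp]: "reduce (reduce v) = reduce v"
  by (cases v) (simp add: reduce_def)

lemma reduce_in_carrier_C [simp]: "reduce v \<in> carrier_C"
  by (cases v) (simp add: reduce_def carrier_C_def)

lemma reduce_id [simp]: "v \<in> carrier_C \<Longrightarrow> reduce v = v"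
  by (cases v) (auto simp: reduce_def carrier_C_def)

fun nabla_raw :: "int \<Rightarrow> int \<times> int \<times> int \<Rightarrow> int \<times> int \<times> int \<Rightarrow> int \<times> int \<times> int" where
  "nabla_raw s (a0, a1, a2) (b0, b1, b2) =
     (26 * a0 + 3 * a1 + 2 * b0 + 24 * b1 + 9 * (s * ddet (a0, a1, a2) (b0, b1, b2)),
      8 * a1 + 3 * a2 + 2 * b1 + 6 * b2, 2 * a2 + 2 * b2)"

lemma nabla_eq_reduce: "nabla s v w = reduce (nabla_raw s v w)"
  by (cases v; cases w) (simp add: reduce_def)

lemma cong_27_3: "[i = i'] (mod 27) \<Longrightarrow> [i = i'] (mod (3 :: int))"
  and cong_9_3: "[i = i'] (mod 9) \<Longrightarrow> [i = i'] (mod (3 :: int))"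
  by (erule cong_dvd_modulus, simp)+

text \<open>Behind the factor 9 only residues modulo 3 matter. Nested cubic terms can thus be
  simplified first, which keeps the polynomial identities below at low degree.\<close>

lemma cong_lift:
  fixes u :: int
  assumes "[u = u'] (mod 3)" "[v = v'] (mod 3)" "[x + 9 * (s * u') = y + 9 * (s * v')] (mod 27)"
  shows "[x + 9 * (s * u) = y + 9 * (s * v)] (mod 27)"
proof -
  have "[9 * (s * w) = 9 * (s * w')] (mod 27)" if "[w = w'] (mod 3)" for w w'
    by (rule cong_scale[OF cong_scalar_left[OF that]]) simp
  then show ?thesis
    using assms by (meson cong_add_lcancel cong_sym cong_trans)
qed

lemma nabla_raw_cong:
  assumes "reduce v = reduce v'" "reduce w = reduce w'"
  shows "reduce (nabla_raw s v w) = reduce (nabla_raw s v' w')"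
proof -
  obtain a0 a1 a2 where v: "v = (a0, a1, a2)"
    by (cases v)
  obtain a0' a1' a2' where v': "v' = (a0', a1', a2')"
    by (cases v')
  obtain b0 b1 b2 where w: "w = (b0, b1, b2)"
    by (cases w)
  obtain b0' b1' b2' where w': "w' = (b0', b1', b2')"
    by (cases w')
  have c: "[a0 = a0'] (mod 27)" "[a1 = a1'] (mod 9)" "[a2 = a2'] (mod 3)"
    "[b0 = b0'] (mod 27)" "[b1 = b1'] (mod 9)" "[b2 = b2'] (mod 3)"
    using assms by (simp_all add: v v' w w' reduce_eq_iff)
  note sc = c(1)[THEN cong_scale] c(2)[THEN cong_scale] c(3)[THEN cong_scale]
    c(4)[THEN cong_scale] c(5)[THEN cong_scale] c(6)[THEN cong_scale]
  have lin: "[26 * a0 + 3 * a1 + 2 * b0 + 24 * b1 = 26 * a0' + 3 * a1' + 2 * b0' + 24 * b1'] (mod 27)"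
    by (intro cong_add sc) simp_all
  have "[ddet (a0, a1, a2) (b0, b1, b2) = ddet (a0', a1', a2') (b0', b1', b2')] (mod 3)"
    by (rule ddet_cong[OF cong_27_3[OF c(1)] cong_9_3[OF c(2)] c(3) cong_27_3[OF c(4)] cong_9_3[OF c(5)] c(6)])
  from cong_scale[OF cong_scalar_left[OF this], of 27 9 s]
  have "[9 * (s * ddet (a0, a1, a2) (b0, b1, b2)) = 9 * (s * ddet (a0', a1', a2') (b0', b1', b2'))] (mod 27)"
    by simp
  note first = cong_add[OF lin this]
  have "[8 * a1 + 3 * a2 + 2 * b1 + 6 * b2 = 8 * a1' + 3 * a2' + 2 * b1' + 6 * b2'] (mod 9)"
    by (intro cong_add sc) simp_all
  moreover have "[2 * a2 + 2 * b2 = 2 * a2' + 2 * b2'] (mod 3)"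
    by (intro cong_add sc) simp_all
  ultimately show ?thesis
    unfolding v v' w w' nabla_raw.simps reduce_eq_iff using first by (intro conjI)
qed

lemma nabla_reduce: "nabla s (reduce v) (reduce w) = nabla s v w"
  unfolding nabla_eq_reduce by (rule nabla_raw_cong) simp_all

text \<open>The coordinates are recovered from the last to the first. Once the later ones agree, the
  cubic term only changes the coefficient of the first one from 2 to 2 - 9 R, still a unit modulo
  27.\<close>

lemma nabla_left_cancel:
  assumes C: "a \<in> carrier_C" "x \<in> carrier_C" "y \<in> carrier_C" and eq: "nabla s a x = nabla s a y"
  shows "x = y"
proof -
  obtain a0 a1 a2 where a: "a = (a0, a1, a2)"
    by (cases a)
  obtain x0 x1 x2 where x: "x = (x0, x1, x2)"
    by (cases x)
  obtain y0 y1 y2 where y: "y = (y0, y1, y2)"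
    by (cases y)
  have bd: "0 \<le> x0" "x0 < 27" "0 \<le> x1" "x1 < 9" "0 \<le> x2" "x2 < 3"
    "0 \<le> y0" "y0 < 27" "0 \<le> y1" "y1 < 9" "0 \<le> y2" "y2 < 3"
    using C by (auto simp: x y carrier_C_def)
  note eq = eq[unfolded a x y nabla.simps prod.inject]
  have "3 dvd 2 * (x2 - y2)"
    using eq[THEN conjunct2, THEN conjunct2] by (simp add: mod_eq_dvd_iff algebra_simps)
  then have 2: "x2 = y2"
    by (rule residue_eqI) (use bd in simp_all)
  have "9 dvd 2 * (x1 - y1)"
    using eq[THEN conjunct2, THEN conjunct1, unfolded 2] by (simp add: mod_eq_dvd_iff algebra_simps)
  then have 1: "x1 = y1"
    by (rule residue_eqI) (use bd in \<open>simp_all add: coprime_three_power\<close>)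
  define R where "R = s * (y2 - a2) * a1"
  have "27 dvd (26 * a0 + 3 * a1 + 2 * x0 + 24 * y1 + 9 * (s * ((y2 - a2) * (a0 * y1 - a1 * x0))))
      - (26 * a0 + 3 * a1 + 2 * y0 + 24 * y1 + 9 * (s * ((y2 - a2) * (a0 * y1 - a1 * y0))))"
    using eq[THEN conjunct1, unfolded 1 2] by (simp only: mod_eq_dvd_iff)
  also have "(26 * a0 + 3 * a1 + 2 * x0 + 24 * y1 + 9 * (s * ((y2 - a2) * (a0 * y1 - a1 * x0))))
      - (26 * a0 + 3 * a1 + 2 * y0 + 24 * y1 + 9 * (s * ((y2 - a2) * (a0 * y1 - a1 * y0))))
      = (2 - 9 * R) * (x0 - y0)"
    by (simp add: R_def algebra_simps)
  finally have d: "27 dvd (2 - 9 * R) * (x0 - y0)" .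
  have "\<not> 3 dvd 2 - 9 * R"
    by presburger
  then have "x0 = y0"
    by (intro residue_eqI[OF d]) (use bd in \<open>simp_all add: coprime_three_power\<close>)
  then show ?thesis
    by (simp add: x y 1 2)
qed

lemma nabla_right_cancel:
  assumes C: "a \<in> carrier_C" "x \<in> carrier_C" "y \<in> carrier_C" and eq: "nabla s x a = nabla s y a"
  shows "x = y"
proof -
  obtain a0 a1 a2 where a: "a = (a0, a1, a2)"
    by (cases a)
  obtain x0 x1 x2 where x: "x = (x0, x1, x2)"
    by (cases x)
  obtain y0 y1 y2 where y: "y = (y0, y1, y2)"
    by (cases y)
  have bd: "0 \<le> x0" "x0 < 27" "0 \<le> x1" "x1 < 9" "0 \<le> x2" "x2 < 3"
    "0 \<le> y0" "y0 < 27" "0 \<le> y1" "y1 < 9" "0 \<le> y2" "y2 < 3"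
    using C by (auto simp: x y carrier_C_def)
  note eq = eq[unfolded a x y nabla.simps prod.inject]
  have "3 dvd 2 * (x2 - y2)"
    using eq[THEN conjunct2, THEN conjunct2] by (simp add: mod_eq_dvd_iff algebra_simps)
  then have 2: "x2 = y2"
    by (rule residue_eqI) (use bd in simp_all)
  have "9 dvd 8 * (x1 - y1)"
    using eq[THEN conjunct2, THEN conjunct1, unfolded 2] by (simp add: mod_eq_dvd_iff algebra_simps)
  then have 1: "x1 = y1"
    by (rule residue_eqI) (use bd in \<open>simp_all add: coprime_three_power\<close>)
  define R where "R = s * (a2 - y2) * a1"
  have "27 dvd (26 * x0 + 3 * y1 + 2 * a0 + 24 * a1 + 9 * (s * ((a2 - y2) * (x0 * a1 - y1 * a0))))
      - (26 * y0 + 3 * y1 + 2 * a0 + 24 * a1 + 9 * (s * ((a2 - y2) * (y0 * a1 - y1 * a0))))"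
    using eq[THEN conjunct1, unfolded 1 2] by (simp only: mod_eq_dvd_iff)
  also have "(26 * x0 + 3 * y1 + 2 * a0 + 24 * a1 + 9 * (s * ((a2 - y2) * (x0 * a1 - y1 * a0))))
      - (26 * y0 + 3 * y1 + 2 * a0 + 24 * a1 + 9 * (s * ((a2 - y2) * (y0 * a1 - y1 * a0))))
      = (26 + 9 * R) * (x0 - y0)"
    by (simp add: R_def algebra_simps)
  finally have d: "27 dvd (26 + 9 * R) * (x0 - y0)" .
  have "\<not> 3 dvd 26 + 9 * R"
    by presburger
  then have "x0 = y0"
    by (intro residue_eqI[OF d]) (use bd in \<open>simp_all add: coprime_three_power\<close>)
  then show ?thesis
    by (simp add: x y 1 2)
qed

lemma quasigroup_nabla: "quasigroup carrier_C (nabla s)"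
proof (rule finite_quasigroupI[OF finite_carrier_C])
  have "reduce (0, 0, 0) \<in> carrier_C"
    by simp
  then show "carrier_C \<noteq> {}"
    by blast
  show "nabla s a b \<in> carrier_C" for a b
    by (rule nabla_in_carrier_C)
  show "x = y" if "a \<in> carrier_C" "x \<in> carrier_C" "y \<in> carrier_C" "nabla s a x = nabla s a y" for a x y
    using that by (rule nabla_left_cancel)
  show "x = y" if "a \<in> carrier_C" "x \<in> carrier_C" "y \<in> carrier_C" "nabla s x a = nabla s y a" for a x y
    using that by (rule nabla_right_cancel)
qed

lemma nabla_left_distrib: "nabla s x (nabla s a b) = nabla s (nabla s x a) (nabla s x b)"
proof -
  obtain x0 x1 x2 where x: "x = (x0, x1, x2)"
    by (cases x)
  obtain a0 a1 a2 where a: "a = (a0, a1, a2)"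
    by (cases a)
  obtain b0 b1 b2 where b: "b = (b0, b1, b2)"
    by (cases b)
  have cong_neg: "[26 * u0 + 3 * u1 + 2 * v0 + 24 * v1 + 9 * w = - u0 - v0] (mod 3)"
    "[8 * u1 + 3 * u2 + 2 * v1 + 6 * v2 = - u1 - v1] (mod 3)"
    "[2 * u2 + 2 * v2 = - u2 - v2] (mod 3)" for u0 u1 u2 v0 v1 v2 w :: int
    unfolding cong_iff_dvd_diff by presburger+
  have "reduce (nabla_raw s x (nabla_raw s a b)) = reduce (nabla_raw s (nabla_raw s x a) (nabla_raw s x b))"
    unfolding x a b nabla_raw.simps reduce_eq_iff
  proof (rule conjI[OF cong_lift conjI])
    show "[ddet (x0, x1, x2)
        (26 * a0 + 3 * a1 + 2 * b0 + 24 * b1 + 9 * (s * ddet (a0, a1, a2) (b0, b1, b2)),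
         8 * a1 + 3 * a2 + 2 * b1 + 6 * b2, 2 * a2 + 2 * b2)
       = ddet (x0, x1, x2) (- a0 - b0, - a1 - b1, - a2 - b2)] (mod 3)"
      by (intro ddet_cong cong_refl cong_neg)
    show "[ddet (26 * x0 + 3 * x1 + 2 * a0 + 24 * a1 + 9 * (s * ddet (x0, x1, x2) (a0, a1, a2)),
         8 * x1 + 3 * x2 + 2 * a1 + 6 * a2, 2 * x2 + 2 * a2)
        (26 * x0 + 3 * x1 + 2 * b0 + 24 * b1 + 9 * (s * ddet (x0, x1, x2) (b0, b1, b2)),
         8 * x1 + 3 * x2 + 2 * b1 + 6 * b2, 2 * x2 + 2 * b2)
       = ddet (- x0 - a0, - x1 - a1, - x2 - a2) (- x0 - b0, - x1 - b1, - x2 - b2)] (mod 3)"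
      by (intro ddet_cong cong_neg)
  \<comment> \<open>After the reduction of the cubic arguments modulo 3, the witnesses are the
    quotients of the expanded differences by 27, 9 and 3.\<close>
  qed (unfold cong_iff_dvd_diff ddet.simps,
      rule dvdI[where k = "- a0 * a2 * b1 * s + 8 * a0 * a2 * s * x1 + a0 * b1 * b2 * s - 9 * a0 * s * x1 * x2 - 16 * a1 + a1 * a2 * b0 * s - 8 * a1 * a2 * s * x0 - a1 * b0 * b2 * s + 9 * a1 * s * x0 * x2 + 2 * a2 - b0 * s * x1 * x2 + b1 * s * x0 * x2 - 26 * x0 - 11 * x1 - 3 * x2"],
      simp add: algebra_simps,
      rule dvdI[where k = "- 4 * a2 - 8 * x1 - 5 * x2"], simp add: algebra_simps,
      rule dvdI[where k = "- 2 * x2"], simp add: algebra_simps)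
  then show ?thesis
    unfolding nabla_eq_reduce using nabla_raw_cong[of x x "reduce (nabla_raw s a b)" "nabla_raw s a b" s]
      nabla_raw_cong[of "reduce (nabla_raw s x a)" "nabla_raw s x a" "reduce (nabla_raw s x b)" "nabla_raw s x b" s] by simp
qed

lemma nabla_right_distrib: "nabla s (nabla s a b) x = nabla s (nabla s a x) (nabla s b x)"
proof -
  obtain x0 x1 x2 where x: "x = (x0, x1, x2)"
    by (cases x)
  obtain a0 a1 a2 where a: "a = (a0, a1, a2)"
    by (cases a)
  obtain b0 b1 b2 where b: "b = (b0, b1, b2)"
    by (cases b)
  have cong_neg: "[26 * u0 + 3 * u1 + 2 * v0 + 24 * v1 + 9 * w = - u0 - v0] (mod 3)"
    "[8 * u1 + 3 * u2 + 2 * v1 + 6 * v2 = - u1 - v1] (mod 3)"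
    "[2 * u2 + 2 * v2 = - u2 - v2] (mod 3)" for u0 u1 u2 v0 v1 v2 w :: int
    unfolding cong_iff_dvd_diff by presburger+
  have "reduce (nabla_raw s (nabla_raw s a b) x) = reduce (nabla_raw s (nabla_raw s a x) (nabla_raw s b x))"
    unfolding x a b nabla_raw.simps reduce_eq_iff
  proof (rule conjI[OF cong_lift conjI])
    show "[ddet 
        (26 * a0 + 3 * a1 + 2 * b0 + 24 * b1 + 9 * (s * ddet (a0, a1, a2) (b0, b1, b2)),
         8 * a1 + 3 * a2 + 2 * b1 + 6 * b2, 2 * a2 + 2 * b2) (x0, x1, x2)
       = ddet (- a0 - b0, - a1 - b1, - a2 - b2) (x0, x1, x2)] (mod 3)"
      by (intro ddet_cong cong_refl cong_neg)
    show "[ddet (26 * a0 + 3 * a1 + 2 * x0 + 24 * x1 + 9 * (s * ddet (a0, a1, a2) (x0, x1, x2)),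
         8 * a1 + 3 * a2 + 2 * x1 + 6 * x2, 2 * a2 + 2 * x2)
        (26 * b0 + 3 * b1 + 2 * x0 + 24 * x1 + 9 * (s * ddet (b0, b1, b2) (x0, x1, x2)),
         8 * b1 + 3 * b2 + 2 * x1 + 6 * x2, 2 * b2 + 2 * x2)
       = ddet (- a0 - x0, - a1 - x1, - a2 - x2) (- b0 - x0, - b1 - x1, - b2 - x2)] (mod 3)"
      by (intro ddet_cong cong_neg)
  qed (unfold cong_iff_dvd_diff ddet.simps,
      rule dvdI[where k = "- 9 * a0 * a2 * b1 * s + 8 * a0 * a2 * s * x1 + 9 * a0 * b1 * b2 * s - 9 * a0 * s * x1 * x2 + 9 * a1 * a2 * b0 * s - 8 * a1 * a2 * s * x0 - 9 * a1 * b0 * b2 * s + 9 * a1 * s * x0 * x2 - b0 * s * x1 * x2 + 16 * b1 + b1 * s * x0 * x2 - 2 * b2 - 2 * x0 - 26 * x1 - 6 * x2"],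
      simp add: algebra_simps,
      rule dvdI[where k = "4 * b2 - 2 * x1 - 8 * x2"], simp add: algebra_simps,
      rule dvdI[where k = "- 2 * x2"], simp add: algebra_simps)
  then show ?thesis
    unfolding nabla_eq_reduce using nabla_raw_cong[of "reduce (nabla_raw s a b)" "nabla_raw s a b" x x s]
      nabla_raw_cong[of "reduce (nabla_raw s a x)" "nabla_raw s a x" "reduce (nabla_raw s b x)" "nabla_raw s b x" s] by simp
qed

lemma distributive_nabla: "distributive carrier_C (nabla s)"
  unfolding distributive_def by (auto intro: nabla_left_distrib nabla_right_distrib)

lemma not_medial_nabla:
  assumes "s = 1 \<or> s = -1"
  shows "\<not> medial carrier_C (nabla s)"
proof
  assume "medial carrier_C (nabla s)"
  moreover have "(0, 0, 0) \<in> carrier_C" "(1, 0, 0) \<in> carrier_C" "(0, 1, 0) \<in> carrier_C" "(0, 0, 1) \<in> carrier_C"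
    by (simp_all add: carrier_C_def)
  \<comment> \<open>Zero and the three basis vectors, whose associator is nonzero: the two sides
    differ by 9 s in the first coordinate.\<close>
  ultimately have "nabla s (nabla s (0, 0, 0) (0, 1, 0)) (nabla s (0, 0, 1) (1, 0, 0))
      = nabla s (nabla s (0, 0, 0) (0, 0, 1)) (nabla s (0, 1, 0) (1, 0, 0))"
    unfolding medial_def by blast
  then show False
    using assms by auto
qed

section \<open>Normality, reduced to subquasigroups through one point\<close>

lemma normal_congruenceI:
  assumes "equiv Q r"
    and "\<And>a b c d. a \<in> Q \<Longrightarrow> b \<in> Q \<Longrightarrow> c \<in> Q \<Longrightarrow> d \<in> Q \<Longrightarrow>
      (a, b) \<in> r \<Longrightarrow> (c, d) \<in> r \<Longrightarrow> (f a c, f b d) \<in> r"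
    and "\<And>a b c d. a \<in> Q \<Longrightarrow> b \<in> Q \<Longrightarrow> c \<in> Q \<Longrightarrow> d \<in> Q \<Longrightarrow>
      (a, b) \<in> r \<Longrightarrow> (f a c, f b d) \<in> r \<Longrightarrow> (c, d) \<in> r"
    and "\<And>a b c d. a \<in> Q \<Longrightarrow> b \<in> Q \<Longrightarrow> c \<in> Q \<Longrightarrow> d \<in> Q \<Longrightarrow>
      (c, d) \<in> r \<Longrightarrow> (f a c, f b d) \<in> r \<Longrightarrow> (a, b) \<in> r"
  shows "normal_congruence Q f r"
  unfolding normal_congruence_def
  by (intro conjI ballI impI; (elim conjE)?; (rule assms; assumption))

lemma normal_congruence_vimage:
  assumes qg: "quasigroup Q f" and bij: "bij_betw \<psi> Q Q"
    and hom: "\<And>x y. x \<in> Q \<Longrightarrow> y \<in> Q \<Longrightarrow> \<psi> (f x y) = f (\<psi> x) (\<psi> y)"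
    and r: "normal_congruence Q f r"
  shows "normal_congruence Q f {(x, y). x \<in> Q \<and> y \<in> Q \<and> (\<psi> x, \<psi> y) \<in> r}"
proof -
  have \<psi>: "\<psi> x \<in> Q" if "x \<in> Q" for x
    using bij that by (rule bij_betw_apply)
  have eqv: "equiv Q r"
    using r by (simp add: normal_congruence_def)
  have cong: "((a, b) \<in> r \<and> (c, d) \<in> r \<longrightarrow> (f a c, f b d) \<in> r) \<and>
      ((a, b) \<in> r \<and> (f a c, f b d) \<in> r \<longrightarrow> (c, d) \<in> r) \<and>
      ((c, d) \<in> r \<and> (f a c, f b d) \<in> r \<longrightarrow> (a, b) \<in> r)"
    if "a \<in> Q" "b \<in> Q" "c \<in> Q" "d \<in> Q" for a b c d
    using r that unfolding normal_congruence_def by blast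
  have "equiv Q {(x, y). x \<in> Q \<and> y \<in> Q \<and> (\<psi> x, \<psi> y) \<in> r}"
  proof (rule equivI)
    show "refl_on Q {(x, y). x \<in> Q \<and> y \<in> Q \<and> (\<psi> x, \<psi> y) \<in> r}"
      using eqv \<psi> by (auto simp: equiv_def refl_on_def)
    show "sym {(x, y). x \<in> Q \<and> y \<in> Q \<and> (\<psi> x, \<psi> y) \<in> r}"
      using eqv by (auto simp: equiv_def sym_def)
    show "trans {(x, y). x \<in> Q \<and> y \<in> Q \<and> (\<psi> x, \<psi> y) \<in> r}"
      using eqv unfolding equiv_def trans_def by blast
  qed auto
  then show ?thesis
  proof (rule normal_congruenceI)
    fix a b c d
    assume Q: "a \<in> Q" "b \<in> Q" "c \<in> Q" "d \<in> Q"
    let ?r = "{(x, y). x \<in> Q \<and> y \<in> Q \<and> (\<psi> x, \<psi> y) \<in> r}"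
    have "f a c \<in> Q" "f b d \<in> Q"
      using Q by (simp_all add: quasigroup_closed[OF qg])
    then have iff: "(a, b) \<in> ?r \<longleftrightarrow> (\<psi> a, \<psi> b) \<in> r" "(c, d) \<in> ?r \<longleftrightarrow> (\<psi> c, \<psi> d) \<in> r"
      "(f a c, f b d) \<in> ?r \<longleftrightarrow> (f (\<psi> a) (\<psi> c), f (\<psi> b) (\<psi> d)) \<in> r"
      using Q by (simp_all add: hom)
    note cong' = cong[OF \<psi>[OF Q(1)] \<psi>[OF Q(2)] \<psi>[OF Q(3)] \<psi>[OF Q(4)]]
    show "(f a c, f b d) \<in> ?r" if "(a, b) \<in> ?r" "(c, d) \<in> ?r"
      using cong' that unfolding iff by blast
    show "(c, d) \<in> ?r" if "(a, b) \<in> ?r" "(f a c, f b d) \<in> ?r"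
      using cong' that unfolding iff by blast
    show "(a, b) \<in> ?r" if "(c, d) \<in> ?r" "(f a c, f b d) \<in> ?r"
      using cong' that unfolding iff by blast
  qed
qed

lemma bij_betw_inv_hom:
  assumes bij: "bij_betw \<phi> Q P" and closed: "\<And>x y. x \<in> Q \<Longrightarrow> y \<in> Q \<Longrightarrow> f x y \<in> Q"
    and hom: "\<And>x y. x \<in> Q \<Longrightarrow> y \<in> Q \<Longrightarrow> \<phi> (f x y) = g (\<phi> x) (\<phi> y)"
    and x: "x \<in> P" and y: "y \<in> P"
  shows "inv_into Q \<phi> (g x y) = f (inv_into Q \<phi> x) (inv_into Q \<phi> y)"
proof -
  let ?\<psi> = "inv_into Q \<phi>"
  have \<psi>: "?\<psi> x \<in> Q" "?\<psi> y \<in> Q"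
    using bij_betw_inv_into[OF bij] x y by (simp_all add: bij_betw_apply)
  have "\<phi> (f (?\<psi> x) (?\<psi> y)) = g x y"
    using hom[OF \<psi>] bij_betw_inv_into_right[OF bij x] bij_betw_inv_into_right[OF bij y] by simp
  then show ?thesis
    using bij_betw_inv_into_left[OF bij closed[OF \<psi>]] by simp
qed

text \<open>Left translations are automorphisms, and every element is a left translate of \<open>e\<close>.\<close>

lemma hamiltonian_if_normal_at:
  assumes fin: "finite Q" and qg: "quasigroup Q f" and distr: "distributive Q f" and e: "e \<in> Q"
    and normal: "\<And>H. subquasigroup H Q f \<Longrightarrow> e \<in> H \<Longrightarrow> normal_subquasigroup H Q f"
  shows "hamiltonian Q f"
  unfolding hamiltonian_def
proof (intro allI impI)
  fix H
  assume H: "subquasigroup H Q f"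
  have HQ: "H \<subseteq> Q" and qgH: "quasigroup H f"
    using H by (simp_all add: subquasigroup_def)
  obtain h0 where h0: "h0 \<in> H"
    using qgH by (auto simp: quasigroup_def)
  obtain a where a: "a \<in> Q" "f a e = h0"
    using qg e h0 HQ unfolding quasigroup_def by (metis subsetD)
  have bij: "bij_betw (f a) Q Q"
    using quasigroup_bij_left[OF qg a(1)] .
  have hom: "f a (f x y) = f (f a x) (f a y)" if "x \<in> Q" "y \<in> Q" for x y
    using distr a(1) that by (simp add: distributive_def)
  define \<psi> where "\<psi> = inv_into Q (f a)"
  have \<psi>: "bij_betw \<psi> Q Q"
    unfolding \<psi>_def by (rule bij_betw_inv_into[OF bij])
  have \<psi>_hom: "\<psi> (f x y) = f (\<psi> x) (\<psi> y)" if "x \<in> Q" "y \<in> Q" for x y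
    unfolding \<psi>_def using that
    by (intro bij_betw_inv_hom[OF bij, where f = f and g = f]) (simp_all add: quasigroup_closed[OF qg] hom)
  have f\<psi>: "f a (\<psi> x) = x" and \<psi>Q: "\<psi> x \<in> Q" if "x \<in> Q" for x
    using that bij_betw_inv_into_right[OF bij] bij_betw_apply[OF \<psi>] by (simp_all add: \<psi>_def)
  define H' where "H' = {x \<in> Q. f a x \<in> H}"
  have "quasigroup H' f"
  proof (rule finite_quasigroupI)
    show "finite H'"
      using fin by (simp add: H'_def)
    show "H' \<noteq> {}"
      using e a h0 by (auto simp: H'_def)
    show "f x y \<in> H'" if "x \<in> H'" "y \<in> H'" for x y
      using that quasigroup_closed[OF qg] quasigroup_closed[OF qgH] by (simp add: H'_def hom)
    show "x = y" if "b \<in> H'" "x \<in> H'" "y \<in> H'" "f b x = f b y" for b x y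
      using that quasigroup_left_cancel[OF qg, of b x y] by (simp add: H'_def)
    show "x = y" if "b \<in> H'" "x \<in> H'" "y \<in> H'" "f x b = f y b" for b x y
      using that quasigroup_right_cancel[OF qg, of b x y] by (simp add: H'_def)
  qed
  then have "normal_subquasigroup H' Q f"
    using e a h0 by (intro normal) (auto simp: H'_def subquasigroup_def)
  then obtain r where r: "normal_congruence Q f r" and H'r: "H' \<in> Q // r"
    by (auto simp: normal_subquasigroup_def)
  have eqv: "equiv Q r"
    using r by (simp add: normal_congruence_def)
  have "e \<in> H'"
    using e a h0 by (simp add: H'_def)
  then have H'_eq: "H' = r `` {e}"
    using H'r eqv by (metis Image_singleton_iff equiv_class_eq_iff quotientE)
  let ?r = "{(x, y). x \<in> Q \<and> y \<in> Q \<and> (\<psi> x, \<psi> y) \<in> r}"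
  have \<psi>h0: "\<psi> h0 = e"
    using bij_betw_inv_into_left[OF bij e] a(2) by (simp add: \<psi>_def)
  have "x \<in> H \<longleftrightarrow> (h0, x) \<in> ?r" for x
  proof (cases "x \<in> Q")
    case True
    have "x \<in> H \<longleftrightarrow> \<psi> x \<in> H'"
      using True f\<psi> \<psi>Q by (simp add: H'_def)
    also have "\<dots> \<longleftrightarrow> (e, \<psi> x) \<in> r"
      by (simp add: H'_eq)
    finally show ?thesis
      using True h0 HQ by (auto simp: \<psi>h0)
  qed (use HQ in auto)
  then have "H = ?r `` {h0}"
    by auto
  then have "H \<in> Q // ?r"
    by (rule ssubst) (use h0 HQ in \<open>blast intro: quotientI\<close>)
  then show "normal_subquasigroup H Q f"
    unfolding normal_subquasigroup_def
    using H normal_congruence_vimage[OF qg \<psi> \<psi>_hom r] by blast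
qed

text \<open>As \<zeta>^3 = 0, the inverse of \<zeta> - 1 is -(1 + \<zeta> + \<zeta>^2).\<close>

fun F_inv :: "int \<times> int \<times> int \<Rightarrow> int \<times> int \<times> int" where
  "F_inv (i, j, k) = (- i - 3 * j - 9 * k, - j - 3 * k, - k)"

text \<open>Back substitution in 2 - \<zeta>, with 14, 5 and 2 as inverses of 2 modulo 27, 9 and 3;
  thus 210 = 14 * 3 * 5 and 1260 = 14 * 3 * 30.\<close>

fun G_inv :: "int \<times> int \<times> int \<Rightarrow> int \<times> int \<times> int" where
  "G_inv (i, j, k) = (14 * i + 210 * j + 1260 * k, 5 * j + 30 * k, 2 * k)"

fun loop_raw :: "int \<Rightarrow> int \<times> int \<times> int \<Rightarrow> int \<times> int \<times> int \<Rightarrow> int \<times> int \<times> int" where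
  "loop_raw s (i, j, k) (i', j', k') = (i + i' + 9 * ((- s) * ddet (i, j, k) (i', j', k')), j + j', k + k')"

lemma nabla_zero_right: "nabla s (i, j, k) (0, 0, 0) = reduce (3 * j - i, 3 * k - j, - k)"
  unfolding nabla_eq_reduce nabla_raw.simps reduce_eq_iff cong_iff_dvd_diff ddet.simps
  by (rule conjI[OF dvdI[where k = i] conjI[OF dvdI[where k = j] dvdI[where k = k]]]) simp_all

lemma nabla_zero_left: "nabla s (0, 0, 0) (i, j, k) = reduce (2 * i - 3 * j, 2 * j - 3 * k, 2 * k)"
  unfolding nabla_eq_reduce nabla_raw.simps reduce_eq_iff cong_iff_dvd_diff ddet.simps
  by (rule conjI[OF dvdI[where k = j] conjI[OF dvdI[where k = k] dvdI[where k = 0]]]) simp_all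

lemma nabla_F_inv: "nabla s (F_inv v) (0, 0, 0) = reduce v"
  by (cases v) (simp add: nabla_zero_right del: nabla.simps)

lemma nabla_G_inv: "nabla s (0, 0, 0) (G_inv v) = reduce v"
proof (cases v)
  case (fields i j k)
  have "[2 * (14 * i + 210 * j + 1260 * k) - 3 * (5 * j + 30 * k) = i] (mod 27)"
    unfolding cong_iff_dvd_diff by (rule dvdI[where k = "i + 15 * j + 90 * k"]) simp
  moreover have "[2 * (5 * j + 30 * k) - 3 * (2 * k) = j] (mod 9)"
    unfolding cong_iff_dvd_diff by (rule dvdI[where k = "j + 6 * k"]) simp
  moreover have "[2 * (2 * k) = k] (mod 3)"
    unfolding cong_iff_dvd_diff by (rule dvdI[where k = k]) simp
  ultimately show ?thesis
    unfolding fields G_inv.simps nabla_zero_left reduce_eq_iff by blast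
qed

text \<open>Belousov's loop with neutral element zero, in coordinates. Modulo 3 both inverses act as
  -1, which accounts for the sign of the cocycle.\<close>

lemma nabla_F_inv_G_inv: "nabla s (F_inv v) (G_inv w) = reduce (loop_raw s v w)"
proof -
  obtain i j k where v: "v = (i, j, k)"
    by (cases v)
  obtain i' j' k' where w: "w = (i', j', k')"
    by (cases w)
  let ?x = "(- i - 3 * j - 9 * k, - j - 3 * k, - k)"
  let ?y = "(14 * i' + 210 * j' + 1260 * k', 5 * j' + 30 * k', 2 * k')"
  have "[ddet ?x ?y = ddet (- i, - j, - k) (- i', - j', - k')] (mod 3)"
    by (rule ddet_cong; unfold cong_iff_dvd_diff)
      (rule dvdI[where k = "- j - 3 * k"], simp,
       rule dvdI[where k = "- k"], simp,
       rule dvdI[where k = "0"], simp,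
       rule dvdI[where k = "5 * i' + 70 * j' + 420 * k'"], simp,
       rule dvdI[where k = "2 * j' + 10 * k'"], simp,
       rule dvdI[where k = "k'"], simp)
  also have "ddet (- i, - j, - k) (- i', - j', - k') = - ddet (i, j, k) (i', j', k')"
    by (simp add: algebra_simps)
  finally have c: "[ddet ?x ?y = - ddet (i, j, k) (i', j', k')] (mod 3)" .
  have d: "[9 * (s * ddet ?x ?y) = 9 * ((- s) * ddet (i, j, k) (i', j', k'))] (mod 27)"
    using cong_scale[OF cong_scalar_left[OF c], of 27 9 s] by (simp del: ddet.simps)
  have l: "[26 * (- i - 3 * j - 9 * k) + 3 * (- j - 3 * k) + 2 * (14 * i' + 210 * j' + 1260 * k')
      + 24 * (5 * j' + 30 * k') = i + i'] (mod 27)"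
    unfolding cong_iff_dvd_diff
    by (rule dvdI[where k = "- i - 3 * j - 9 * k + i' + 20 * j' + 120 * k'"]) simp
  have "[8 * (- j - 3 * k) + 3 * (- k) + 2 * (5 * j' + 30 * k') + 6 * (2 * k') = j + j'] (mod 9)"
    unfolding cong_iff_dvd_diff by (rule dvdI[where k = "- j - 3 * k + j' + 8 * k'"]) simp
  moreover have "[2 * (- k) + 2 * (2 * k') = k + k'] (mod 3)"
    unfolding cong_iff_dvd_diff by (rule dvdI[where k = "- k + k'"]) simp
  ultimately show ?thesis
    unfolding v w nabla_eq_reduce F_inv.simps G_inv.simps loop_raw.simps nabla_raw.simps reduce_eq_iff
    using cong_add[OF l d] by blast
qed

section \<open>Subquasigroups through zero are subgroups of the abelian group\<close>

context
  fixes s :: int and H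
  assumes H: "subquasigroup H carrier_C (nabla s)" and zero: "(0, 0, 0) \<in> H"
begin

text \<open>Arbitrary integers as coordinates, so that sums and multiples need no reduction.\<close>

definition mem :: "int \<Rightarrow> int \<Rightarrow> int \<Rightarrow> bool" where
  "mem i j k \<longleftrightarrow> reduce (i, j, k) \<in> H"

lemma mem_cong:
  "[i = i'] (mod 27) \<Longrightarrow> [j = j'] (mod 9) \<Longrightarrow> [k = k'] (mod 3) \<Longrightarrow> mem i j k \<longleftrightarrow> mem i' j' k'"
  unfolding mem_def by (metis reduce_eq_iff)

lemma H_subset: "x \<in> H \<Longrightarrow> x \<in> carrier_C"
  using H by (auto simp: subquasigroup_def)

lemma quasigroup_H: "quasigroup H (nabla s)"
  using H by (simp add: subquasigroup_def)

lemma mem_F: "mem i j k \<longleftrightarrow> mem (3 * j - i) (3 * k - j) (- k)"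
proof -
  have C0: "(0, 0, 0) \<in> carrier_C"
    using H_subset zero by blast
  have eq: "nabla s (reduce (i, j, k)) (0, 0, 0) = reduce (3 * j - i, 3 * k - j, - k)"
    using nabla_reduce[of s "(i, j, k)" "(0, 0, 0)"] C0 by (simp only: reduce_id nabla_zero_right)
  show ?thesis
  proof
    assume "mem i j k"
    then show "mem (3 * j - i) (3 * k - j) (- k)"
      unfolding mem_def eq[symmetric] using zero by (rule quasigroup_closed[OF quasigroup_H])
  next
    assume "mem (3 * j - i) (3 * k - j) (- k)"
    then obtain y where y: "y \<in> H" "nabla s y (0, 0, 0) = nabla s (reduce (i, j, k)) (0, 0, 0)"
      unfolding mem_def eq[symmetric] using zero quasigroup_H unfolding quasigroup_def by metis
    then have "y = reduce (i, j, k)"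
      using nabla_right_cancel[of "(0, 0, 0)" y "reduce (i, j, k)"] H_subset zero by auto
    then show "mem i j k"
      using y by (simp add: mem_def)
  qed
qed

lemma mem_G: "mem i j k \<longleftrightarrow> mem (2 * i - 3 * j) (2 * j - 3 * k) (2 * k)"
proof -
  have C0: "(0, 0, 0) \<in> carrier_C"
    using H_subset zero by blast
  have eq: "nabla s (0, 0, 0) (reduce (i, j, k)) = reduce (2 * i - 3 * j, 2 * j - 3 * k, 2 * k)"
    using nabla_reduce[of s "(0, 0, 0)" "(i, j, k)"] C0 by (simp only: reduce_id nabla_zero_left)
  show ?thesis
  proof
    assume "mem i j k"
    with zero show "mem (2 * i - 3 * j) (2 * j - 3 * k) (2 * k)"
      unfolding mem_def eq[symmetric] by (rule quasigroup_closed[OF quasigroup_H])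
  next
    assume "mem (2 * i - 3 * j) (2 * j - 3 * k) (2 * k)"
    then obtain y where y: "y \<in> H" "nabla s (0, 0, 0) y = nabla s (0, 0, 0) (reduce (i, j, k))"
      unfolding mem_def eq[symmetric] using zero quasigroup_H unfolding quasigroup_def by metis
    then have "y = reduce (i, j, k)"
      using nabla_left_cancel[of "(0, 0, 0)" y "reduce (i, j, k)"] H_subset zero by auto
    then show "mem i j k"
      using y by (simp add: mem_def)
  qed
qed

text \<open>H contains the quotients of its elements by zero on either side, hence is closed under
  Belousov's addition.\<close>

lemma mem_add_ddet:
  assumes "mem i j k" "mem i' j' k'"
  shows "mem (i + i' - 9 * (s * ddet (i, j, k) (i', j', k'))) (j + j') (k + k')"
proof -
  have div: "\<exists>x\<in>H. nabla s x (0, 0, 0) = v" "\<exists>y\<in>H. nabla s (0, 0, 0) y = v" if "v \<in> H" for v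
    using zero quasigroup_H that unfolding quasigroup_def by blast+
  obtain x where x: "x \<in> H" "nabla s x (0, 0, 0) = reduce (i, j, k)"
    using div(1) assms(1) unfolding mem_def by blast
  obtain y where y: "y \<in> H" "nabla s (0, 0, 0) y = reduce (i', j', k')"
    using div(2) assms(2) unfolding mem_def by blast
  have C0: "(0, 0, 0) \<in> carrier_C"
    using H_subset zero by blast
  have "nabla s x (0, 0, 0) = nabla s (reduce (F_inv (i, j, k))) (0, 0, 0)"
    using nabla_reduce[of s "F_inv (i, j, k)" "(0, 0, 0)"] x(2) C0 by (simp only: reduce_id nabla_F_inv)
  then have "x = reduce (F_inv (i, j, k))"
    using C0 H_subset[OF x(1)] reduce_in_carrier_C by (rule nabla_right_cancel[rotated 3])
  moreover have "nabla s (0, 0, 0) y = nabla s (0, 0, 0) (reduce (G_inv (i', j', k')))"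
    using nabla_reduce[of s "(0, 0, 0)" "G_inv (i', j', k')"] y(2) C0 by (simp only: reduce_id nabla_G_inv)
  then have "y = reduce (G_inv (i', j', k'))"
    using C0 H_subset[OF y(1)] reduce_in_carrier_C by (rule nabla_left_cancel[rotated 3])
  ultimately have "nabla s (reduce (F_inv (i, j, k))) (reduce (G_inv (i', j', k'))) \<in> H"
    using quasigroup_closed[OF quasigroup_H x(1) y(1)] by simp
  then show ?thesis
    unfolding nabla_reduce nabla_F_inv_G_inv by (simp add: mem_def)
qed

lemma mem_zero: "mem 0 0 0"
  using zero by (simp add: mem_def reduce_def)

lemma mem_mult:
  assumes "mem i j k"
  shows "mem (n * i) (n * j) (n * k)"
proof -
  have nat: "mem (int m * i) (int m * j) (int m * k)" for m
  proof (induction m)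
    case (Suc m)
    have "ddet (int m * i, int m * j, int m * k) (i, j, k) = 0"
      by (simp add: algebra_simps)
    then show ?case
      using mem_add_ddet[OF Suc assms] by (simp add: algebra_simps)
  qed (simp add: mem_zero)
  have "mem (n mod 27 * i) (n mod 27 * j) (n mod 27 * k)"
    using nat[of "nat (n mod 27)"] by simp
  moreover have "[n mod 27 = n] (mod 27)" "[n mod 27 = n] (mod 9)" "[n mod 27 = n] (mod 3)"
    by (simp_all add: cong_def mod_mod_cancel)
  then have "mem (n mod 27 * i) (n mod 27 * j) (n mod 27 * k) \<longleftrightarrow> mem (n * i) (n * j) (n * k)"
    by (intro mem_cong cong_scalar_right)
  ultimately show ?thesis
    by simp
qed

lemma mem_zeta:
  assumes "mem i j k"
  shows "mem (3 * j) (3 * k) 0"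
proof -
  have "mem (3 * j - i) (3 * k - j) (- k)"
    using assms by (simp flip: mem_F)
  from mem_add_ddet[OF assms this]
  have "mem (3 * j - 27 * (s * (2 * k * (j * j - i * k)))) (3 * k) 0"
    by (simp add: algebra_simps)
  then show ?thesis
    by (subst (asm) mem_cong[of _ "3 * j" _ "3 * k" _ 0]) (simp_all add: cong_iff_dvd_diff)
qed

text \<open>The cocycle takes its values in the elements (9 c, 0, 0); this predicate tells which of
  them belong to H and depends only on c modulo 3.\<close>

definition socle :: "int \<Rightarrow> bool" where
  "socle c \<longleftrightarrow> mem (9 * c) 0 0"

text \<open>Applying 9, 3 \<zeta> and \<zeta>^2 to (i, j, k) yields 9 i, 9 j and 9 k in the first
  coordinate and zero elsewhere.\<close>

lemma socle_coords:
  assumes "mem i j k"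
  shows "socle i" "socle j" "socle k"
proof -
  have *: "socle i" if "mem i j k" for i j k
    unfolding socle_def using mem_mult[OF that, of 9]
    by (subst (asm) mem_cong[of _ "9 * i" _ 0 _ 0]) (simp_all add: cong_iff_dvd_diff)
  have **: "socle j" if "mem i j k" for i j k
    unfolding socle_def using mem_mult[OF mem_zeta[OF that], of 3]
    by (subst (asm) mem_cong[of _ "9 * j" _ 0 _ 0]) (simp_all add: cong_iff_dvd_diff)
  show "socle i" "socle j"
    using * ** assms by blast+
  show "socle k"
    unfolding socle_def using mem_zeta[OF mem_zeta[OF assms]] by simp
qed

lemma socle_add: "socle c \<Longrightarrow> socle d \<Longrightarrow> socle (c + d)"
  unfolding socle_def using mem_add_ddet[of "9 * c" 0 0 "9 * d" 0 0] by (simp add: algebra_simps)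

lemma socle_mult: "socle c \<Longrightarrow> socle (n * c)"
  unfolding socle_def using mem_mult[of "9 * c" 0 0 n] by (simp add: algebra_simps)

lemma socle_cong: "[c = d] (mod 3) \<Longrightarrow> socle c \<longleftrightarrow> socle d"
  unfolding socle_def by (rule mem_cong) (auto intro: cong_scale)

lemma mem_add_socle:
  assumes "mem i j k" "socle c"
  shows "mem (i + 9 * c) j k"
proof -
  have "mem (i + 9 * c - 9 * (s * ddet (i, j, k) (9 * c, 0, 0))) j k"
    using mem_add_ddet[OF assms(1) assms(2)[unfolded socle_def]] by simp
  then show ?thesis
    by (subst (asm) mem_cong[of _ "i + 9 * c" _ j _ k])
      (simp_all add: cong_iff_dvd_diff)
qed

text \<open>The decisive point for hamiltonicity: the cocycle is a combination of coordinates of one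
  summand, so by \<open>socle_coords\<close> its value already lies in H and can be removed. Hence H
  is closed under the addition of the abelian group.\<close>

lemma mem_add:
  assumes "mem i j k" "mem i' j' k'"
  shows "mem (i + i') (j + j') (k + k')"
proof -
  have "socle (s * ((k' - k) * j') * i + s * (- ((k' - k) * i')) * j)"
    using socle_coords[OF assms(1)] by (intro socle_add socle_mult)
  then have "socle (s * ddet (i, j, k) (i', j', k'))"
    by (simp add: algebra_simps)
  from mem_add_socle[OF mem_add_ddet[OF assms] this] show ?thesis
    by simp
qed

lemma mem_diff: "mem i j k \<Longrightarrow> mem i' j' k' \<Longrightarrow> mem (i - i') (j - j') (k - k')"
  using mem_add[of i j k "- i'" "- j'" "- k'"] mem_mult[of i' j' k' "-1"] by simp

text \<open>Changing the arguments one after the other makes the difference a linear combination of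
  the x and y coordinates.\<close>

lemma socle_ddet_diff:
  assumes x: "socle x0" "socle x1" "socle x2" and y: "socle y0" "socle y1" "socle y2"
  shows "socle (ddet (b0 + x0, b1 + x1, b2 + x2) (d0 + y0, d1 + y1, d2 + y2) - ddet (b0, b1, b2) (d0, d1, d2))"
proof -
  define W where "W = (b0 + x0) * (d1 + y1) - (b1 + x1) * (d0 + y0)"
  have "socle ((d2 - b2) * (d1 + y1) * x0 + (- ((d2 - b2) * (d0 + y0))) * x1 + (- W) * x2
      + (- ((d2 - b2) * b1)) * y0 + (d2 - b2) * b0 * y1 + W * y2)"
    using x y by (intro socle_add socle_mult)
  also have "(d2 - b2) * (d1 + y1) * x0 + (- ((d2 - b2) * (d0 + y0))) * x1 + (- W) * x2
      + (- ((d2 - b2) * b1)) * y0 + (d2 - b2) * b0 * y1 + W * y2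
      = ddet (b0 + x0, b1 + x1, b2 + x2) (d0 + y0, d1 + y1, d2 + y2) - ddet (b0, b1, b2) (d0, d1, d2)"
    by (simp add: W_def algebra_simps)
  finally show ?thesis .
qed

text \<open>Cosets in the abelian group, not in the loop.\<close>

definition coset_rel :: "((int \<times> int \<times> int) \<times> (int \<times> int \<times> int)) set" where
  "coset_rel = {((i, j, k), (i', j', k')). (i, j, k) \<in> carrier_C \<and> (i', j', k') \<in> carrier_C \<and>
     mem (i - i') (j - j') (k - k')}"

lemma coset_rel_iff:
  "((i, j, k), (i', j', k')) \<in> coset_rel \<longleftrightarrow>
    (i, j, k) \<in> carrier_C \<and> (i', j', k') \<in> carrier_C \<and> mem (i - i') (j - j') (k - k')"
  by (simp add: coset_rel_def)

lemma equiv_coset_rel: "equiv carrier_C coset_rel"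
proof (rule equivI)
  show "coset_rel \<subseteq> carrier_C \<times> carrier_C"
    by (auto simp: coset_rel_def)
  show "refl_on carrier_C coset_rel"
    by (auto simp: refl_on_def coset_rel_iff mem_zero)
  show "sym coset_rel"
  proof (rule symI)
    fix u v
    assume uv: "(u, v) \<in> coset_rel"
    obtain i j k i' j' k' where eq: "u = (i, j, k)" "v = (i', j', k')"
      by (metis surj_pair)
    show "(v, u) \<in> coset_rel"
      using uv mem_diff[OF mem_zero, of "i - i'" "j - j'" "k - k'"] by (simp add: eq coset_rel_iff)
  qed
  show "trans coset_rel"
  proof (rule transI)
    fix u v w
    assume uv: "(u, v) \<in> coset_rel" and vw: "(v, w) \<in> coset_rel"
    obtain i j k i' j' k' l m n where eq: "u = (i, j, k)" "v = (i', j', k')" "w = (l, m, n)"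
      by (metis surj_pair)
    show "(u, w) \<in> coset_rel"
      using uv vw mem_add[of "i - i'" "j - j'" "k - k'" "i' - l" "j' - m" "k' - n"]
      by (simp add: eq coset_rel_iff)
  qed
qed

lemma coset_rel_nabla:
  fixes b0 b1 b2 d0 d1 d2 x0 x1 x2 y0 y1 y2
  defines "\<delta> \<equiv> ddet (b0 + x0, b1 + x1, b2 + x2) (d0 + y0, d1 + y1, d2 + y2) - ddet (b0, b1, b2) (d0, d1, d2)"
  shows "(nabla s (b0 + x0, b1 + x1, b2 + x2) (d0 + y0, d1 + y1, d2 + y2), nabla s (b0, b1, b2) (d0, d1, d2)) \<in> coset_rel
    \<longleftrightarrow> mem ((3 * x1 - x0) + (2 * y0 - 3 * y1) + 9 * (s * \<delta>)) ((3 * x2 - x1) + (2 * y1 - 3 * y2)) (- x2 + 2 * y2)"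
proof -
  have *: "(reduce (i, j, k), reduce (i', j', k')) \<in> coset_rel \<longleftrightarrow> mem (i - i') (j - j') (k - k')" for i j k i' j' k'
  proof -
    have "(reduce (i, j, k), reduce (i', j', k')) \<in> coset_rel
      \<longleftrightarrow> mem (i mod 27 - i' mod 27) (j mod 9 - j' mod 9) (k mod 3 - k' mod 3)"
      using reduce_in_carrier_C[of "(i, j, k)"] reduce_in_carrier_C[of "(i', j', k')"]
      by (simp add: reduce_def coset_rel_iff)
    also have "\<dots> \<longleftrightarrow> mem (i - i') (j - j') (k - k')"
      by (rule mem_cong) (simp_all add: cong_def mod_diff_eq)
    finally show ?thesis .
  qed
  show ?thesis
    unfolding nabla_eq_reduce nabla_raw.simps *
  proof (rule mem_cong; unfold cong_iff_dvd_diff)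
  qed (rule dvdI[where k = "x0 + y1"], simp add: \<delta>_def algebra_simps del: ddet.simps,
      rule dvdI[where k = "x1 + y2"], simp, rule dvdI[where k = x2], simp)
qed

text \<open>For x = a - b and y = c - d the two products differ by F x + G y + 9 s \<delta>.
  Elements lie in H exactly when their images under F or G do, and 9 s \<delta> lies in H once the
  coordinates of x and y satisfy \<open>socle\<close>.\<close>

lemma normal_congruence_coset_rel: "normal_congruence carrier_C (nabla s) coset_rel"
proof (rule normal_congruenceI[OF equiv_coset_rel])
  fix a b c d :: "int \<times> int \<times> int"
  assume C: "a \<in> carrier_C" "b \<in> carrier_C" "c \<in> carrier_C" "d \<in> carrier_C"
  obtain a0 a1 a2 b0 b1 b2 c0 c1 c2 d0 d1 d2 where tuples: "a = (a0, a1, a2)" "b = (b0, b1, b2)"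
    "c = (c0, c1, c2)" "d = (d0, d1, d2)"
    by (metis surj_pair)
  define x0 x1 x2 y0 y1 y2 where diffs: "x0 = a0 - b0" "x1 = a1 - b1" "x2 = a2 - b2"
    "y0 = c0 - d0" "y1 = c1 - d1" "y2 = c2 - d2"
  define \<delta> where "\<delta> = ddet (b0 + x0, b1 + x1, b2 + x2) (d0 + y0, d1 + y1, d2 + y2) - ddet (b0, b1, b2) (d0, d1, d2)"
  have ac: "a = (b0 + x0, b1 + x1, b2 + x2)" "c = (d0 + y0, d1 + y1, d2 + y2)"
    by (simp_all add: tuples diffs)
  have ab_iff: "(a, b) \<in> coset_rel \<longleftrightarrow> mem x0 x1 x2" and cd_iff: "(c, d) \<in> coset_rel \<longleftrightarrow> mem y0 y1 y2"
    using C by (simp_all add: tuples coset_rel_iff diffs)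
  have prod_iff: "(nabla s a c, nabla s b d) \<in> coset_rel \<longleftrightarrow>
      mem ((3 * x1 - x0) + (2 * y0 - 3 * y1) + 9 * (s * \<delta>)) ((3 * x2 - x1) + (2 * y1 - 3 * y2)) (- x2 + 2 * y2)"
    unfolding ac tuples(2,4) \<delta>_def by (rule coset_rel_nabla)
  have socle_\<delta>: "socle (s * \<delta>)" if "socle x0" "socle x1" "socle x2" "socle y0" "socle y1" "socle y2"
    unfolding \<delta>_def by (intro socle_mult socle_ddet_diff that)
  show "(nabla s a c, nabla s b d) \<in> coset_rel" if "(a, b) \<in> coset_rel" "(c, d) \<in> coset_rel"
  proof -
    have x: "mem x0 x1 x2" and y: "mem y0 y1 y2"
      using that ab_iff cd_iff by simp_all
    show ?thesis
      unfolding prod_iff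
      by (rule mem_add_socle[OF mem_add[OF x[unfolded mem_F[of x0]] y[unfolded mem_G[of y0]]]
            socle_\<delta>[OF socle_coords[OF x] socle_coords[OF y]]])
  qed
  show "(c, d) \<in> coset_rel" if "(a, b) \<in> coset_rel" "(nabla s a c, nabla s b d) \<in> coset_rel"
  proof -
    have x: "mem x0 x1 x2"
      using that ab_iff by simp
    have u: "mem (2 * y0 - 3 * y1 + 9 * (s * \<delta>)) (2 * y1 - 3 * y2) (2 * y2)"
      using mem_diff[OF that(2)[unfolded prod_iff] x[unfolded mem_F[of x0]]] by (simp add: algebra_simps)
    \<comment> \<open>It is not yet known that y lies in H, but u agrees with 2 y modulo 3 in each
      coordinate, and 2 * 2 = 1 modulo 3. This suffices to place 9 s \<delta> in H.\<close>
    have two: "socle y" if "socle (2 * y + 3 * z)" for y z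
      using socle_mult[OF that, of 2] socle_cong[of "2 * (2 * y + 3 * z)" y]
      by (simp add: cong_iff_dvd_diff)
    have "socle y0" "socle y1" "socle y2"
      using two[of y0 "3 * (s * \<delta>) - y1"] two[of y1 "- y2"] two[of y2 0] socle_coords[OF u]
      by (simp_all add: algebra_simps)
    then have "socle (- (s * \<delta>))"
      using socle_mult[OF socle_\<delta>[OF socle_coords[OF x]], of "-1"] by simp
    from mem_add_socle[OF u this] have "mem (2 * y0 - 3 * y1) (2 * y1 - 3 * y2) (2 * y2)"
      by simp
    then show ?thesis
      unfolding cd_iff by (simp only: mem_G[of y0 y1 y2])
  qed
  show "(a, b) \<in> coset_rel" if "(c, d) \<in> coset_rel" "(nabla s a c, nabla s b d) \<in> coset_rel"
  proof -
    have y: "mem y0 y1 y2"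
      using that cd_iff by simp
    have u: "mem (3 * x1 - x0 + 9 * (s * \<delta>)) (3 * x2 - x1) (- x2)"
      using mem_diff[OF that(2)[unfolded prod_iff] y[unfolded mem_G[of y0]]] by (simp add: algebra_simps)
    have one: "socle x" if "socle (3 * z - x)" for x z
      using socle_mult[OF that, of "-1"] socle_cong[of "- 1 * (3 * z - x)" x]
      by (simp add: cong_iff_dvd_diff)
    have "socle x0" "socle x1" "socle x2"
      using one[of "3 * (s * \<delta>) + x1" x0] one[of x2 x1] one[of 0 x2] socle_coords[OF u]
      by (simp_all add: algebra_simps)
    then have "socle (- (s * \<delta>))"
      using socle_mult[OF socle_\<delta>[OF _ _ _ socle_coords[OF y]], of "-1"] by simp
    from mem_add_socle[OF u this] have "mem (3 * x1 - x0) (3 * x2 - x1) (- x2)"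
      by simp
    then show ?thesis
      unfolding ab_iff by (simp only: mem_F[of x0 x1 x2])
  qed
qed

lemma normal_H: "normal_subquasigroup H carrier_C (nabla s)"
proof -
  have "v \<in> H \<longleftrightarrow> ((0, 0, 0), v) \<in> coset_rel" for v
  proof (cases "v \<in> carrier_C")
    case True
    obtain i j k where v: "v = (i, j, k)"
      by (cases v)
    have "v \<in> H \<longleftrightarrow> mem i j k"
      using True by (simp add: mem_def v)
    also have "\<dots> \<longleftrightarrow> mem (- i) (- j) (- k)"
      using mem_mult[of i j k "-1"] mem_mult[of "- i" "- j" "- k" "-1"] by auto
    also have "\<dots> \<longleftrightarrow> ((0, 0, 0), v) \<in> coset_rel"
      using True H_subset[OF zero] by (simp add: v coset_rel_iff)
    finally show ?thesis .
  next
    case False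
    then show ?thesis
      using H_subset[of v] by (auto simp: coset_rel_def)
  qed
  then have "H = coset_rel `` {(0, 0, 0)}"
    by auto
  then have "H \<in> carrier_C // coset_rel"
    using quotientI[OF H_subset[OF zero], of coset_rel] by simp
  then show ?thesis
    unfolding normal_subquasigroup_def using H normal_congruence_coset_rel by blast
qed

end

lemma zero_in_carrier_C: "(0, 0, 0) \<in> carrier_C"
  by (simp add: carrier_C_def)

lemma hamiltonian_nabla: "hamiltonian carrier_C (nabla s)"
  by (rule hamiltonian_if_normal_at[OF finite_carrier_C quasigroup_nabla distributive_nabla zero_in_carrier_C])
    (rule normal_H)

section \<open>Isomorphisms and anti-isomorphisms\<close>

definition loop_add :: "int \<Rightarrow> int \<times> int \<times> int \<Rightarrow> int \<times> int \<times> int \<Rightarrow> int \<times> int \<times> int" where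
  "loop_add s v w = reduce (loop_raw s v w)"

lemma loop_raw_cong:
  assumes "reduce v = reduce v'" "reduce w = reduce w'"
  shows "reduce (loop_raw s v w) = reduce (loop_raw s v' w')"
proof -
  obtain i j k l m n i' j' k' l' m' n' where eq: "v = (i, j, k)" "w = (l, m, n)" "v' = (i', j', k')" "w' = (l', m', n')"
    by (metis surj_pair)
  have c: "[i = i'] (mod 27)" "[j = j'] (mod 9)" "[k = k'] (mod 3)"
    "[l = l'] (mod 27)" "[m = m'] (mod 9)" "[n = n'] (mod 3)"
    using assms by (simp_all add: eq reduce_eq_iff)
  have "[ddet (i, j, k) (l, m, n) = ddet (i', j', k') (l', m', n')] (mod 3)"
    by (rule ddet_cong[OF cong_27_3[OF c(1)] cong_9_3[OF c(2)] c(3) cong_27_3[OF c(4)] cong_9_3[OF c(5)] c(6)])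
  from cong_scale[OF cong_scalar_left[OF this], of 27 9 "- s"]
  have "[i + l + 9 * (- s * ddet (i, j, k) (l, m, n)) = i' + l' + 9 * (- s * ddet (i', j', k') (l', m', n'))] (mod 27)"
    by (intro cong_add c(1) c(4)) simp
  then show ?thesis
    unfolding eq loop_raw.simps reduce_eq_iff using cong_add[OF c(2) c(5)] cong_add[OF c(3) c(6)] by blast
qed

lemma loop_add_reduce: "loop_add s (reduce v) w = loop_add s v w" "loop_add s v (reduce w) = loop_add s v w"
  unfolding loop_add_def by (rule loop_raw_cong; simp)+

lemma loop_add_in_carrier_C: "loop_add t v w \<in> carrier_C"
  by (simp add: loop_add_def)

text \<open>\<open>tripling\<close> and \<open>shift\<close> are multiplication by 3 and \<zeta>.
  For either sign they are expressible through the product and zero, so an isomorphism fixing zero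
  commutes with them.\<close>

fun tripling :: "int \<times> int \<times> int \<Rightarrow> int \<times> int \<times> int" where
  "tripling (i, j, k) = reduce (3 * i, 3 * j, 0)"

fun shift :: "int \<times> int \<times> int \<Rightarrow> int \<times> int \<times> int" where
  "shift (i, j, k) = reduce (3 * j, 3 * k, 0)"

lemma tripling_eq: "tripling v = loop_add t (loop_add t v v) v"
proof (cases v)
  case (fields i j k)
  show ?thesis
    unfolding loop_add_def[of t v v] loop_add_reduce
    by (simp add: loop_add_def fields reduce_eq_iff cong_iff_dvd_diff)
qed

lemma shift_eq: "shift v = loop_add t v (nabla t v (0, 0, 0))"
proof (cases v)
  case (fields i j k)
  have "[3 * j = i + (3 * j - i) + 9 * ((- t) * ddet (i, j, k) (3 * j - i, 3 * k - j, - k))] (mod 27)"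
    unfolding cong_iff_dvd_diff
    by (rule dvdI[where k = "2 * t * k * (j * j - i * k)"]) (simp add: algebra_simps)
  then show ?thesis
    unfolding fields nabla_zero_right loop_add_reduce
    unfolding shift.simps loop_add_def loop_raw.simps reduce_eq_iff by (simp del: ddet.simps)
qed

context
  fixes s s' :: int and h
  assumes bij: "bij_betw h carrier_C carrier_C"
    and hom: "\<And>v w. v \<in> carrier_C \<Longrightarrow> w \<in> carrier_C \<Longrightarrow> h (nabla s v w) = nabla s' (h v) (h w)"
    and h0: "h (0, 0, 0) = (0, 0, 0)"
begin

lemma h_C: "v \<in> carrier_C \<Longrightarrow> h v \<in> carrier_C"
  using bij by (rule bij_betw_apply)

text \<open>Loop addition is built from the product and the divisions by zero, all of which are
  preserved by an isomorphism fixing zero.\<close>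

lemma hom_loop_add:
  assumes v: "v \<in> carrier_C" and w: "w \<in> carrier_C"
  shows "h (loop_add s v w) = loop_add s' (h v) (h w)"
proof -
  note C0 = zero_in_carrier_C
  let ?x = "reduce (F_inv v)" and ?y = "reduce (G_inv w)"
  have F: "nabla t (reduce (F_inv v)) (0, 0, 0) = v" if "v \<in> carrier_C" for t v
    using nabla_reduce[of t "F_inv v" "(0, 0, 0)"] that C0 by (simp only: reduce_id nabla_F_inv)
  have G: "nabla t (0, 0, 0) (reduce (G_inv v)) = v" if "v \<in> carrier_C" for t v
    using nabla_reduce[of t "(0, 0, 0)" "G_inv v"] that C0 by (simp only: reduce_id nabla_G_inv)
  have "nabla s' (h ?x) (0, 0, 0) = h v"
    using hom[OF reduce_in_carrier_C C0, of "F_inv v"] by (simp only: F[OF v] h0)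
  also have "\<dots> = nabla s' (reduce (F_inv (h v))) (0, 0, 0)"
    by (rule F[OF h_C[OF v], symmetric])
  finally have x: "h ?x = reduce (F_inv (h v))"
    using C0 h_C[OF reduce_in_carrier_C] reduce_in_carrier_C by (rule nabla_right_cancel[rotated 3])
  have "nabla s' (0, 0, 0) (h ?y) = h w"
    using hom[OF C0 reduce_in_carrier_C, of "G_inv w"] by (simp only: G[OF w] h0)
  also have "\<dots> = nabla s' (0, 0, 0) (reduce (G_inv (h w)))"
    by (rule G[OF h_C[OF w], symmetric])
  finally have y: "h ?y = reduce (G_inv (h w))"
    using C0 h_C[OF reduce_in_carrier_C] reduce_in_carrier_C by (rule nabla_left_cancel[rotated 3])
  have "h (nabla s ?x ?y) = nabla s' (h ?x) (h ?y)"
    by (rule hom) simp_all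
  then show ?thesis
    unfolding x y nabla_reduce nabla_F_inv_G_inv loop_add_def .
qed

lemma hom_tripling: "v \<in> carrier_C \<Longrightarrow> h (tripling v) = tripling (h v)"
  using tripling_eq[of v s] tripling_eq[of "h v" s'] hom_loop_add loop_add_in_carrier_C by simp

lemma hom_shift: "v \<in> carrier_C \<Longrightarrow> h (shift v) = shift (h v)"
  using shift_eq[of v s] shift_eq[of "h v" s'] hom_loop_add[OF _ nabla_in_carrier_C] hom[OF _ zero_in_carrier_C]
  by (simp add: h0)

end

text \<open>The base triple \<open>(1, 0, 0)\<close>, \<open>(0, 1, 0)\<close>, \<open>(0, 0, 1)\<close> is characterised up to a common sign \<open>u\<close>,
  modulo 3, by \<open>9 x = 3 \<zeta> y = \<zeta>\<^sup>2 w \<noteq> 0\<close>, the other such multiples being zero. Since \<open>u\<^sup>3 = u\<close> modulo 3, the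
  sign of the associator relative to this common value is an invariant.\<close>

lemma not_isomorphic_fixing_zero:
  assumes bij: "bij_betw h carrier_C carrier_C"
    and hom: "\<And>v w. v \<in> carrier_C \<Longrightarrow> w \<in> carrier_C \<Longrightarrow> h (nabla 1 v w) = nabla (-1) (h v) (h w)"
    and h0: "h (0, 0, 0) = (0, 0, 0)"
  shows False
proof -
  note T = hom_tripling[OF bij hom h0] and S = hom_shift[OF bij hom h0]
    and A = hom_loop_add[OF bij hom h0]
  have C: "(1, 0, 0) \<in> carrier_C" "(0, 1, 0) \<in> carrier_C" "(0, 0, 1) \<in> carrier_C"
    "(3, 0, 0) \<in> carrier_C" "(0, 3, 0) \<in> carrier_C" "(9, 0, 0) \<in> carrier_C" "(1, 1, 0) \<in> carrier_C"
    "(0, 1, 1) \<in> carrier_C" "(19, 1, 1) \<in> carrier_C"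
    by (simp_all add: carrier_C_def)
  obtain x0 x1 x2 where x: "h (1, 0, 0) = (x0, x1, x2)"
    by (metis surj_pair)
  obtain y0 y1 y2 where y: "h (0, 1, 0) = (y0, y1, y2)"
    by (metis surj_pair)
  obtain w0 w1 w2 where w: "h (0, 0, 1) = (w0, w1, w2)"
    by (metis surj_pair)
  have t_reduce: "tripling (reduce v) = tripling v" and s_reduce: "shift (reduce v) = shift v" for v
  proof -
    obtain i j k where v: "v = (i, j, k)"
      by (cases v)
    have c: "[i mod 27 = i] (mod 27)" "[j mod 9 = j] (mod 9)" "[k mod 3 = k] (mod 3)"
      by (simp_all add: cong_def)
    have "[3 * (i mod 27) = 3 * i] (mod 27)" "[3 * (j mod 9) = 3 * j] (mod 27)" "[3 * (j mod 9) = 3 * j] (mod 9)"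
      "[3 * (k mod 3) = 3 * k] (mod 9)"
      using cong_scale[OF c(1), of 27 3] cong_scale[OF c(2), of 27 3] cong_scale[OF c(2), of 9 3]
        cong_scale[OF c(3), of 9 3] by simp_all
    moreover have "reduce v = (i mod 27, j mod 9, k mod 3)"
      by (simp add: v reduce_def)
    ultimately show "tripling (reduce v) = tripling v" "shift (reduce v) = shift v"
      unfolding \<open>reduce v = _\<close> unfolding v tripling.simps shift.simps reduce_eq_iff by auto
  qed
  have "h (9, 0, 0) = tripling (tripling (h (1, 0, 0)))"
    using T[of "(1, 0, 0)"] T[of "(3, 0, 0)"] C by (simp add: reduce_def)
  then have s1: "h (9, 0, 0) = reduce (9 * x0, 9 * x1, 0)"
    by (simp add: x t_reduce)
  have "h (9, 0, 0) = tripling (shift (h (0, 1, 0)))"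
    using S[of "(0, 1, 0)"] T[of "(3, 0, 0)"] C by (simp add: reduce_def)
  then have s2: "h (9, 0, 0) = reduce (9 * y1, 9 * y2, 0)"
    by (simp add: y t_reduce)
  have "h (9, 0, 0) = shift (shift (h (0, 0, 1)))"
    using S[of "(0, 0, 1)"] S[of "(0, 3, 0)"] C by (simp add: reduce_def)
  then have s3: "h (9, 0, 0) = reduce (9 * w2, 0, 0)"
    by (simp add: w s_reduce)
  have "shift (h (1, 0, 0)) = (0, 0, 0)"
    using S[of "(1, 0, 0)"] C by (simp add: reduce_def h0)
  then have x12: "27 dvd 3 * x1" "9 dvd 3 * x2"
    by (auto simp: x reduce_def)
  have "tripling (tripling (h (0, 1, 0))) = (0, 0, 0)"
    using T[of "(0, 1, 0)"] T[of "(0, 3, 0)"] C by (simp add: reduce_def h0)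
  then have y0: "27 dvd 9 * y0"
    by (auto simp: y t_reduce) (auto simp: reduce_def)
  have "shift (shift (h (0, 1, 0))) = (0, 0, 0)"
    using S[of "(0, 1, 0)"] S[of "(3, 0, 0)"] C by (simp add: reduce_def h0)
  then have y2: "27 dvd 9 * y2"
    by (auto simp: y s_reduce) (auto simp: reduce_def)
  have "tripling (h (0, 0, 1)) = (0, 0, 0)"
    using T[of "(0, 0, 1)"] C by (simp add: reduce_def h0)
  then have w01: "27 dvd 3 * w0" "9 dvd 3 * w1"
    by (auto simp: w reduce_def)
  have "reduce (9 * w2, 0, 0) \<noteq> reduce (0, 0, 0)"
    using bij C zero_in_carrier_C s3 h0 unfolding bij_betw_def inj_on_def
    by (metis Pair_inject reduce_id zero_neq_numeral)
  then have u: "\<not> 3 dvd w2"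
    unfolding reduce_eq_iff by (auto simp: cong_iff_dvd_diff)
  have zeros: "[x1 = 0] (mod 3)" "[x2 = 0] (mod 3)" "[y0 = 0] (mod 3)" "[y2 = 0] (mod 3)"
    "[w0 = 0] (mod 3)" "[w1 = 0] (mod 3)"
    using x12 y0 y2 w01 by (simp_all add: cong_iff_dvd_diff) presburger+
  have "27 dvd 9 * w2 - 9 * x0" "27 dvd 9 * w2 - 9 * y1"
    using trans[OF s3[symmetric] s1] trans[OF s3[symmetric] s2]
    unfolding reduce_eq_iff cong_iff_dvd_diff by blast+
  then have us: "[x0 = w2] (mod 3)" "[y1 = w2] (mod 3)"
    by (simp_all add: cong_iff_dvd_diff) presburger+
  \<comment> \<open>The associator of the base triple is (9, 0, 0) for sign 1; its image under h
    must be the associator of the image triple for sign -1.\<close>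
  have e1: "loop_add 1 (loop_add 1 (1, 0, 0) (0, 1, 0)) (0, 0, 1)
      = loop_add 1 (9, 0, 0) (loop_add 1 (1, 0, 0) (loop_add 1 (0, 1, 0) (0, 0, 1)))"
    by (simp add: loop_add_def reduce_def)
  let ?L = "loop_raw (-1)"
  let ?x = "(x0, x1, x2)" and ?y = "(y0, y1, y2)" and ?w = "(w0, w1, w2)"
  have "reduce (?L (?L ?x ?y) ?w) = reduce (?L (9 * w2, 0, 0) (?L ?x (?L ?y ?w)))"
  proof -
    have "loop_add (-1) (loop_add (-1) ?x ?y) ?w = loop_add (-1) (reduce (9 * w2, 0, 0)) (loop_add (-1) ?x (loop_add (-1) ?y ?w))"
      using arg_cong[OF e1, of h] C by (simp only: A loop_add_in_carrier_C x y w s3)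
    then show ?thesis
      unfolding loop_add_reduce
      by (simp only: loop_add_def[of _ ?x ?y] loop_add_def[of _ ?y ?w] loop_add_reduce)
        (simp only: loop_add_def[of _ ?x] loop_add_reduce, simp only: loop_add_def)
  qed
  moreover define a1 a2 a3 a4 a5 where "a1 = ddet ?x ?y" and "a2 = ddet (?L ?x ?y) ?w"
    and "a3 = ddet ?y ?w" and "a4 = ddet ?x (?L ?y ?w)" and "a5 = ddet (9 * w2, 0, 0) (?L ?x (?L ?y ?w))"
  ultimately have "27 dvd 9 * (a1 + a2 - w2 - a3 - a4 - a5)"
    by (simp add: reduce_eq_iff cong_iff_dvd_diff algebra_simps del: ddet.simps)
  then have sum_w: "[a1 + a2 - a3 - a4 - a5 = w2] (mod 3)"
    by (simp add: cong_iff_dvd_diff) presburger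
  \<comment> \<open>With u = w2, modulo 3 the images are (u, 0, 0), (0, u, 0), (0, 0, u). Only a4
    survives, with value u^3 = u, and u = -u follows.\<close>
  have sum_c: "[a1 + a2 - a3 - a4 - a5 = 0 + 0 - 0 - w2 * w2 * w2 - 0] (mod 3)"
  proof -
    have nine: "[p + q + 9 * r = p' + q'] (mod 3)" if "[p = p'] (mod 3)" "[q = q'] (mod 3)" for p q r p' q' :: int
      using cong_add[OF cong_add[OF that], of "9 * r" 0] by (simp add: cong_iff_dvd_diff)
    have "[a1 = ddet (w2, 0, 0) (0, w2, 0)] (mod 3)"
      unfolding a1_def by (intro ddet_cong zeros us)
    moreover have "[a2 = ddet (w2 + 0, 0 + w2, 0 + 0) (0, 0, w2)] (mod 3)"
      unfolding a2_def loop_raw.simps by (intro ddet_cong nine cong_add zeros us cong_refl)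
    moreover have "[a3 = ddet (0, w2, 0) (0, 0, w2)] (mod 3)"
      unfolding a3_def by (intro ddet_cong zeros us cong_refl)
    moreover have "[a4 = ddet (w2, 0, 0) (0 + 0, w2 + 0, 0 + w2)] (mod 3)"
      unfolding a4_def loop_raw.simps by (intro ddet_cong nine cong_add zeros us cong_refl)
    moreover have "[a5 = ddet (0, 0, 0) (?L ?x (?L ?y ?w))] (mod 3)"
    proof -
      have "[9 * w2 = 0] (mod 3)"
        by (simp add: cong_iff_dvd_diff)
      then show ?thesis
        unfolding a5_def loop_raw.simps by (intro ddet_cong cong_refl)
    qed
    ultimately show ?thesis
      by (intro cong_add cong_diff) (simp_all add: mult.assoc)
  qed
  have cube: "[w2 * w2 * w2 = w2] (mod 3)"
  proof -
    have "w2 mod 3 = 0 \<or> w2 mod 3 = 1 \<or> w2 mod 3 = 2"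
      by presburger
    then have "[(w2 mod 3) * (w2 mod 3) * (w2 mod 3) = w2] (mod 3)"
      by (auto simp: cong_def)
    moreover have "[(w2 mod 3) * (w2 mod 3) * (w2 mod 3) = w2 * w2 * w2] (mod 3)"
      by (intro cong_mult) (simp_all add: cong_def)
    ultimately show ?thesis
      using cong_sym cong_trans by blast
  qed
  have "[w2 = 0 - w2] (mod 3)"
    using cong_trans[OF cong_sym[OF sum_w] sum_c] cong_diff[OF cong_refl[of 0] cube] cong_trans by auto
  then have "3 dvd w2"
    by (simp add: cong_iff_dvd_diff) presburger
  with u show False ..
qed

text \<open>A left translation of the target is an automorphism and brings the image of zero back to
  zero.\<close>

lemma not_isomorphic_nabla: "\<not> isomorphic carrier_C (nabla 1) carrier_C (nabla (-1))"
proof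
  assume "isomorphic carrier_C (nabla 1) carrier_C (nabla (-1))"
  then obtain g where g: "bij_betw g carrier_C carrier_C"
    and hom: "\<And>v w. v \<in> carrier_C \<Longrightarrow> w \<in> carrier_C \<Longrightarrow> g (nabla 1 v w) = nabla (-1) (g v) (g w)"
    unfolding isomorphic_def by blast
  note C0 = zero_in_carrier_C
  have "g (0, 0, 0) \<in> carrier_C"
    using g C0 by (rule bij_betw_apply)
  then obtain a where a: "a \<in> carrier_C" "nabla (-1) a (g (0, 0, 0)) = (0, 0, 0)"
    using quasigroup_nabla[of "-1"] C0 unfolding quasigroup_def by metis
  show False
  proof (rule not_isomorphic_fixing_zero[of "\<lambda>v. nabla (-1) a (g v)"])
    show "bij_betw (\<lambda>v. nabla (-1) a (g v)) carrier_C carrier_C"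
      using bij_betw_trans[OF g quasigroup_bij_left[OF quasigroup_nabla a(1)]] by (simp add: comp_def)
    show "nabla (-1) a (g (nabla 1 v w)) = nabla (-1) (nabla (-1) a (g v)) (nabla (-1) a (g w))"
      if "v \<in> carrier_C" "w \<in> carrier_C" for v w
      unfolding hom[OF that] by (rule nabla_left_distrib)
    show "nabla (-1) a (g (0, 0, 0)) = (0, 0, 0)"
      by (rule a(2))
  qed
qed

text \<open>The map \<open>\<zeta> \<mapsto> 3 - \<zeta>\<close> exchanges the two translations by \<open>0\<close>; the matrix of the corresponding semilinear
  map has determinant \<open>-1\<close>, and the cubic term corrects the choice of representing cocycle.\<close>

fun anti :: "int \<times> int \<times> int \<Rightarrow> int \<times> int \<times> int" where
  "anti (a0, a1, a2) = (a0 + 9 * ((-1) * (a0 * a1 * (a1 - a0))), a0 - a1, a0 + a1 + a2)"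

lemma anti_reduce: "reduce (anti (reduce v)) = reduce (anti v)"
proof -
  obtain a0 a1 a2 where v: "v = (a0, a1, a2)"
    by (cases v)
  have c: "[a0 mod 27 = a0] (mod 27)" "[a0 mod 27 = a0] (mod 9)" "[a1 mod 9 = a1] (mod 9)"
    "[a0 mod 27 = a0] (mod 3)" "[a1 mod 9 = a1] (mod 3)" "[a2 mod 3 = a2] (mod 3)"
    by (simp_all add: cong_def mod_mod_cancel)
  have "[(a0 mod 27) * (a1 mod 9) * (a1 mod 9 - a0 mod 27) = a0 * a1 * (a1 - a0)] (mod 3)"
    by (intro cong_mult cong_diff c)
  from cong_scale[OF cong_scalar_left[OF this], of 27 9 "-1"]
  have "[a0 mod 27 + 9 * ((-1) * ((a0 mod 27) * (a1 mod 9) * (a1 mod 9 - a0 mod 27)))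
      = a0 + 9 * ((-1) * (a0 * a1 * (a1 - a0)))] (mod 27)"
    by (intro cong_add c) simp
  moreover have "[a0 mod 27 - a1 mod 9 = a0 - a1] (mod 9)" "[a0 mod 27 + a1 mod 9 + a2 mod 3 = a0 + a1 + a2] (mod 3)"
    by (intro cong_diff cong_add c)+
  moreover have "reduce v = (a0 mod 27, a1 mod 9, a2 mod 3)"
    by (simp add: v reduce_def)
  ultimately show ?thesis
    unfolding \<open>reduce v = _\<close> unfolding v anti.simps reduce_eq_iff by blast
qed

text \<open>The cubic correction is a multiple of 9, so a0 is known modulo 9 and then a1 modulo 9.
  This determines the correction modulo 27, hence a0, and at last a2.\<close>

lemma inj_on_anti: "inj_on (\<lambda>v. reduce (anti v)) carrier_C"
proof (rule inj_onI)
  fix v w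
  assume C: "v \<in> carrier_C" "w \<in> carrier_C" and eq: "reduce (anti v) = reduce (anti w)"
  obtain a0 a1 a2 where v: "v = (a0, a1, a2)"
    by (cases v)
  obtain b0 b1 b2 where w: "w = (b0, b1, b2)"
    by (cases w)
  have bd: "0 \<le> a0" "a0 < 27" "0 \<le> a1" "a1 < 9" "0 \<le> a2" "a2 < 3"
    "0 \<le> b0" "b0 < 27" "0 \<le> b1" "b1 < 9" "0 \<le> b2" "b2 < 3"
    using C by (auto simp: v w carrier_C_def)
  define p where "p = (-1) * (a0 * a1 * (a1 - a0))"
  define q where "q = (-1) * (b0 * b1 * (b1 - b0))"
  have c: "[a0 + 9 * p = b0 + 9 * q] (mod 27)" "[a0 - a1 = b0 - b1] (mod 9)" "[a0 + a1 + a2 = b0 + b1 + b2] (mod 3)"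
    using eq by (simp_all only: v w anti.simps reduce_eq_iff p_def q_def)
  have "[a0 + 9 * p = b0 + 9 * q] (mod 9)"
    using c(1) by (rule cong_dvd_modulus) simp
  then have c0: "[a0 = b0] (mod 9)"
    by (simp add: cong_def)
  have "[a0 - (a0 - a1) = b0 - (b0 - b1)] (mod 9)"
    by (intro cong_diff c0 c)
  then have c1: "[a1 = b1] (mod 9)"
    by simp
  have 1: "a1 = b1"
    by (rule residue_eqI[of 9 1]) (use c1 bd in \<open>simp_all add: cong_iff_dvd_diff\<close>)
  have "[p = q] (mod 3)"
    unfolding p_def q_def using cong_9_3[OF c0] cong_9_3[OF c1] by (intro cong_mult cong_diff cong_refl)
  from cong_scale[OF this, of 27 9] have "[a0 + 9 * p - 9 * p = b0 + 9 * q - 9 * q] (mod 27)"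
    by (intro cong_diff c) simp
  then have "[a0 = b0] (mod 27)"
    by simp
  then have 0: "a0 = b0"
    by (intro residue_eqI[of 27 1]) (use bd in \<open>simp_all add: cong_iff_dvd_diff\<close>)
  have "a2 = b2"
    by (rule residue_eqI[of 3 1]) (use c(3) 0 1 bd in \<open>simp_all add: cong_iff_dvd_diff\<close>)
  then show "v = w"
    by (simp add: v w 0 1)
qed

lemma anti_nabla: "reduce (anti (nabla 1 a b)) = nabla (-1) (reduce (anti b)) (reduce (anti a))"
proof -
  obtain a0 a1 a2 where a: "a = (a0, a1, a2)"
    by (cases a)
  obtain b0 b1 b2 where b: "b = (b0, b1, b2)"
    by (cases b)
  have neg: "[26 * a0 + 3 * a1 + 2 * b0 + 24 * b1 + 9 * (1 * ddet (a0, a1, a2) (b0, b1, b2)) = - a0 - b0] (mod 3)"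
    "[8 * a1 + 3 * a2 + 2 * b1 + 6 * b2 = - a1 - b1] (mod 3)"
    unfolding cong_iff_dvd_diff by presburger+
  have nine: "[i + 9 * r = i] (mod 3)" for i r :: int
    by (simp add: cong_iff_dvd_diff)
  have "reduce (anti (nabla_raw 1 a b)) = reduce (nabla_raw (-1) (anti b) (anti a))"
    unfolding a b nabla_raw.simps anti.simps reduce_eq_iff
  proof (rule conjI[OF cong_lift conjI])
    show "[(26 * a0 + 3 * a1 + 2 * b0 + 24 * b1 + 9 * (1 * ddet (a0, a1, a2) (b0, b1, b2)))
        * (8 * a1 + 3 * a2 + 2 * b1 + 6 * b2)
        * ((8 * a1 + 3 * a2 + 2 * b1 + 6 * b2)
          - (26 * a0 + 3 * a1 + 2 * b0 + 24 * b1 + 9 * (1 * ddet (a0, a1, a2) (b0, b1, b2))))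
       = (- a0 - b0) * (- a1 - b1) * ((- a1 - b1) - (- a0 - b0))] (mod 3)"
      by (intro cong_mult cong_diff neg)
    show "[ddet (b0 + 9 * ((-1) * (b0 * b1 * (b1 - b0))), b0 - b1, b0 + b1 + b2)
        (a0 + 9 * ((-1) * (a0 * a1 * (a1 - a0))), a0 - a1, a0 + a1 + a2)
       = ddet (b0, b0 - b1, b0 + b1 + b2) (a0, a0 - a1, a0 + a1 + a2)] (mod 3)"
      by (intro ddet_cong nine cong_refl)
  \<comment> \<open>Quotients of the expanded differences by 27, 9 and 3. In the first coordinate
    the cubic correction absorbs what the linear change of coordinates leaves of the two
    cocycles.\<close>
  qed (unfold cong_iff_dvd_diff ddet.simps,
      rule dvdI[where k = "- a0 * a0 * a1 + a0 * a1 * a1 - a0 * a1 * b0 + a0 * a1 * b1 - a0 * b0 * b1 + a1 + a1 * b0 * b1 - b0 - 9 * b0 * b0 * b1 + 9 * b0 * b1 * b1 + b1"],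
      simp add: algebra_simps,
      rule dvdI[where k = "2 * a0 - a0 * a2 * b1 + a0 * b1 * b2 - a1 + a1 * a2 * b0 - a1 * b0 * b2 - a2 - b0 + 3 * b1 - b2"],
      simp add: algebra_simps,
      rule dvdI[where k = "8 * a0 - 3 * a0 * a2 * b1 + 3 * a0 * b1 * b2 + 3 * a1 + 3 * a1 * a2 * b0 - 3 * a1 * b0 * b2 + a2 + 8 * b1 + 2 * b2"],
      simp add: algebra_simps)
  then show ?thesis
    by (simp only: nabla_reduce) (simp only: nabla_eq_reduce anti_reduce)
qed

lemma anti_isomorphic_nabla: "anti_isomorphic carrier_C (nabla 1) carrier_C (nabla (-1))"
proof -
  have "(\<lambda>v. reduce (anti v)) ` carrier_C = carrier_C"
    by (rule endo_inj_surj[OF finite_carrier_C _ inj_on_anti]) auto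
  then have "bij_betw (\<lambda>v. reduce (anti v)) carrier_C carrier_C"
    using inj_on_anti by (simp add: bij_betw_def)
  then show ?thesis
    unfolding anti_isomorphic_def using anti_nabla by blast
qed

section \<open>The classification\<close>

context hamiltonian_loop
begin

lemma medial_if_associative:
  assumes "\<And>x y w. x \<in> Q \<Longrightarrow> y \<in> Q \<Longrightarrow> w \<in> Q \<Longrightarrow> asc x y w = e"
  shows "medial Q m"
  using medialI[OF assms] by (simp add: medial_def m_eq)

lemma card_ge_729:
  assumes "\<not> medial Q m"
  shows "729 \<le> card Q"
    and "card Q = 729 \<Longrightarrow> isomorphic Q m carrier_C (nabla 1) \<or> isomorphic Q m carrier_C (nabla (-1))"
proof -
  obtain a b c where abc: "a \<in> Q" "b \<in> Q" "c \<in> Q" "asc a b c \<noteq> e"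
    using assms medial_if_associative by blast
  obtain N where "hamiltonian_loop_max Q (\<boxplus>) e F G m a b c N"
    using ex_hamiltonian_loop_max[OF abc] by blast
  then interpret max: hamiltonian_loop_max Q "(\<boxplus>)" e F G m a b c N .
  show "729 \<le> card Q"
    by (rule max.card_Q_ge)
  assume card_Q: "card Q = 729"
  obtain a' b' c' where basis: "a' \<in> Q" "b' \<in> Q" "c' \<in> Q"
    "\<zeta> a' = e" "\<zeta> b' = triple a'" "\<zeta> c' = triple b'" "triple c' = e"
    "triple (triple b') = e" "triple (triple a') \<noteq> e" "triple (triple (triple a')) = e"
    "asc a' b' c' = triple (triple a') \<or> asc a' b' c' = neg (triple (triple a'))"
    using max.ex_basis[OF card_Q] by blast
  from basis(11) show "isomorphic Q m carrier_C (nabla 1) \<or> isomorphic Q m carrier_C (nabla (-1))"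
  proof
    assume "asc a' b' c' = triple (triple a')"
    then interpret hamiltonian_basis Q "(\<boxplus>)" e F G m a' b' c' 1
      using basis card_Q by unfold_locales simp_all
    show ?thesis
      using isomorphic_nabla ..
  next
    assume "asc a' b' c' = neg (triple (triple a'))"
    then interpret hamiltonian_basis Q "(\<boxplus>)" e F G m a' b' c' "-1"
      using basis card_Q by unfold_locales simp_all
    show ?thesis
      using isomorphic_nabla ..
  qed
qed

end

lemma nonmedial_hamiltonian_distributive_quasigroup_loop:
  assumes Q: "nonmedial_hamiltonian_distributive_quasigroup Q f" and fin: "finite Q"
  obtains add e F G where "hamiltonian_loop Q add e F G f" "\<not> medial Q f"
proof -
  have qg: "quasigroup Q f" and distr: "distributive Q f" and "hamiltonian Q f" and "\<not> medial Q f"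
    using Q by (simp_all add: nonmedial_hamiltonian_distributive_quasigroup_def)
  obtain e where e: "e \<in> Q"
    using qg by (auto simp: quasigroup_def)
  obtain add F G where "belousov_loop Q add e F G"
    and "\<And>x y. x \<in> Q \<Longrightarrow> y \<in> Q \<Longrightarrow> f x y = add (F x) (G y)"
    using distributive_quasigroup_belousov[OF qg distr e] by blast
  then have "hamiltonian_loop Q add e F G f"
    using fin \<open>hamiltonian Q f\<close> by (simp add: hamiltonian_loop_def hamiltonian_loop_axioms_def)
  then show ?thesis
    using that \<open>\<not> medial Q f\<close> by blast
qed

lemma nonmedial_hamiltonian_distributive_quasigroup_nabla:
  assumes "s = 1 \<or> s = -1"
  shows "nonmedial_hamiltonian_distributive_quasigroup carrier_C (nabla s)"
  unfolding nonmedial_hamiltonian_distributive_quasigroup_def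
  using quasigroup_nabla distributive_nabla hamiltonian_nabla not_medial_nabla[OF assms] by blast

theorem theorem12p8:
  shows "(\<forall>(Q :: 'a set) f. nonmedial_hamiltonian_distributive_quasigroup Q f
            \<longrightarrow> infinite Q \<or> card Q \<ge> 729)
    \<and> nonmedial_hamiltonian_distributive_quasigroup carrier_C nabla1
    \<and> nonmedial_hamiltonian_distributive_quasigroup carrier_C nabla2
    \<and> card carrier_C = 729
    \<and> (\<forall>(Q :: 'a set) f. nonmedial_hamiltonian_distributive_quasigroup Q f \<and> card Q = 729
            \<longrightarrow> isomorphic Q f carrier_C nabla1 \<or> isomorphic Q f carrier_C nabla2)
    \<and> \<not> isomorphic carrier_C nabla1 carrier_C nabla2
    \<and> anti_isomorphic carrier_C nabla1 carrier_C nabla2"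
proof -
  have ge: "card Q \<ge> 729"
    if "nonmedial_hamiltonian_distributive_quasigroup Q f" "finite Q" for Q :: "'a set" and f
    using that hamiltonian_loop.card_ge_729(1)
    by (metis nonmedial_hamiltonian_distributive_quasigroup_loop)
  have iso: "isomorphic Q f carrier_C (nabla 1) \<or> isomorphic Q f carrier_C (nabla (-1))"
    if Q: "nonmedial_hamiltonian_distributive_quasigroup Q f" and "card Q = 729" for Q :: "'a set" and f
  proof -
    have "finite Q"
      using \<open>card Q = 729\<close> card.infinite by fastforce
    then obtain add e F G where "hamiltonian_loop Q add e F G f" "\<not> medial Q f"
      using nonmedial_hamiltonian_distributive_quasigroup_loop[OF Q] by blast
    then show ?thesis
      using \<open>card Q = 729\<close> by (rule hamiltonian_loop.card_ge_729(2))
  qed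
  show ?thesis
    unfolding nabla1_eq nabla2_eq
    using ge iso card_carrier_C not_isomorphic_nabla anti_isomorphic_nabla
      nonmedial_hamiltonian_distributive_quasigroup_nabla[of 1]
      nonmedial_hamiltonian_distributive_quasigroup_nabla[of "-1"]
    by blast
qed

end
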